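(* Let $R$ be a commutative local ring with $2\in R^\times$ and a non-trivial involution $\theta$. Let $n\in\{3,4\}$, let $\pi$ be an isogeny type ($\pi\in\{\mathrm{sc},\mathrm{mid},\mathrm{ad}\}$ if $n=3$, $\pi\in\{\mathrm{sc},\mathrm{ad}\}$ if $n=4$), and let $\delta\in\mathcal E(R,\theta)$. Then the exceptional automorphism $\Theta_\delta^{(n)}$ of $E_\pi^{(n)}$ is standard if and only if $\delta=0$.
   Context: Notation. $J$ is the Jacobson radical of $R$; $\theta\colon r\mapsto\bar r$ is a ring automorphism with $\theta^2=\mathrm{id}$, $\theta\ne\mathrm{id}$. $R_\theta=\{r:\bar r=r\}$, $R_\theta^-=\{r:\bar r=-r\}$, $t^+=(t+\bar t)/2$, $m=n+1$. $E_{ij}$ are matrix units, $\bar A$ is entrywise application of $\theta$. $Q_4=E_{14}-E_{23}+E_{32}-E_{41}$, $Q_5=E_{15}-E_{24}+E_{33}-E_{42}+E_{51}$. $\mathcal E(R,\theta)=\{\delta\in J\cap R_\theta^-:\ \delta R_\theta^-=0,\ \delta(t^2-1)=0\ \text{for all } t\in R_\theta^\times\}$. Groups. Let $\Lambda_r\subseteq\Lambda_{\mathrm{sc}}$ be the root and weight lattices of type $A_n$, $\rho$ the non-trivial diagram automorphism ($\rho(\alpha_i)=\alpha_{n+1-i}$), and $\Lambda_\pi=\Lambda_{\mathrm{sc}}$, $\Lambda_r$, or (for $n=3$, $\pi=\mathrm{mid}$) $\Lambda_r+\mathbb Z\omega_2$. $G_\pi(A_n,R)$ is the group of $R$-points of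 the Chevalley–Demazure group scheme of type $A_n$ with weight lattice $\Lambda_\pi$ ($\mathrm{SL}_m$, $\mathrm{PGL}_m$, $\mathrm{SL}_4/\mu_2$ for sc, ad, mid). $G_\pi^{(n)}=G_{\pi,\sigma}(A_n,R)$ is the fixed-point subgroup of the automorphism $\sigma$ induced by $A\mapsto Q_m(\bar A^t)^{-1}Q_m^{-1}$; so $G_{\mathrm{sc}}^{(n)}=\mathrm{SU}_m(R)=\{A\in\mathrm{SL}_m(R):AQ_m\bar A^t=Q_m\}$. Root elements: for $n=3$ ($t\in R$, $s\in R_\theta$): $x_1(t)=I+tE_{12}+\bar tE_{34}$, $x_2(s)=I+sE_{23}$; for $n=4$ ($t\in R$; $(t,u)\in\mathcal A(R)=\{(t,u)\in R^2:t\bar t=u+\bar u\}$): $x_1(t)=I+tE_{12}+\bar tE_{45}$, $x_2(t,u)=I+tE_{23}+\bar tE_{34}+uE_{24}$; $x_{-i}(\cdot)$ is obtained from $x_i(\cdot)$ by replacing each $E_{jk}$ by $E_{kj}$. $E^{(n)}_{\mathrm{sc}}\subseteq\mathrm{SU}_m(R)$ is the subgroup generated by all $x_{\pm1}(\cdot),x_{\pm2}(\cdot)$; $E_\pi^{(n)}$ is its natural image in $G_\pi^{(n)}$. Exceptional automorphism. $\Theta_\delta^{(n)}$ is the automorphism of $E^{(n)}_{\mathrm{sc}}$ given on generators as follows ($p=t^+$); it fixes the center pointwise and induces an automorphism, denoted the same, of each $E_\pi^{(n)}$. $n=3$: $x_1(t)\mapsto I+tE_{12}+\bar tE_{34}-p\delta(E_{13}+E_{24}+E_{31}+E_{42})-p^2\delta(E_{14}+E_{32})$;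 $x_{-1}(t)\mapsto I+tE_{21}+\bar tE_{43}+p\delta(E_{13}+E_{24}+E_{31}+E_{42})+p^2\delta(E_{23}+E_{41})$; $x_2(s)\mapsto(1+2s\delta)(E_{11}+E_{44})+(1+s\delta)(E_{22}+E_{33})+(s+s^2\delta)E_{23}$; $x_{-2}(s)\mapsto(1-2s\delta)(E_{11}+E_{44})+(1-s\delta)(E_{22}+E_{33})+(s-s^2\delta)E_{32}$. $n=4$: $x_{\pm1}(t)\mapsto\operatorname{diag}(1\pm p\delta,1\pm p\delta,1\mp p\delta,1\pm p\delta,1\pm p\delta)\,x_{\pm1}(t)$; $x_2(t,u)\mapsto x_2(t,u)-p\delta(E_{13}+E_{53}+E_{31}+E_{35})+p^2\delta(E_{14}+E_{54}+E_{21}+E_{25})$; $x_{-2}(t,u)\mapsto x_{-2}(t,u)+p\delta(E_{13}+E_{53}+E_{31}+E_{35})-p^2\delta(E_{12}+E_{52}+E_{41}+E_{45})$. Standard automorphisms of $E_\pi^{(n)}$ are compositions of: inner automorphisms ($x\mapsto gxg^{-1}$ preserving $E_\pi^{(n)}$, with $g\in G_{\pi,\sigma}(A_n,S)$ for some ring extension $(S,\theta_S)$ of $(R,\theta)$); diagonal automorphisms (conjugation by $h(\chi)$, where for some ring extension $(S,\theta_S)$ of $(R,\theta)$ one has $\chi\in\operatorname{Hom}_1(\Lambda_\pi,S^\times)$, $\chi|_{\Lambda_r}\in\operatorname{Hom}_1(\Lambda_r,R^\times)$, with $\operatorname{Hom}_1(\Lambda,S^\times)=\{\chi\in\operatorname{Hom}(\Lambda,S^\times):\chi(\rho(\lambda))=\theta_S(\chi(\lambda))\}$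 and $h(\chi)\in G_\pi(A_n,S)$ the torus element acting on the weight-$\lambda$ space by $\chi(\lambda)$); ring automorphisms (induced by $\mu\in\operatorname{Aut}(R)$ commuting with $\theta$); and central automorphisms ($x\mapsto x\,z(x)$ with $z$ a homomorphism from the group to its center). *)

theory Defs
  imports "HOL-Algebra.Algebra" "HOL-Combinatorics.Permutations" "HOL-Library.Function_Algebras"
    Complex_Main
begin

section \<open>Rings with involution\<close>

definition local_cring :: "('a, 'r) ring_scheme \<Rightarrow> bool" where
  "local_cring R \<longleftrightarrow> cring R \<and> (\<exists>!I. maximalideal I R)"

definition ring_involution :: "('a, 'r) ring_scheme \<Rightarrow> ('a \<Rightarrow> 'a) \<Rightarrow> bool" where
  "ring_involution R \<theta> \<longleftrightarrow> \<theta> \<in> ring_iso R R \<and> (\<forall>r\<in>carrier R. \<theta> (\<theta> r) = r)"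

definition jacobson_radical :: "('a, 'r) ring_scheme \<Rightarrow> 'a set" where
  "jacobson_radical R = carrier R \<inter> \<Inter>{I. maximalideal I R}"

definition sym_part :: "('a, 'r) ring_scheme \<Rightarrow> ('a \<Rightarrow> 'a) \<Rightarrow> 'a set" where
  "sym_part R \<theta> = {r \<in> carrier R. \<theta> r = r}"

definition skew_part :: "('a, 'r) ring_scheme \<Rightarrow> ('a \<Rightarrow> 'a) \<Rightarrow> 'a set" where
  "skew_part R \<theta> = {r \<in> carrier R. \<theta> r = \<ominus>\<^bsub>R\<^esub> r}"

definition two :: "('a, 'r) ring_scheme \<Rightarrow> 'a" where
  "two R = \<one>\<^bsub>R\<^esub> \<oplus>\<^bsub>R\<^esub> \<one>\<^bsub>R\<^esub>"

text \<open>The element \<open>t\<^sup>+ = (t + \<theta> t) / 2\<close>.\<close>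

definition plus_part :: "('a, 'r) ring_scheme \<Rightarrow> ('a \<Rightarrow> 'a) \<Rightarrow> 'a \<Rightarrow> 'a" where
  "plus_part R \<theta> t = inv\<^bsub>R\<^esub> (two R) \<otimes>\<^bsub>R\<^esub> (t \<oplus>\<^bsub>R\<^esub> \<theta> t)"

text \<open>The inverse of a \<open>\<theta>\<close>-fixed unit is \<open>\<theta>\<close>-fixed, so the units of the fixed ring are
  \<open>Units R \<inter> sym_part R \<theta>\<close>.\<close>

definition exceptional_params :: "('a, 'r) ring_scheme \<Rightarrow> ('a \<Rightarrow> 'a) \<Rightarrow> 'a set" where
  "exceptional_params R \<theta> =
    {\<delta> \<in> jacobson_radical R \<inter> skew_part R \<theta>.
       (\<forall>r\<in>skew_part R \<theta>. \<delta> \<otimes>\<^bsub>R\<^esub> r = \<zero>\<^bsub>R\<^esub>) \<and>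
       (\<forall>t\<in>Units R \<inter> sym_part R \<theta>. \<delta> \<otimes>\<^bsub>R\<^esub> (t \<otimes>\<^bsub>R\<^esub> t \<ominus>\<^bsub>R\<^esub> \<one>\<^bsub>R\<^esub>) = \<zero>\<^bsub>R\<^esub>)}"

text \<open>An extension \<open>(S, \<theta>\<^sub>S)\<close> of \<open>(R, \<theta>)\<close>, given by an embedding \<open>\<iota>\<close>. The elements of \<open>S\<close> live in
  a type of their own, since \<open>S\<close> need not be realizable inside the type of \<open>R\<close>.\<close>

definition involution_extension ::
  "('a, 'r) ring_scheme \<Rightarrow> ('a \<Rightarrow> 'a) \<Rightarrow> ('b, 's) ring_scheme \<Rightarrow> ('b \<Rightarrow> 'b) \<Rightarrow> ('a \<Rightarrow> 'b) \<Rightarrow> bool" where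
  "involution_extension R \<theta> S \<theta>\<^sub>S \<iota> \<longleftrightarrow>
     cring S \<and> ring_involution S \<theta>\<^sub>S \<and> \<iota> \<in> ring_hom R S \<and> inj_on \<iota> (carrier R) \<and>
     (\<forall>r\<in>carrier R. \<theta>\<^sub>S (\<iota> r) = \<iota> (\<theta> r))"


section \<open>Matrices over a ring, indexed by a finite set\<close>

definition Mat :: "('a, 'r) ring_scheme \<Rightarrow> 'i set \<Rightarrow> ('i \<Rightarrow> 'i \<Rightarrow> 'a) monoid" where
  "Mat R I =
    \<lparr>carrier = I \<rightarrow>\<^sub>E I \<rightarrow>\<^sub>E carrier R,
     monoid.mult = (\<lambda>A B. \<lambda>i\<in>I. \<lambda>j\<in>I. \<Oplus>\<^bsub>R\<^esub>k\<in>I. A i k \<otimes>\<^bsub>R\<^esub> B k j),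
     one = (\<lambda>i\<in>I. \<lambda>j\<in>I. if i = j then \<one>\<^bsub>R\<^esub> else \<zero>\<^bsub>R\<^esub>)\<rparr>"

definition mat_transpose :: "'i set \<Rightarrow> ('i \<Rightarrow> 'i \<Rightarrow> 'a) \<Rightarrow> 'i \<Rightarrow> 'i \<Rightarrow> 'a" where
  "mat_transpose I A = (\<lambda>i\<in>I. \<lambda>j\<in>I. A j i)"

definition mat_map :: "'i set \<Rightarrow> ('a \<Rightarrow> 'b) \<Rightarrow> ('i \<Rightarrow> 'i \<Rightarrow> 'a) \<Rightarrow> 'i \<Rightarrow> 'i \<Rightarrow> 'b" where
  "mat_map I f A = (\<lambda>i\<in>I. \<lambda>j\<in>I. f (A i j))"

definition mat_det :: "('a, 'r) ring_scheme \<Rightarrow> 'i set \<Rightarrow> ('i \<Rightarrow> 'i \<Rightarrow> 'a) \<Rightarrow> 'a" where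
  "mat_det R I A =
    (\<Oplus>\<^bsub>R\<^esub>p\<in>{p. p permutes I}.
       let a = (\<Otimes>\<^bsub>R\<^esub>i\<in>I. A i (p i)) in if evenperm p then a else \<ominus>\<^bsub>R\<^esub> a)"

definition SL :: "('a, 'r) ring_scheme \<Rightarrow> nat \<Rightarrow> (nat \<Rightarrow> nat \<Rightarrow> 'a) set" where
  "SL R m = {A \<in> carrier (Mat R {1..m}). mat_det R {1..m} A = \<one>\<^bsub>R\<^esub>}"

text \<open>\<open>lin R m [(a\<^sub>1, i\<^sub>1, j\<^sub>1), \<dots>]\<close> is the \<open>m \<times> m\<close> matrix \<open>\<Sum> a\<^sub>k E\<^bsub>i\<^sub>k j\<^sub>k\<^esub>\<close>, and \<open>cf a [(i\<^sub>1, j\<^sub>1), \<dots>]\<close>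
  stands for \<open>a (E\<^bsub>i\<^sub>1 j\<^sub>1\<^esub> + \<dots>)\<close> in such a list.\<close>

definition lin :: "('a, 'r) ring_scheme \<Rightarrow> nat \<Rightarrow> ('a \<times> nat \<times> nat) list \<Rightarrow> nat \<Rightarrow> nat \<Rightarrow> 'a" where
  "lin R m xs =
    (\<lambda>i\<in>{1..m}. \<lambda>j\<in>{1..m}.
       foldr (\<lambda>(a, k, l) s. if k = i \<and> l = j then a \<oplus>\<^bsub>R\<^esub> s else s) xs \<zero>\<^bsub>R\<^esub>)"

definition cf :: "'a \<Rightarrow> (nat \<times> nat) list \<Rightarrow> ('a \<times> nat \<times> nat) list" where
  "cf a ps = map (\<lambda>(i, j). (a, i, j)) ps"

definition idm :: "('a, 'r) ring_scheme \<Rightarrow> nat \<Rightarrow> ('a \<times> nat \<times> nat) list" where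
  "idm R m = cf \<one>\<^bsub>R\<^esub> (map (\<lambda>i. (i, i)) [1..<Suc m])"

text \<open>\<open>Q\<^sub>4 = E\<^sub>1\<^sub>4 - E\<^sub>2\<^sub>3 + E\<^sub>3\<^sub>2 - E\<^sub>4\<^sub>1\<close> and \<open>Q\<^sub>5 = E\<^sub>1\<^sub>5 - E\<^sub>2\<^sub>4 + E\<^sub>3\<^sub>3 - E\<^sub>4\<^sub>2 + E\<^sub>5\<^sub>1\<close>.\<close>

definition Qmat :: "('a, 'r) ring_scheme \<Rightarrow> nat \<Rightarrow> nat \<Rightarrow> nat \<Rightarrow> 'a" where
  "Qmat R m =
    (if m = 4 then lin R 4 (cf \<one>\<^bsub>R\<^esub> [(1,4),(3,2)] @ cf (\<ominus>\<^bsub>R\<^esub> \<one>\<^bsub>R\<^esub>) [(2,3),(4,1)])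
     else lin R 5 (cf \<one>\<^bsub>R\<^esub> [(1,5),(3,3),(5,1)] @ cf (\<ominus>\<^bsub>R\<^esub> \<one>\<^bsub>R\<^esub>) [(2,4),(4,2)]))"


section \<open>Weights of type \<open>A\<^sub>n\<close>\<close>

text \<open>A weight is written in coordinates with respect to the fundamental weights
  \<open>\<omega>\<^sub>1, \<dots>, \<omega>\<^sub>n\<close>; by convention \<open>\<omega>\<^sub>0 = \<omega>\<^sub>n\<^sub>+\<^sub>1 = 0\<close>.\<close>

type_synonym weight = "nat \<Rightarrow> int"

definition fund_weight :: "nat \<Rightarrow> nat \<Rightarrow> weight" where
  "fund_weight n k = (\<lambda>j. if j = k \<and> k \<in> {1..n} then 1 else 0)"

text \<open>The weights \<open>\<epsilon>\<^sub>1, \<dots>, \<epsilon>\<^sub>n\<^sub>+\<^sub>1\<close> of the standard representation (with sum \<open>0\<close>).\<close>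

definition std_weight :: "nat \<Rightarrow> nat \<Rightarrow> weight" where
  "std_weight n i = fund_weight n i - fund_weight n (i - 1)"

text \<open>\<open>\<alpha>\<^sub>i = \<epsilon>\<^sub>i - \<epsilon>\<^sub>i\<^sub>+\<^sub>1 = 2\<omega>\<^sub>i - \<omega>\<^sub>i\<^sub>-\<^sub>1 - \<omega>\<^sub>i\<^sub>+\<^sub>1\<close>.\<close>

definition simple_root :: "nat \<Rightarrow> nat \<Rightarrow> weight" where
  "simple_root n i = std_weight n i - std_weight n (i + 1)"

definition weight_lattice :: "nat \<Rightarrow> weight set" where
  "weight_lattice n = {v. \<forall>j. j \<notin> {1..n} \<longrightarrow> v j = 0}"

definition root_lattice :: "nat \<Rightarrow> weight set" where
  "root_lattice n = {v. \<exists>c :: nat \<Rightarrow> int. v = (\<lambda>j. \<Sum>i=1..n. c i * simple_root n i j)}"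

definition diagram_aut :: "nat \<Rightarrow> weight \<Rightarrow> weight" where
  "diagram_aut n v = (\<lambda>j. if j \<in> {1..n} then v (n + 1 - j) else 0)"

text \<open>\<open>MID\<close> is only used for \<open>n = 3\<close>.\<close>

datatype isogeny = SC | MID | AD

fun isogeny_lattice :: "nat \<Rightarrow> isogeny \<Rightarrow> weight set" where
  "isogeny_lattice n SC = weight_lattice n"
| "isogeny_lattice n MID = {\<lambda>j. v j + k * fund_weight n 2 j |v k. v \<in> root_lattice n}"
| "isogeny_lattice n AD = root_lattice n"

definition weight_group :: "weight set \<Rightarrow> weight monoid" where
  "weight_group L = \<lparr>carrier = L, monoid.mult = (+), one = 0\<rparr>"

definition Hom1 :: "nat \<Rightarrow> weight set \<Rightarrow> ('a, 'r) ring_scheme \<Rightarrow> ('a \<Rightarrow> 'a) \<Rightarrow> (weight \<Rightarrow> 'a) set" where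
  "Hom1 n L S \<theta>\<^sub>S =
    {\<chi> \<in> hom (weight_group L) (units_of S). \<forall>v\<in>L. \<chi> (diagram_aut n v) = \<theta>\<^sub>S (\<chi> v)}"


section \<open>The Chevalley--Demazure groups\<close>

text \<open>For each isogeny type we use a representation of \<open>SL\<^sub>m\<close>, \<open>m = n + 1\<close>, whose weights generate
  the lattice: the standard module \<open>V\<close>, its exterior square with basis \<open>e\<^sub>i \<and> e\<^sub>j\<close> \<open>(i < j)\<close>, and
  conjugation on \<open>m \<times> m\<close> matrices with basis \<open>E\<^sub>i\<^sub>j\<close>. The basis vectors \<open>e\<^sub>i\<close>, \<open>e\<^sub>i \<and> e\<^sub>j\<close>, \<open>E\<^sub>i\<^sub>j\<close> are
  encoded by the index lists \<open>[i]\<close>, \<open>[i, j]\<close>, \<open>[i, j]\<close>.\<close>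

fun rep_index :: "nat \<Rightarrow> isogeny \<Rightarrow> nat list set" where
  "rep_index n SC = {[i] |i. 1 \<le> i \<and> i \<le> n + 1}"
| "rep_index n MID = {[i, j] |i j. 1 \<le> i \<and> i < j \<and> j \<le> n + 1}"
| "rep_index n AD = {[i, j] |i j. 1 \<le> i \<and> i \<le> n + 1 \<and> 1 \<le> j \<and> j \<le> n + 1}"

fun rep_weight :: "nat \<Rightarrow> isogeny \<Rightarrow> nat list \<Rightarrow> weight" where
  "rep_weight n SC [i] = std_weight n i"
| "rep_weight n MID [i, j] = std_weight n i + std_weight n j"
| "rep_weight n AD [i, j] = std_weight n i - std_weight n j"
| "rep_weight n _ _ = undefined"

text \<open>Matrix entries, where \<open>B\<close> is the inverse of \<open>A\<close>; in the last case
  \<open>A E\<^sub>k\<^sub>l A\<^sup>-\<^sup>1 = \<Sum> A\<^sub>i\<^sub>k B\<^sub>l\<^sub>j E\<^sub>i\<^sub>j\<close>.\<close>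

fun rep_entry ::
  "('a, 'r) ring_scheme \<Rightarrow> isogeny \<Rightarrow> (nat \<Rightarrow> nat \<Rightarrow> 'a) \<Rightarrow> (nat \<Rightarrow> nat \<Rightarrow> 'a) \<Rightarrow> nat list \<Rightarrow> nat list \<Rightarrow> 'a"
where
  "rep_entry R SC A B [i] [k] = A i k"
| "rep_entry R MID A B [i, j] [k, l] = (A i k \<otimes>\<^bsub>R\<^esub> A j l) \<ominus>\<^bsub>R\<^esub> (A i l \<otimes>\<^bsub>R\<^esub> A j k)"
| "rep_entry R AD A B [i, j] [k, l] = A i k \<otimes>\<^bsub>R\<^esub> B l j"
| "rep_entry R _ A B _ _ = undefined"

definition rep ::
  "('a, 'r) ring_scheme \<Rightarrow> nat \<Rightarrow> isogeny \<Rightarrow> (nat \<Rightarrow> nat \<Rightarrow> 'a) \<Rightarrow> nat list \<Rightarrow> nat list \<Rightarrow> 'a" where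
  "rep R n \<pi> A =
    (\<lambda>r\<in>rep_index n \<pi>. \<lambda>c\<in>rep_index n \<pi>. rep_entry R \<pi> A (inv\<^bsub>Mat R {1..n+1}\<^esub> A) r c)"

text \<open>Integer polynomials, as expressions that can be evaluated in every ring.\<close>

datatype (zvars: 'v) zpoly =
  ZVar 'v | ZOne | ZNeg "'v zpoly" | ZAdd "'v zpoly" "'v zpoly" | ZMul "'v zpoly" "'v zpoly"

primrec zeval :: "('a, 'r) ring_scheme \<Rightarrow> ('v \<Rightarrow> 'a) \<Rightarrow> 'v zpoly \<Rightarrow> 'a" where
  "zeval R x (ZVar v) = x v"
| "zeval R x ZOne = \<one>\<^bsub>R\<^esub>"
| "zeval R x (ZNeg p) = \<ominus>\<^bsub>R\<^esub> zeval R x p"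
| "zeval R x (ZAdd p q) = zeval R x p \<oplus>\<^bsub>R\<^esub> zeval R x q"
| "zeval R x (ZMul p q) = zeval R x p \<otimes>\<^bsub>R\<^esub> zeval R x q"

definition complex_ring :: "complex ring" where
  "complex_ring = \<lparr>carrier = UNIV, monoid.mult = (*), one = 1, ring.zero = 0, add = (+)\<rparr>"

text \<open>The coordinate ring of the Chevalley--Demazure scheme is the ring of functions on the complex
  group generated over \<open>\<int>\<close> by the matrix coefficients of the representation. Hence its \<open>S\<close>-points
  are the matrices over \<open>S\<close> satisfying all integer polynomial relations that hold between the
  matrix coefficients on \<open>SL\<^sub>m(\<complex>)\<close>. As the representations above induce closed immersions over
  \<open>\<int>\<close> of \<open>SL\<^sub>m\<close>, \<open>SL\<^sub>4/\<mu>\<^sub>2\<close> and \<open>PGL\<^sub>m\<close>, these are the groups of points of those schemes, for every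
  commutative ring \<open>S\<close> (for \<open>PGL\<^sub>m\<close> this can be larger than \<open>GL\<^sub>m(S)/S\<^sup>\<times>\<close>).\<close>

definition chevalley_group ::
  "('a, 'r) ring_scheme \<Rightarrow> nat \<Rightarrow> isogeny \<Rightarrow> (nat list \<Rightarrow> nat list \<Rightarrow> 'a) set" where
  "chevalley_group S n \<pi> =
    {g \<in> carrier (Mat S (rep_index n \<pi>)).
       \<forall>p. zvars p \<subseteq> rep_index n \<pi> \<times> rep_index n \<pi> \<longrightarrow>
           (\<forall>A\<in>SL complex_ring (n + 1).
              zeval complex_ring (\<lambda>(r, c). rep complex_ring n \<pi> A r c) p = 0) \<longrightarrow>
           zeval S (\<lambda>(r, c). g r c) p = \<zero>\<^bsub>S\<^esub>}"

text \<open>All three representations commute with transposition, so the automorphism induced by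
  \<open>A \<mapsto> Q (\<theta> A\<^sup>t)\<^sup>-\<^sup>1 Q\<^sup>-\<^sup>1\<close> is given by the same formula with \<open>Q\<close> replaced by its image.\<close>

definition sigma ::
  "('a, 'r) ring_scheme \<Rightarrow> ('a \<Rightarrow> 'a) \<Rightarrow> nat \<Rightarrow> isogeny \<Rightarrow>
    (nat list \<Rightarrow> nat list \<Rightarrow> 'a) \<Rightarrow> nat list \<Rightarrow> nat list \<Rightarrow> 'a" where
  "sigma S \<theta>\<^sub>S n \<pi> g =
    (let I = rep_index n \<pi>; M = Mat S I; Q = rep S n \<pi> (Qmat S (n + 1))
     in Q \<otimes>\<^bsub>M\<^esub> inv\<^bsub>M\<^esub> (mat_transpose I (mat_map I \<theta>\<^sub>S g)) \<otimes>\<^bsub>M\<^esub> inv\<^bsub>M\<^esub> Q)"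

definition twisted_group ::
  "('a, 'r) ring_scheme \<Rightarrow> ('a \<Rightarrow> 'a) \<Rightarrow> nat \<Rightarrow> isogeny \<Rightarrow> (nat list \<Rightarrow> nat list \<Rightarrow> 'a) set" where
  "twisted_group S \<theta>\<^sub>S n \<pi> = {g \<in> chevalley_group S n \<pi>. sigma S \<theta>\<^sub>S n \<pi> g = g}"

definition torus_element ::
  "('a, 'r) ring_scheme \<Rightarrow> nat \<Rightarrow> isogeny \<Rightarrow> (weight \<Rightarrow> 'a) \<Rightarrow> nat list \<Rightarrow> nat list \<Rightarrow> 'a" where
  "torus_element S n \<pi> \<chi> =
    (\<lambda>r\<in>rep_index n \<pi>. \<lambda>c\<in>rep_index n \<pi>. if r = c then \<chi> (rep_weight n \<pi> r) else \<zero>\<^bsub>S\<^esub>)"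


section \<open>Root elements and elementary groups\<close>

text \<open>The elements \<open>x\<^sub>1\<close>, \<open>x\<^sub>-\<^sub>1\<close> (for both values of \<open>n\<close>), then \<open>x\<^sub>2\<close>, \<open>x\<^sub>-\<^sub>2\<close> for \<open>n = 3\<close>, then
  \<open>x\<^sub>2\<close>, \<open>x\<^sub>-\<^sub>2\<close> for \<open>n = 4\<close>.\<close>

definition x1 :: "('a, 'r) ring_scheme \<Rightarrow> ('a \<Rightarrow> 'a) \<Rightarrow> nat \<Rightarrow> 'a \<Rightarrow> nat \<Rightarrow> nat \<Rightarrow> 'a" where
  "x1 R \<theta> n t = lin R (n + 1) (idm R (n + 1) @ [(t, 1, 2), (\<theta> t, n, n + 1)])"

definition xm1 :: "('a, 'r) ring_scheme \<Rightarrow> ('a \<Rightarrow> 'a) \<Rightarrow> nat \<Rightarrow> 'a \<Rightarrow> nat \<Rightarrow> nat \<Rightarrow> 'a" where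
  "xm1 R \<theta> n t = lin R (n + 1) (idm R (n + 1) @ [(t, 2, 1), (\<theta> t, n + 1, n)])"

definition x2_3 :: "('a, 'r) ring_scheme \<Rightarrow> 'a \<Rightarrow> nat \<Rightarrow> nat \<Rightarrow> 'a" where
  "x2_3 R s = lin R 4 (idm R 4 @ [(s, 2, 3)])"

definition xm2_3 :: "('a, 'r) ring_scheme \<Rightarrow> 'a \<Rightarrow> nat \<Rightarrow> nat \<Rightarrow> 'a" where
  "xm2_3 R s = lin R 4 (idm R 4 @ [(s, 3, 2)])"

definition x2_4_list :: "('a, 'r) ring_scheme \<Rightarrow> ('a \<Rightarrow> 'a) \<Rightarrow> 'a \<Rightarrow> 'a \<Rightarrow> ('a \<times> nat \<times> nat) list" where
  "x2_4_list R \<theta> t u = idm R 5 @ [(t, 2, 3), (\<theta> t, 3, 4), (u, 2, 4)]"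

definition xm2_4_list :: "('a, 'r) ring_scheme \<Rightarrow> ('a \<Rightarrow> 'a) \<Rightarrow> 'a \<Rightarrow> 'a \<Rightarrow> ('a \<times> nat \<times> nat) list" where
  "xm2_4_list R \<theta> t u = idm R 5 @ [(t, 3, 2), (\<theta> t, 4, 3), (u, 4, 2)]"

definition param_A :: "('a, 'r) ring_scheme \<Rightarrow> ('a \<Rightarrow> 'a) \<Rightarrow> ('a \<times> 'a) set" where
  "param_A R \<theta> = {(t, u). t \<in> carrier R \<and> u \<in> carrier R \<and> t \<otimes>\<^bsub>R\<^esub> \<theta> t = u \<oplus>\<^bsub>R\<^esub> \<theta> u}"

definition root_elements :: "('a, 'r) ring_scheme \<Rightarrow> ('a \<Rightarrow> 'a) \<Rightarrow> nat \<Rightarrow> (nat \<Rightarrow> nat \<Rightarrow> 'a) set" where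
  "root_elements R \<theta> n =
    x1 R \<theta> n ` carrier R \<union> xm1 R \<theta> n ` carrier R \<union>
    (if n = 3 then x2_3 R ` sym_part R \<theta> \<union> xm2_3 R ` sym_part R \<theta>
     else (\<lambda>(t, u). lin R 5 (x2_4_list R \<theta> t u)) ` param_A R \<theta> \<union>
          (\<lambda>(t, u). lin R 5 (xm2_4_list R \<theta> t u)) ` param_A R \<theta>)"

definition E_sc :: "('a, 'r) ring_scheme \<Rightarrow> ('a \<Rightarrow> 'a) \<Rightarrow> nat \<Rightarrow> (nat \<Rightarrow> nat \<Rightarrow> 'a) monoid" where
  "E_sc R \<theta> n =
    (Mat R {1..n+1})\<lparr>carrier := generate (units_of (Mat R {1..n+1})) (root_elements R \<theta> n)\<rparr>"

definition E_grp ::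
  "('a, 'r) ring_scheme \<Rightarrow> ('a \<Rightarrow> 'a) \<Rightarrow> nat \<Rightarrow> isogeny \<Rightarrow> (nat list \<Rightarrow> nat list \<Rightarrow> 'a) monoid" where
  "E_grp R \<theta> n \<pi> = (Mat R (rep_index n \<pi>))\<lparr>carrier := rep R n \<pi> ` carrier (E_sc R \<theta> n)\<rparr>"


section \<open>The exceptional automorphism\<close>

definition exceptional_on_roots_3 ::
  "('a, 'r) ring_scheme \<Rightarrow> ('a \<Rightarrow> 'a) \<Rightarrow> 'a \<Rightarrow> ((nat \<Rightarrow> nat \<Rightarrow> 'a) \<Rightarrow> nat \<Rightarrow> nat \<Rightarrow> 'a) \<Rightarrow> bool" where
  "exceptional_on_roots_3 R \<theta> \<delta> \<Phi> \<longleftrightarrow>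
    (\<forall>t\<in>carrier R.
       let p = plus_part R \<theta> t; pd = p \<otimes>\<^bsub>R\<^esub> \<delta>; ppd = p \<otimes>\<^bsub>R\<^esub> p \<otimes>\<^bsub>R\<^esub> \<delta> in
       \<Phi> (x1 R \<theta> 3 t) =
         lin R 4 (idm R 4 @ [(t,1,2), (\<theta> t,3,4)] @
                  cf (\<ominus>\<^bsub>R\<^esub> pd) [(1,3),(2,4),(3,1),(4,2)] @ cf (\<ominus>\<^bsub>R\<^esub> ppd) [(1,4),(3,2)]) \<and>
       \<Phi> (xm1 R \<theta> 3 t) =
         lin R 4 (idm R 4 @ [(t,2,1), (\<theta> t,4,3)] @
                  cf pd [(1,3),(2,4),(3,1),(4,2)] @ cf ppd [(2,3),(4,1)])) \<and>
    (\<forall>s\<in>sym_part R \<theta>.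
       let sd = s \<otimes>\<^bsub>R\<^esub> \<delta>; ssd = s \<otimes>\<^bsub>R\<^esub> s \<otimes>\<^bsub>R\<^esub> \<delta> in
       \<Phi> (x2_3 R s) =
         lin R 4 (cf (\<one>\<^bsub>R\<^esub> \<oplus>\<^bsub>R\<^esub> two R \<otimes>\<^bsub>R\<^esub> sd) [(1,1),(4,4)] @
                  cf (\<one>\<^bsub>R\<^esub> \<oplus>\<^bsub>R\<^esub> sd) [(2,2),(3,3)] @ [(s \<oplus>\<^bsub>R\<^esub> ssd,2,3)]) \<and>
       \<Phi> (xm2_3 R s) =
         lin R 4 (cf (\<one>\<^bsub>R\<^esub> \<ominus>\<^bsub>R\<^esub> two R \<otimes>\<^bsub>R\<^esub> sd) [(1,1),(4,4)] @
                  cf (\<one>\<^bsub>R\<^esub> \<ominus>\<^bsub>R\<^esub> sd) [(2,2),(3,3)] @ [(s \<ominus>\<^bsub>R\<^esub> ssd,3,2)]))"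

definition exceptional_on_roots_4 ::
  "('a, 'r) ring_scheme \<Rightarrow> ('a \<Rightarrow> 'a) \<Rightarrow> 'a \<Rightarrow> ((nat \<Rightarrow> nat \<Rightarrow> 'a) \<Rightarrow> nat \<Rightarrow> nat \<Rightarrow> 'a) \<Rightarrow> bool" where
  "exceptional_on_roots_4 R \<theta> \<delta> \<Phi> \<longleftrightarrow>
    (\<forall>t\<in>carrier R.
       let pd = plus_part R \<theta> t \<otimes>\<^bsub>R\<^esub> \<delta> in
       \<Phi> (x1 R \<theta> 4 t) =
         lin R 5 (cf (\<one>\<^bsub>R\<^esub> \<oplus>\<^bsub>R\<^esub> pd) [(1,1),(2,2),(4,4),(5,5)] @ [(\<one>\<^bsub>R\<^esub> \<ominus>\<^bsub>R\<^esub> pd,3,3)])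
           \<otimes>\<^bsub>Mat R {1..5}\<^esub> x1 R \<theta> 4 t \<and>
       \<Phi> (xm1 R \<theta> 4 t) =
         lin R 5 (cf (\<one>\<^bsub>R\<^esub> \<ominus>\<^bsub>R\<^esub> pd) [(1,1),(2,2),(4,4),(5,5)] @ [(\<one>\<^bsub>R\<^esub> \<oplus>\<^bsub>R\<^esub> pd,3,3)])
           \<otimes>\<^bsub>Mat R {1..5}\<^esub> xm1 R \<theta> 4 t) \<and>
    (\<forall>(t, u)\<in>param_A R \<theta>.
       let p = plus_part R \<theta> t; pd = p \<otimes>\<^bsub>R\<^esub> \<delta>; ppd = p \<otimes>\<^bsub>R\<^esub> p \<otimes>\<^bsub>R\<^esub> \<delta> in
       \<Phi> (lin R 5 (x2_4_list R \<theta> t u)) =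
         lin R 5 (x2_4_list R \<theta> t u @
                  cf (\<ominus>\<^bsub>R\<^esub> pd) [(1,3),(5,3),(3,1),(3,5)] @ cf ppd [(1,4),(5,4),(2,1),(2,5)]) \<and>
       \<Phi> (lin R 5 (xm2_4_list R \<theta> t u)) =
         lin R 5 (xm2_4_list R \<theta> t u @
                  cf pd [(1,3),(5,3),(3,1),(3,5)] @ cf (\<ominus>\<^bsub>R\<^esub> ppd) [(1,2),(5,2),(4,1),(4,5)]))"

text \<open>\<open>\<Theta>\<close> is the automorphism of the elementary group of type \<open>\<pi>\<close> induced by the automorphism of the
  simply connected one with the prescribed values on the generators. These conditions determine
  \<open>\<Theta>\<close>, since \<open>auto\<close> consists of extensional functions.\<close>

definition is_exceptional_aut ::
  "('a, 'r) ring_scheme \<Rightarrow> ('a \<Rightarrow> 'a) \<Rightarrow> nat \<Rightarrow> isogeny \<Rightarrow> 'a \<Rightarrow>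
    ((nat list \<Rightarrow> nat list \<Rightarrow> 'a) \<Rightarrow> nat list \<Rightarrow> nat list \<Rightarrow> 'a) \<Rightarrow> bool" where
  "is_exceptional_aut R \<theta> n \<pi> \<delta> \<Theta> \<longleftrightarrow>
    \<Theta> \<in> auto (E_grp R \<theta> n \<pi>) \<and>
    (\<exists>\<Phi>\<in>auto (E_sc R \<theta> n).
       (if n = 3 then exceptional_on_roots_3 R \<theta> \<delta> \<Phi> else exceptional_on_roots_4 R \<theta> \<delta> \<Phi>) \<and>
       (\<forall>A\<in>carrier (E_sc R \<theta> n). \<Theta> (rep R n \<pi> A) = rep R n \<pi> (\<Phi> A)))"


section \<open>Standard automorphisms\<close>

definition group_center :: "('g, 'x) monoid_scheme \<Rightarrow> 'g set" where
  "group_center G = {z \<in> carrier G. \<forall>x\<in>carrier G. z \<otimes>\<^bsub>G\<^esub> x = x \<otimes>\<^bsub>G\<^esub> z}"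

definition central_auts :: "('g, 'x) monoid_scheme \<Rightarrow> ('g \<Rightarrow> 'g) set" where
  "central_auts G =
    {\<phi> \<in> auto G. \<exists>z\<in>hom G (G\<lparr>carrier := group_center G\<rparr>). \<forall>x\<in>carrier G. \<phi> x = x \<otimes>\<^bsub>G\<^esub> z x}"

definition ring_auts ::
  "('a, 'r) ring_scheme \<Rightarrow> ('a \<Rightarrow> 'a) \<Rightarrow> nat \<Rightarrow> isogeny \<Rightarrow>
    ((nat list \<Rightarrow> nat list \<Rightarrow> 'a) \<Rightarrow> nat list \<Rightarrow> nat list \<Rightarrow> 'a) set" where
  "ring_auts R \<theta> n \<pi> =
    {\<phi> \<in> auto (E_grp R \<theta> n \<pi>).
       \<exists>\<mu>\<in>ring_iso R R. (\<forall>r\<in>carrier R. \<mu> (\<theta> r) = \<theta> (\<mu> r)) \<and>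
         (\<forall>x\<in>carrier (E_grp R \<theta> n \<pi>). \<phi> x = mat_map (rep_index n \<pi>) \<mu> x)}"

definition is_conj_over ::
  "('a, 'r) ring_scheme \<Rightarrow> ('a \<Rightarrow> 'a) \<Rightarrow> nat \<Rightarrow> isogeny \<Rightarrow> ('b, 's) ring_scheme \<Rightarrow> ('a \<Rightarrow> 'b) \<Rightarrow>
    (nat list \<Rightarrow> nat list \<Rightarrow> 'b) \<Rightarrow>
    ((nat list \<Rightarrow> nat list \<Rightarrow> 'a) \<Rightarrow> nat list \<Rightarrow> nat list \<Rightarrow> 'a) \<Rightarrow> bool" where
  "is_conj_over R \<theta> n \<pi> S \<iota> g \<phi> \<longleftrightarrow>
    (let I = rep_index n \<pi>; M = Mat S I in
     \<forall>x\<in>carrier (E_grp R \<theta> n \<pi>).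
       mat_map I \<iota> (\<phi> x) = g \<otimes>\<^bsub>M\<^esub> mat_map I \<iota> x \<otimes>\<^bsub>M\<^esub> inv\<^bsub>M\<^esub> g)"

text \<open>HOL cannot quantify over all types inside a formula, so the type \<open>'b\<close> hosting the ring
  extensions is a parameter. Different factors of a composition may use different extensions;
  finitely many of them always fit into one type.\<close>

definition inner_auts ::
  "'b itself \<Rightarrow> ('a, 'r) ring_scheme \<Rightarrow> ('a \<Rightarrow> 'a) \<Rightarrow> nat \<Rightarrow> isogeny \<Rightarrow>
    ((nat list \<Rightarrow> nat list \<Rightarrow> 'a) \<Rightarrow> nat list \<Rightarrow> nat list \<Rightarrow> 'a) set" where
  "inner_auts _ R \<theta> n \<pi> =
    {\<phi> \<in> auto (E_grp R \<theta> n \<pi>).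
       \<exists>(S :: 'b ring) \<theta>\<^sub>S \<iota>. involution_extension R \<theta> S \<theta>\<^sub>S \<iota> \<and>
         (\<exists>g\<in>twisted_group S \<theta>\<^sub>S n \<pi>. is_conj_over R \<theta> n \<pi> S \<iota> g \<phi>)}"

definition diagonal_auts ::
  "'b itself \<Rightarrow> ('a, 'r) ring_scheme \<Rightarrow> ('a \<Rightarrow> 'a) \<Rightarrow> nat \<Rightarrow> isogeny \<Rightarrow>
    ((nat list \<Rightarrow> nat list \<Rightarrow> 'a) \<Rightarrow> nat list \<Rightarrow> nat list \<Rightarrow> 'a) set" where
  "diagonal_auts _ R \<theta> n \<pi> =
    {\<phi> \<in> auto (E_grp R \<theta> n \<pi>).
       \<exists>(S :: 'b ring) \<theta>\<^sub>S \<iota>. involution_extension R \<theta> S \<theta>\<^sub>S \<iota> \<and>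
         (\<exists>\<chi>\<in>Hom1 n (isogeny_lattice n \<pi>) S \<theta>\<^sub>S.
            (\<exists>\<chi>\<^sub>0\<in>Hom1 n (root_lattice n) R \<theta>. \<forall>v\<in>root_lattice n. \<chi> v = \<iota> (\<chi>\<^sub>0 v)) \<and>
            is_conj_over R \<theta> n \<pi> S \<iota> (torus_element S n \<pi> \<chi>) \<phi>)}"

inductive_set compositions :: "'g set \<Rightarrow> ('g \<Rightarrow> 'g) set \<Rightarrow> ('g \<Rightarrow> 'g) set" for B F where
  single: "f \<in> F \<Longrightarrow> f \<in> compositions B F"
| comp: "f \<in> F \<Longrightarrow> g \<in> compositions B F \<Longrightarrow> compose B f g \<in> compositions B F"

definition standard_auts ::
  "'b itself \<Rightarrow> ('a, 'r) ring_scheme \<Rightarrow> ('a \<Rightarrow> 'a) \<Rightarrow> nat \<Rightarrow> isogeny \<Rightarrow>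
    ((nat list \<Rightarrow> nat list \<Rightarrow> 'a) \<Rightarrow> nat list \<Rightarrow> nat list \<Rightarrow> 'a) set" where
  "standard_auts T R \<theta> n \<pi> =
    compositions (carrier (E_grp R \<theta> n \<pi>))
      (inner_auts T R \<theta> n \<pi> \<union> diagonal_auts T R \<theta> n \<pi> \<union> ring_auts R \<theta> n \<pi> \<union>
       central_auts (E_grp R \<theta> n \<pi>))"

end

theory Submission
  imports Defs "Jordan_Normal_Form.Determinant"
begin


text \<open>
  A composition of standard automorphisms acts on a suitable class function \<open>f\<close> through a ring
  endomorphism \<open>\<mu>\<close> of \<open>R\<close>: inner and diagonal automorphisms preserve \<open>f\<close>, ring automorphisms apply
  \<open>\<mu>\<close> to its values, and central automorphisms fix the elements that are killed by every
  homomorphism to the center. On a commutator \<open>w\<close> of products of root elements with integer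
  parameters the value \<open>f(w)\<close> is an integer \<open>k\<close>, hence fixed by \<open>\<mu>\<close>, whereas the exceptional
  automorphism turns it into \<open>k + c \<delta>\<close>. Taking \<open>t = 2\<close> in the definition of the parameters gives
  \<open>3 \<delta> = 0\<close>, so \<open>\<delta> = 0\<close> as soon as \<open>c\<close> is prime to \<open>3\<close>; as \<open>\<delta>\<^sup>2 = 0\<close>, the number \<open>c\<close> can be computed with
  integer dual numbers.

  The \<open>S\<close>-points of the Chevalley group scheme are only known to satisfy the integral polynomial
  relations valid on the complex group. Invariance of \<open>f\<close> under them is obtained by proving it over
  the complex numbers with a generic matrix as a second argument, and comparing coefficients of
  the entries of that matrix.
\<close>

section \<open>Integer polynomials\<close>

text \<open>The relations defining \<open>chevalley_group\<close> constrain one matrix at a time, so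
  they say nothing directly about a pair of a conjugating matrix \<open>h\<close> and a conjugated
  matrix \<open>u\<close>. Making \<open>u\<close> generic removes this obstacle, but then the class
  function has to be invariant for every matrix on the representation space, not only for images of
  group elements. Hence it is built from an equivariant map \<open>Y\<close> to square matrices of
  size \<open>n + 1\<close> that is defined on all of them. Integer parameters are also fixed by
  \<theta>: so \<open>p = t\<close>, and every entry that occurs lies in the image of the integer
  dual numbers. The square of \<delta> vanishes because \<delta> is skew and annihilates all skew
  elements. If 3 is invertible, \<open>3 \<delta> = 0\<close> already gives \<delta> = 0, so the
  content lies in residue characteristic 3; a class function whose \<delta>-part is always divisible
  by 3 therefore detects nothing.\<close>

primrec zsubst :: "('v \<Rightarrow> 'w zpoly) \<Rightarrow> 'v zpoly \<Rightarrow> 'w zpoly" where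
  "zsubst \<sigma> (ZVar v) = \<sigma> v"
| "zsubst \<sigma> ZOne = ZOne"
| "zsubst \<sigma> (ZNeg p) = ZNeg (zsubst \<sigma> p)"
| "zsubst \<sigma> (ZAdd p q) = ZAdd (zsubst \<sigma> p) (zsubst \<sigma> q)"
| "zsubst \<sigma> (ZMul p q) = ZMul (zsubst \<sigma> p) (zsubst \<sigma> q)"

definition ZZero :: "'v zpoly" where
  "ZZero = ZAdd ZOne (ZNeg ZOne)"

text \<open>An expression tree orders its summands, so an arbitrary duplicate-free enumeration of
  the finite index set is fixed; values in a commutative ring do not depend on the choice.\<close>

definition zsum :: "('i \<Rightarrow> 'v zpoly) \<Rightarrow> 'i set \<Rightarrow> 'v zpoly" where
  "zsum f A = foldr (\<lambda>a. ZAdd (f a)) (SOME xs. set xs = A \<and> distinct xs) ZZero"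

definition zprod :: "('i \<Rightarrow> 'v zpoly) \<Rightarrow> 'i set \<Rightarrow> 'v zpoly" where
  "zprod f A = foldr (\<lambda>a. ZMul (f a)) (SOME xs. set xs = A \<and> distinct xs) ZOne"

lemma enumeration:
  assumes "finite A"
  obtains xs where "(SOME xs. set xs = A \<and> distinct xs) = xs" "set xs = A" "distinct xs"
  using someI_ex[OF finite_distinct_list[OF assms]] by blast

lemma zvars_zsubst: "zvars (zsubst \<sigma> p) = (\<Union>v\<in>zvars p. zvars (\<sigma> v))"
  by (induction p) auto

lemma zvars_ZZero [simp]: "zvars ZZero = {}"
  by (simp add: ZZero_def)

lemma zvars_zsum: "finite A \<Longrightarrow> zvars (zsum f A) = (\<Union>a\<in>A. zvars (f a))"
proof (erule enumeration)
  fix xs assume *: "(SOME xs. set xs = A \<and> distinct xs) = xs" "set xs = A"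
  have "zvars (foldr (\<lambda>a. ZAdd (f a)) xs ZZero) = (\<Union>a\<in>set xs. zvars (f a))"
    by (induction xs) auto
  with * show ?thesis by (simp add: zsum_def)
qed

lemma zvars_zprod: "finite A \<Longrightarrow> zvars (zprod f A) = (\<Union>a\<in>A. zvars (f a))"
proof (erule enumeration)
  fix xs assume *: "(SOME xs. set xs = A \<and> distinct xs) = xs" "set xs = A"
  have "zvars (foldr (\<lambda>a. ZMul (f a)) xs ZOne) = (\<Union>a\<in>set xs. zvars (f a))"
    by (induction xs) auto
  with * show ?thesis by (simp add: zprod_def)
qed

lemma zeval_zsubst: "zeval R x (zsubst \<sigma> p) = zeval R (\<lambda>v. zeval R x (\<sigma> v)) p"
  by (induction p) auto

lemma zeval_cong: "(\<And>v. v \<in> zvars p \<Longrightarrow> x v = y v) \<Longrightarrow> zeval R x p = zeval R y p"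
  by (induction p) auto

lemma zeval_map: "zeval R x (map_zpoly f p) = zeval R (x \<circ> f) p"
  by (induction p) auto

context cring
begin

lemma zeval_closed: "(\<And>v. v \<in> zvars p \<Longrightarrow> x v \<in> carrier R) \<Longrightarrow> zeval R x p \<in> carrier R"
  by (induction p) auto

lemma zeval_ZZero [simp]: "zeval R x ZZero = \<zero>"
  by (simp add: ZZero_def r_neg)

lemma zeval_zsum:
  assumes "finite A" "\<And>a v. a \<in> A \<Longrightarrow> v \<in> zvars (f a) \<Longrightarrow> x v \<in> carrier R"
  shows "zeval R x (zsum f A) = (\<Oplus>a\<in>A. zeval R x (f a))"
  using assms(1)
proof (rule enumeration)
  fix xs assume *: "(SOME xs. set xs = A \<and> distinct xs) = xs" "set xs = A" "distinct xs"
  have "set xs \<subseteq> A \<Longrightarrow> distinct xs \<Longrightarrow>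
      zeval R x (foldr (\<lambda>a. ZAdd (f a)) xs ZZero) = (\<Oplus>a\<in>set xs. zeval R x (f a))" for xs
  proof (induction xs)
    case (Cons b xs)
    have "zeval R x (f a) \<in> carrier R" if "a \<in> A" for a
      using assms(2)[OF that] by (rule zeval_closed)
    then have "(\<lambda>a. zeval R x (f a)) \<in> set xs \<rightarrow> carrier R" "zeval R x (f b) \<in> carrier R"
      using Cons.prems by auto
    then show ?case using Cons by (simp add: finsum_insert)
  qed simp
  with * show ?thesis by (simp add: zsum_def)
qed

end

lemma zeval_hom:
  assumes "cring R" "cring S" "h \<in> Ring.ring_hom R S" "\<And>v. v \<in> zvars p \<Longrightarrow> x v \<in> carrier R"
  shows "h (zeval R x p) = zeval S (\<lambda>v. h (x v)) p"
proof -
  interpret R: cring R by fact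
  interpret S: cring S by fact
  interpret hom: ring_hom_cring R S h by unfold_locales (fact assms(3))
  show ?thesis using assms(4)
    by (induction p) (simp_all add: R.zeval_closed)
qed

section \<open>Commutative rings given by a type\<close>

text \<open>Record view of a type-class ring: the record-based notions \<open>Mat\<close>,
  \<open>zeval\<close> and \<open>mat_det\<close> become ordinary arithmetic. It is used for complex
  numbers, integers and dual numbers.\<close>

definition class_ring :: "'a::comm_ring_1 ring" where
  "class_ring = \<lparr>carrier = UNIV, monoid.mult = (*), one = 1, ring.zero = 0, add = (+)\<rparr>"

lemma complex_ring_eq: "complex_ring = class_ring"
  by (simp add: complex_ring_def class_ring_def)

lemma class_ring_simps [simp]:
  "carrier class_ring = UNIV" "x \<otimes>\<^bsub>class_ring\<^esub> y = x * y" "\<one>\<^bsub>class_ring\<^esub> = 1"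
  "\<zero>\<^bsub>class_ring\<^esub> = 0" "x \<oplus>\<^bsub>class_ring\<^esub> y = x + y"
  by (simp_all add: class_ring_def)

interpretation class_ring: cring class_ring
proof (rule cringI)
  show "abelian_group class_ring"
    by (rule abelian_groupI) (auto simp: algebra_simps intro: exI[of _ "- x" for x])
  show "comm_monoid class_ring"
    by (rule comm_monoidI) (auto simp: algebra_simps)
qed (auto simp: algebra_simps)

lemma class_ring_uminus [simp]: "\<ominus>\<^bsub>class_ring\<^esub> x = - x"
  by (rule class_ring.minus_equality) auto

lemma class_ring_minus [simp]: "x \<ominus>\<^bsub>class_ring\<^esub> y = x - y"
  by (simp add: a_minus_def)

lemma class_ring_finsum [simp]: "finite A \<Longrightarrow> finsum class_ring f A = sum f A"
  by (induction rule: finite_induct) auto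

lemma class_ring_finprod [simp]: "finite A \<Longrightarrow> finprod class_ring f A = prod f A"
  by (induction rule: finite_induct) auto

lemma zeval_class_zsum [simp]:
  "finite A \<Longrightarrow> zeval class_ring x (zsum f A) = (\<Sum>a\<in>A. zeval class_ring x (f a))"
  by (simp add: class_ring.zeval_zsum)

lemma zeval_class_zprod [simp]:
  assumes "finite A"
  shows "zeval class_ring x (zprod f A) = (\<Prod>a\<in>A. zeval class_ring x (f a))"
  using assms
proof (rule enumeration)
  fix xs assume *: "(SOME xs. set xs = A \<and> distinct xs) = xs" "set xs = A" "distinct xs"
  have "distinct xs \<Longrightarrow>
      zeval class_ring x (foldr (\<lambda>a. ZMul (f a)) xs ZOne) = (\<Prod>a\<in>set xs. zeval class_ring x (f a))" for xs
    by (induction xs) auto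
  with * show ?thesis by (simp add: zprod_def)
qed

definition int_embed :: "('a, 'r) ring_scheme \<Rightarrow> int \<Rightarrow> 'a" where
  "int_embed R k = add_pow R k \<one>\<^bsub>R\<^esub>"

lemma int_embed_hom:
  assumes "cring R"
  shows "int_embed R \<in> Ring.ring_hom class_ring R"
proof -
  interpret cring R by fact
  show ?thesis
    unfolding int_embed_def
  proof (rule ring_hom_memI)
    fix x y :: int
    have "add_pow R (y * x) \<one>\<^bsub>R\<^esub> = add_pow R y (add_pow R x \<one>\<^bsub>R\<^esub>)"
      by (simp add: add.int_pow_pow mult.commute)
    then show "add_pow R (x \<otimes>\<^bsub>class_ring\<^esub> y) \<one>\<^bsub>R\<^esub> =
        add_pow R x \<one>\<^bsub>R\<^esub> \<otimes>\<^bsub>R\<^esub> add_pow R y \<one>\<^bsub>R\<^esub>"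
      by (simp add: add_pow_rdistr_int mult.commute)
  qed (auto simp: add.int_pow_mult)
qed

text \<open>A variable-free expression denotes the same integer in every ring. This settles the
  transfer of relations without variables.\<close>

lemma zeval_closed_term:
  assumes "cring R" "zvars p = {}"
  shows "zeval R x p = int_embed R (zeval class_ring (\<lambda>_. 0) p)"
  by (subst zeval_hom[OF class_ring.is_cring assms(1) int_embed_hom[OF assms(1)]])
     (use assms(2) in \<open>auto intro: zeval_cong\<close>)

section \<open>Expansion in one variable\<close>

fun zcoeffs_add :: "'v zpoly list \<Rightarrow> 'v zpoly list \<Rightarrow> 'v zpoly list" where
  "zcoeffs_add [] qs = qs"
| "zcoeffs_add ps [] = ps"
| "zcoeffs_add (p # ps) (q # qs) = ZAdd p q # zcoeffs_add ps qs"

primrec zcoeffs_mul :: "'v zpoly list \<Rightarrow> 'v zpoly list \<Rightarrow> 'v zpoly list" where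
  "zcoeffs_mul [] qs = []"
| "zcoeffs_mul (p # ps) qs = zcoeffs_add (map (ZMul p) qs) (ZZero # zcoeffs_mul ps qs)"

text \<open>The expression read as a polynomial in the single variable \<open>v\<close>, lowest
  degree first; the coefficients are expressions in the other variables.\<close>

primrec zcoeffs :: "'v \<Rightarrow> 'v zpoly \<Rightarrow> 'v zpoly list" where
  "zcoeffs v (ZVar u) = (if u = v then [ZZero, ZOne] else [ZVar u])"
| "zcoeffs v ZOne = [ZOne]"
| "zcoeffs v (ZNeg p) = map ZNeg (zcoeffs v p)"
| "zcoeffs v (ZAdd p q) = zcoeffs_add (zcoeffs v p) (zcoeffs v q)"
| "zcoeffs v (ZMul p q) = zcoeffs_mul (zcoeffs v p) (zcoeffs v q)"

definition horner :: "('a, 'r) ring_scheme \<Rightarrow> 'a \<Rightarrow> 'a list \<Rightarrow> 'a" where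
  "horner R t cs = foldr (\<lambda>c s. c \<oplus>\<^bsub>R\<^esub> t \<otimes>\<^bsub>R\<^esub> s) cs \<zero>\<^bsub>R\<^esub>"

lemma zvars_zcoeffs_add:
  "q \<in> set (zcoeffs_add ps qs) \<Longrightarrow> zvars q \<subseteq> (\<Union>p\<in>set ps. zvars p) \<union> (\<Union>p\<in>set qs. zvars p)"
  by (induction ps qs rule: zcoeffs_add.induct) auto

lemma zvars_zcoeffs_mul:
  "q \<in> set (zcoeffs_mul ps qs) \<Longrightarrow> zvars q \<subseteq> (\<Union>p\<in>set ps. zvars p) \<union> (\<Union>p\<in>set qs. zvars p)"
proof (induction ps arbitrary: q)
  case (Cons p ps)
  have "zvars q \<subseteq> (\<Union>r\<in>set (map (ZMul p) qs). zvars r) \<union> (\<Union>r\<in>set (ZZero # zcoeffs_mul ps qs). zvars r)"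
    using Cons.prems by (intro zvars_zcoeffs_add) simp
  also have "\<dots> \<subseteq> (zvars p \<union> (\<Union>p\<in>set qs. zvars p)) \<union>
      ((\<Union>p\<in>set ps. zvars p) \<union> (\<Union>p\<in>set qs. zvars p))"
  proof (rule Un_mono)
    show "(\<Union>r\<in>set (map (ZMul p) qs). zvars r) \<subseteq> zvars p \<union> (\<Union>p\<in>set qs. zvars p)"
      by auto
    show "(\<Union>r\<in>set (ZZero # zcoeffs_mul ps qs). zvars r) \<subseteq>
        (\<Union>p\<in>set ps. zvars p) \<union> (\<Union>p\<in>set qs. zvars p)"
      unfolding list.set UN_insert zvars_ZZero Un_empty_left by (rule UN_least) (rule Cons.IH)
  qed
  also have "\<dots> = (zvars p \<union> (\<Union>p\<in>set ps. zvars p)) \<union> (\<Union>p\<in>set qs. zvars p)"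
    by (simp only: Un_ac Un_absorb Un_left_absorb)
  finally have "zvars q \<subseteq> (zvars p \<union> (\<Union>p\<in>set ps. zvars p)) \<union> (\<Union>p\<in>set qs. zvars p)" .
  then show ?case unfolding list.set UN_insert .
qed simp

text \<open>Passing to coefficients eliminates \<open>v\<close>, which makes the induction on the
  number of free variables decrease.\<close>

lemma zvars_zcoeffs: "q \<in> set (zcoeffs v p) \<Longrightarrow> zvars q \<subseteq> zvars p - {v}"
proof (induction p arbitrary: q)
  case (ZAdd p1 p2)
  have "zvars q \<subseteq> (\<Union>p\<in>set (zcoeffs v p1). zvars p) \<union> (\<Union>p\<in>set (zcoeffs v p2). zvars p)"
    using ZAdd.prems by (intro zvars_zcoeffs_add) simp
  also have "\<dots> \<subseteq> (zvars p1 - {v}) \<union> (zvars p2 - {v})"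
    by (intro Un_mono UN_least ZAdd.IH)
  finally show ?case by auto
next
  case (ZMul p1 p2)
  have "zvars q \<subseteq> (\<Union>p\<in>set (zcoeffs v p1). zvars p) \<union> (\<Union>p\<in>set (zcoeffs v p2). zvars p)"
    using ZMul.prems by (intro zvars_zcoeffs_mul) simp
  also have "\<dots> \<subseteq> (zvars p1 - {v}) \<union> (zvars p2 - {v})"
    by (intro Un_mono UN_least ZMul.IH)
  finally show ?case by auto
next
  case (ZNeg p)
  then obtain r where "r \<in> set (zcoeffs v p)" "q = ZNeg r" by auto
  with ZNeg.IH show ?case by simp
qed (auto split: if_splits)

context cring
begin

lemma horner_closed: "t \<in> carrier R \<Longrightarrow> set cs \<subseteq> carrier R \<Longrightarrow> horner R t cs \<in> carrier R"
  by (induction cs) (auto simp: horner_def)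

lemma horner_zcoeffs_add:
  assumes "t \<in> carrier R" "\<And>v. x v \<in> carrier R"
  shows "horner R t (map (zeval R x) (zcoeffs_add ps qs)) =
    horner R t (map (zeval R x) ps) \<oplus> horner R t (map (zeval R x) qs)"
proof (induction ps qs rule: zcoeffs_add.induct)
  case (3 p ps q qs)
  have "horner R t (map (zeval R x) ps) \<in> carrier R" "horner R t (map (zeval R x) qs) \<in> carrier R"
    using assms by (auto intro!: horner_closed zeval_closed)
  moreover have "zeval R x p \<in> carrier R" "zeval R x q \<in> carrier R"
    using assms by (auto intro!: zeval_closed)
  ultimately show ?case using 3 assms
    by (simp add: horner_def r_distr a_ac)
next
  case (1 qs)
  have "horner R t (map (zeval R x) qs) \<in> carrier R"
    using assms by (auto intro!: horner_closed zeval_closed)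
  then show ?case by (simp add: horner_def)
next
  case (2 p ps)
  have "horner R t (map (zeval R x) (p # ps)) \<in> carrier R"
    using assms by (intro horner_closed) (auto intro!: zeval_closed)
  then show ?case by (simp add: horner_def)
qed

lemma horner_zcoeffs_mul:
  assumes "t \<in> carrier R" "\<And>v. x v \<in> carrier R"
  shows "horner R t (map (zeval R x) (zcoeffs_mul ps qs)) =
    horner R t (map (zeval R x) ps) \<otimes> horner R t (map (zeval R x) qs)"
proof (induction ps)
  case Nil
  have "horner R t (map (zeval R x) qs) \<in> carrier R"
    using assms by (auto intro!: horner_closed zeval_closed)
  then show ?case by (simp add: horner_def)
next
  case (Cons p ps)
  have c: "horner R t (map (zeval R x) qs) \<in> carrier R" for qs
    using assms by (auto intro!: horner_closed zeval_closed)
  have p: "zeval R x p \<in> carrier R"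
    using assms by (auto intro!: zeval_closed)
  have *: "horner R t (map (zeval R x) (map (ZMul p) qs)) = zeval R x p \<otimes> horner R t (map (zeval R x) qs)"
  proof (induction qs)
    case Nil
    then show ?case using p by (simp add: horner_def)
  next
    case (Cons q qs)
    have "zeval R x q \<in> carrier R"
      using assms by (auto intro!: zeval_closed)
    with Cons p c[of qs] assms(1) show ?case
      by (simp add: horner_def r_distr m_ac)
  qed
  have "horner R t (map (zeval R x) (zcoeffs_mul (p # ps) qs)) =
      zeval R x p \<otimes> horner R t (map (zeval R x) qs) \<oplus>
      (\<zero> \<oplus> t \<otimes> (horner R t (map (zeval R x) ps) \<otimes> horner R t (map (zeval R x) qs)))"
    by (simp only: zcoeffs_mul.simps horner_zcoeffs_add[OF assms] *)
       (simp add: horner_def Cons.IH[unfolded horner_def])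
  also have "\<dots> = (zeval R x p \<oplus> t \<otimes> horner R t (map (zeval R x) ps)) \<otimes> horner R t (map (zeval R x) qs)"
    using c[of qs] c[of ps] p assms(1) by (simp add: l_distr m_assoc)
  finally show ?case by (simp add: horner_def)
qed

lemma zeval_zcoeffs:
  assumes "\<And>v. x v \<in> carrier R"
  shows "zeval R x p = horner R (x v) (map (zeval R x) (zcoeffs v p))"
proof (induction p)
  case (ZNeg p)
  have "horner R (x v) (map (zeval R x) (map ZNeg ps)) = \<ominus> horner R (x v) (map (zeval R x) ps)" for ps
  proof (induction ps)
    case (Cons q qs)
    have "horner R (x v) (map (zeval R x) qs) \<in> carrier R" "zeval R x q \<in> carrier R"
      using assms by (auto intro!: horner_closed zeval_closed)
    with Cons assms[of v] show ?case
      by (simp add: horner_def minus_add r_minus)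
  qed (simp add: horner_def)
  then show ?case using ZNeg by simp
next
  case (ZAdd p q)
  then show ?case using assms by (simp add: horner_zcoeffs_add)
next
  case (ZMul p q)
  then show ?case using assms by (simp add: horner_zcoeffs_mul)
qed (use assms in \<open>auto simp: horner_def\<close>)

end

text \<open>Links coefficient lists to library polynomials, for which vanishing at all complex
  arguments implies being zero.\<close>

lemma horner_poly: "horner class_ring t cs = poly (Poly cs) t"
  by (induction cs) (auto simp: horner_def)

section \<open>Transfer of polynomial identities from the complex numbers\<close>

text \<open>\<open>integral_point Y V S y\<close>: the coordinates \<open>y v\<close>, \<open>v \<in> V\<close>, define an \<open>S\<close>-point of the closure over
  the integers of the set \<open>Y\<close> of complex points.\<close>

definition integral_point ::
  "('v \<Rightarrow> complex) set \<Rightarrow> 'v set \<Rightarrow> ('b, 's) ring_scheme \<Rightarrow> ('v \<Rightarrow> 'b) \<Rightarrow> bool" where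
  "integral_point Y V S y \<longleftrightarrow> y ` V \<subseteq> carrier S \<and>
     (\<forall>p. zvars p \<subseteq> V \<longrightarrow> (\<forall>c\<in>Y. zeval class_ring c p = 0) \<longrightarrow> zeval S y p = \<zero>\<^bsub>S\<^esub>)"

lemma finite_zvars: "finite (zvars p)"
  by (induction p) auto

text \<open>Here \<open>Inl\<close> marks coordinates constrained to \<open>Y\<close> and
  \<open>Inr\<close> marks free ones. A relation valid for all complex values of a free variable has
  coefficients that vanish on \<open>Y\<close>. Eliminating the free variables one by one leaves
  relations among the constrained coordinates only, and these hold at \<open>y\<close> by
  assumption.\<close>

lemma integral_point_extend:
  fixes p :: "('v + 'w) zpoly"
  assumes S: "cring S" and y: "integral_point Y V S y"
    and p: "Inl -` zvars p \<subseteq> V" "\<And>c x. c \<in> Y \<Longrightarrow> zeval class_ring (case_sum c x) p = 0"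
    and x: "\<And>w. x w \<in> carrier S"
  shows "zeval S (case_sum y x) p = \<zero>\<^bsub>S\<^esub>"
  using p
proof (induction "card (Inr -` zvars p)" arbitrary: p rule: less_induct)
  case less
  interpret S: cring S by fact
  \<comment> \<open>Outside \<open>V\<close> the values of \<open>y\<close> may leave the carrier,
    whereas \<open>zeval_zcoeffs\<close> asks for closedness at every variable; the default zero
    repairs this without changing the value of the expressions considered.\<close>
  define y' where "y' v = (if v \<in> V then y v else \<zero>\<^bsub>S\<^esub>)" for v
  have y': "case_sum y' x v \<in> carrier S" for v
    using y x by (auto simp: y'_def integral_point_def split: sum.split)
  have eq: "zeval S (case_sum y x) q = zeval S (case_sum y' x) q" if "Inl -` zvars q \<subseteq> V" for q
    using that by (intro zeval_cong) (auto simp: y'_def split: sum.split)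
  show ?case
  proof (cases "Inr -` zvars p = {}")
    \<comment> \<open>No free variable is left: after renaming, the expression is one of the
      relations in the definition of \<open>integral_point\<close>.\<close>
    case True
    then have sub: "zvars p \<subseteq> Inl ` V" using less.prems(1)
      by (auto simp: image_iff) (metis old.sum.exhaust vimage_eq subsetD empty_iff)
    have *: "zeval T (case_sum z x) p = zeval T z (map_zpoly projl p)"
      for T :: "('t, 'u) ring_scheme" and z x
      unfolding zeval_map using sub by (intro zeval_cong) auto
    have "zvars (map_zpoly projl p) \<subseteq> V"
      using sub by (auto simp: zpoly.set_map)
    moreover have "zeval class_ring c (map_zpoly projl p) = 0" if "c \<in> Y" for c
      using less.prems(2)[OF that] unfolding * .
    ultimately show ?thesis using y unfolding * integral_point_def by blast
  next
    case False
    then obtain w where w: "Inr w \<in> zvars p" by auto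
    have van: "zeval S (case_sum y x) q = \<zero>\<^bsub>S\<^esub>" if q: "q \<in> set (zcoeffs (Inr w) p)" for q
    proof (rule less.hyps)
      note z = zvars_zcoeffs[OF q]
      have fin: "finite (Inr -` zvars p :: 'w set)"
        by (simp add: finite_vimageI finite_zvars)
      show "card (Inr -` zvars q :: 'w set) < card (Inr -` zvars p :: 'w set)"
        by (rule psubset_card_mono[OF fin]) (use z w in blast)
      show "Inl -` zvars q \<subseteq> V" using z less.prems(1) by blast
      fix c :: "'v \<Rightarrow> complex" and x :: "'w \<Rightarrow> complex" assume c: "c \<in> Y"
      \<comment> \<open>The coefficients do not contain \<open>w\<close>, so letting its value run
        through all complex \<open>t\<close> keeps them fixed while the whole expression stays
        zero.\<close>
      have "poly (Poly (map (zeval class_ring (case_sum c x)) (zcoeffs (Inr w) p))) t = 0" for t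
      proof -
        have "map (zeval class_ring (case_sum c x)) (zcoeffs (Inr w) p) =
            map (zeval class_ring (case_sum c (x(w := t)))) (zcoeffs (Inr w) p)"
          by (rule map_cong[OF refl], rule zeval_cong)
             (auto dest!: zvars_zcoeffs split: sum.split)
        moreover have "zeval class_ring (case_sum c (x(w := t))) p =
            poly (Poly (map (zeval class_ring (case_sum c (x(w := t)))) (zcoeffs (Inr w) p))) t"
          using class_ring.zeval_zcoeffs[of "case_sum c (x(w := t))" p "Inr w"]
          by (simp add: horner_poly)
        ultimately show ?thesis
          using less.prems(2)[OF c, of "x(w := t)"] by (simp only:)
      qed
      then have "Poly (map (zeval class_ring (case_sum c x)) (zcoeffs (Inr w) p)) = 0"
        using poly_all_0_iff_0 by blast
      \<comment> \<open>\<open>Poly\<close> strips trailing zeros, so a zero polynomial means that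
        the whole list consists of zeros.\<close>
      then obtain n where "map (zeval class_ring (case_sum c x)) (zcoeffs (Inr w) p) = replicate n 0"
        unfolding Poly_eq_0 by blast
      then have "\<forall>a\<in>set (map (zeval class_ring (case_sum c x)) (zcoeffs (Inr w) p)). a = 0"
        by (simp only: set_replicate_conv_if) simp
      then show "zeval class_ring (case_sum c x) q = 0"
        using q by simp
    qed
    have z: "Inl -` zvars q \<subseteq> V" if "q \<in> set (zcoeffs (Inr w) p)" for q
      using zvars_zcoeffs[OF that] less.prems(1) by blast
    have "zeval S (case_sum y x) p =
        horner S (x w) (map (zeval S (case_sum y' x)) (zcoeffs (Inr w) p))"
      using S.zeval_zcoeffs[of "case_sum y' x" p "Inr w"] y' eq[OF less.prems(1)] by simp
    also have "map (zeval S (case_sum y' x)) (zcoeffs (Inr w) p) =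
        map (\<lambda>_. \<zero>\<^bsub>S\<^esub>) (zcoeffs (Inr w) p)"
      by (rule map_cong[OF refl]) (metis van eq z)
    also have "horner S (x w) (map (\<lambda>_. \<zero>\<^bsub>S\<^esub>) qs) = \<zero>\<^bsub>S\<^esub>" for qs
      by (induction qs) (use x in \<open>auto simp: horner_def\<close>)
    finally show ?thesis .
  qed
qed

text \<open>The case in which all variables are free: an identity of integer polynomials that holds
  over the complex numbers holds in every commutative ring. It reduces identities between
  record-based ring sums to sum manipulations over a type.\<close>

lemma zeval_eq_0_transfer:
  fixes p :: "'w zpoly"
  assumes S: "cring S" and p: "\<And>x. zeval class_ring (x :: 'w \<Rightarrow> complex) p = 0"
    and x: "\<And>w. w \<in> zvars p \<Longrightarrow> x w \<in> carrier S"
  shows "zeval S x p = \<zero>\<^bsub>S\<^esub>"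
proof -
  interpret S: cring S by fact
  define x' where "x' w = (if w \<in> zvars p then x w else \<zero>\<^bsub>S\<^esub>)" for w
  \<comment> \<open>With no constrained coordinates, the one-point set is integral because a closed
    expression is an integer and the integers embed into the complex numbers.\<close>
  have pt: "integral_point {\<lambda>_::unit. 0} {} S (\<lambda>_. \<zero>\<^bsub>S\<^esub>)"
  proof -
    have "zeval S (\<lambda>_. \<zero>\<^bsub>S\<^esub>) q = \<zero>\<^bsub>S\<^esub>"
      if "zvars q = {}" "zeval class_ring (\<lambda>_. 0::complex) q = 0" for q :: "unit zpoly"
    proof -
      have "of_int \<in> Ring.ring_hom (class_ring :: int ring) (class_ring :: complex ring)"
        by (rule ring_hom_memI) auto
      from zeval_hom[OF class_ring.is_cring class_ring.is_cring this, of q "\<lambda>_. 0"] that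
      have "zeval class_ring (\<lambda>_. 0::int) q = 0" by simp
      moreover have "int_embed S 0 = \<zero>\<^bsub>S\<^esub>" by (simp add: int_embed_def add_pow_def)
      ultimately show ?thesis by (simp add: zeval_closed_term[OF S that(1)])
    qed
    then show ?thesis by (auto simp: integral_point_def)
  qed
  have "zeval S (case_sum (\<lambda>_::unit. \<zero>\<^bsub>S\<^esub>) x') (map_zpoly Inr p) = \<zero>\<^bsub>S\<^esub>"
    by (rule integral_point_extend[OF S pt])
       (auto simp: zeval_map zpoly.set_map o_def p x'_def x)
  then have "zeval S x' p = \<zero>\<^bsub>S\<^esub>" by (simp add: zeval_map o_def)
  then show ?thesis
    by (subst (asm) zeval_cong[of p x' x]) (auto simp: x'_def)
qed



(* otherwise the simplifier rewrites the index sets {1..n+1} and splits sums over them *)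
declare One_nat_def [simp del] sum.cl_ivl_Suc [simp del]

section \<open>Matrices\<close>

lemma Mat_carrierD: "A \<in> carrier (Mat R I) \<Longrightarrow> i \<in> I \<Longrightarrow> j \<in> I \<Longrightarrow> A i j \<in> carrier R"
  by (fastforce simp: Mat_def PiE_iff)

lemma Mat_carrierI: "(\<And>i j. i \<in> I \<Longrightarrow> j \<in> I \<Longrightarrow> f i j \<in> carrier R) \<Longrightarrow>
    (\<lambda>i\<in>I. \<lambda>j\<in>I. f i j) \<in> carrier (Mat R I)"
  by (auto simp: Mat_def)

lemma Mat_eqI:
  assumes "A \<in> carrier (Mat R I)" "B \<in> carrier (Mat R I)"
    and "\<And>i j. i \<in> I \<Longrightarrow> j \<in> I \<Longrightarrow> A i j = B i j"
  shows "A = B"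
proof (rule PiE_ext)
  show "A \<in> I \<rightarrow>\<^sub>E I \<rightarrow>\<^sub>E carrier R" "B \<in> I \<rightarrow>\<^sub>E I \<rightarrow>\<^sub>E carrier R"
    using assms(1,2) by (auto simp: Mat_def)
  then show "A i = B i" if "i \<in> I" for i
    using assms(3) that by (intro PiE_ext[of "A i" I "\<lambda>_. carrier R" "B i"]) auto
qed

lemma Mat_mult_entry:
  "i \<in> I \<Longrightarrow> j \<in> I \<Longrightarrow> (A \<otimes>\<^bsub>Mat R I\<^esub> B) i j = (\<Oplus>\<^bsub>R\<^esub>k\<in>I. A i k \<otimes>\<^bsub>R\<^esub> B k j)"
  by (simp add: Mat_def)

lemma Mat_one_entry:
  "i \<in> I \<Longrightarrow> j \<in> I \<Longrightarrow> \<one>\<^bsub>Mat R I\<^esub> i j = (if i = j then \<one>\<^bsub>R\<^esub> else \<zero>\<^bsub>R\<^esub>)"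
  by (simp add: Mat_def)

lemma Mat_mult_restrict:
  "A \<otimes>\<^bsub>Mat R I\<^esub> B = (\<lambda>i\<in>I. \<lambda>j\<in>I. \<Oplus>\<^bsub>R\<^esub>k\<in>I. A i k \<otimes>\<^bsub>R\<^esub> B k j)"
  by (simp add: Mat_def)

context cring
begin

lemma Mat_mult_closed:
  assumes "A \<in> carrier (Mat R I)" "B \<in> carrier (Mat R I)"
  shows "A \<otimes>\<^bsub>Mat R I\<^esub> B \<in> carrier (Mat R I)"
  unfolding Mat_mult_restrict
  using assms[THEN Mat_carrierD] by (intro Mat_carrierI finsum_closed) auto

text \<open>An identity of integer polynomials in the entries, so it is proved over the complex
  numbers and transferred. The tags 0, 1, 2 of the variables stand for \<open>A\<close>,
  \<open>B\<close>, \<open>C\<close>.\<close>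

lemma Mat_mult_assoc:
  fixes I :: "'i set"
  assumes I: "finite I"
    and A: "A \<in> carrier (Mat R I)" "B \<in> carrier (Mat R I)" "C \<in> carrier (Mat R I)"
  shows "A \<otimes>\<^bsub>Mat R I\<^esub> B \<otimes>\<^bsub>Mat R I\<^esub> C = A \<otimes>\<^bsub>Mat R I\<^esub> (B \<otimes>\<^bsub>Mat R I\<^esub> C)"
proof (rule Mat_eqI[of _ R])
  fix i j assume ij: "i \<in> I" "j \<in> I"
  define V :: "nat \<Rightarrow> 'i \<Rightarrow> 'i \<Rightarrow> (nat \<times> 'i \<times> 'i) zpoly" where "V k i j = ZVar (k, i, j)" for k i j
  define x where "x = (\<lambda>(k::nat, i, j). (if k = 0 then A else if k = 1 then B else C) i j)"
  define p where "p = ZAdd (zsum (\<lambda>l. ZMul (zsum (\<lambda>k. ZMul (V 0 i k) (V 1 k l)) I) (V 2 l j)) I)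
     (ZNeg (zsum (\<lambda>k. ZMul (V 0 i k) (zsum (\<lambda>l. ZMul (V 1 k l) (V 2 l j)) I)) I))"
  have x: "x v \<in> carrier R" if "v \<in> UNIV \<times> I \<times> I" for v
    using that A[THEN Mat_carrierD] by (auto simp: x_def)
  have "zeval R x p = \<zero>"
  proof (rule zeval_eq_0_transfer[OF is_cring])
    show "zeval class_ring y p = 0" for y :: "_ \<Rightarrow> complex"
      unfolding p_def V_def
      by (simp add: I sum_distrib_left sum_distrib_right mult.assoc) (rule sum.swap)
    show "x w \<in> carrier R" if "w \<in> zvars p" for w
      using that ij by (intro x) (auto simp: p_def V_def zvars_zsum I)
  qed
  moreover have "zeval R x p = (A \<otimes>\<^bsub>Mat R I\<^esub> B \<otimes>\<^bsub>Mat R I\<^esub> C) i j \<ominus> (A \<otimes>\<^bsub>Mat R I\<^esub> (B \<otimes>\<^bsub>Mat R I\<^esub> C)) i j"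
  proof -
    have V: "zeval R x (V 0 k l) = A k l" "zeval R x (V 1 k l) = B k l" "zeval R x (V 2 k l) = C k l" for k l
      by (simp_all add: V_def x_def)
    have vars: "w \<in> zvars (V k a b) \<Longrightarrow> a \<in> I \<Longrightarrow> b \<in> I \<Longrightarrow> x w \<in> carrier R" for w k a b
      by (auto simp: V_def intro!: x)
    have c: "(\<Oplus>k\<in>I. A i k \<otimes> B k l) \<in> carrier R" "(\<Oplus>k\<in>I. B l k \<otimes> C k j) \<in> carrier R" if "l \<in> I" for l
      using that ij A[THEN Mat_carrierD] by (auto intro!: finsum_closed)
    have *: "zeval R x (zsum (\<lambda>k. ZMul (V 0 i k) (V 1 k l)) I) = (\<Oplus>k\<in>I. A i k \<otimes> B k l)" if "l \<in> I" for l
      using that ij by (subst zeval_zsum[OF I]) (auto simp: V dest: vars)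
    have **: "zeval R x (zsum (\<lambda>l. ZMul (V 1 k l) (V 2 l j)) I) = (\<Oplus>l\<in>I. B k l \<otimes> C l j)" if "k \<in> I" for k
      using that ij by (subst zeval_zsum[OF I]) (auto simp: V dest: vars)
    have "zeval R x (zsum (\<lambda>l. ZMul (zsum (\<lambda>k. ZMul (V 0 i k) (V 1 k l)) I) (V 2 l j)) I) =
        (\<Oplus>l\<in>I. zeval R x (ZMul (zsum (\<lambda>k. ZMul (V 0 i k) (V 1 k l)) I) (V 2 l j)))"
      using ij by (intro zeval_zsum[OF I]) (auto simp: zvars_zsum[OF I] dest: vars)
    also have "\<dots> = (\<Oplus>l\<in>I. (\<Oplus>k\<in>I. A i k \<otimes> B k l) \<otimes> C l j)"
      using ij c A[THEN Mat_carrierD] by (intro finsum_cong') (simp_all add: V * Pi_iff)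
    also have "\<dots> = (A \<otimes>\<^bsub>Mat R I\<^esub> B \<otimes>\<^bsub>Mat R I\<^esub> C) i j"
      unfolding Mat_mult_entry[OF ij]
      by (rule finsum_cong') (use ij c A[THEN Mat_carrierD] in \<open>simp_all add: Mat_mult_entry Pi_iff\<close>)
    finally have 1: "zeval R x (zsum (\<lambda>l. ZMul (zsum (\<lambda>k. ZMul (V 0 i k) (V 1 k l)) I) (V 2 l j)) I) =
        (A \<otimes>\<^bsub>Mat R I\<^esub> B \<otimes>\<^bsub>Mat R I\<^esub> C) i j" .
    have "zeval R x (zsum (\<lambda>k. ZMul (V 0 i k) (zsum (\<lambda>l. ZMul (V 1 k l) (V 2 l j)) I)) I) =
        (\<Oplus>k\<in>I. zeval R x (ZMul (V 0 i k) (zsum (\<lambda>l. ZMul (V 1 k l) (V 2 l j)) I)))"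
      using ij by (intro zeval_zsum[OF I]) (auto simp: zvars_zsum[OF I] dest: vars)
    also have "\<dots> = (\<Oplus>k\<in>I. A i k \<otimes> (\<Oplus>l\<in>I. B k l \<otimes> C l j))"
      using ij c A[THEN Mat_carrierD] by (intro finsum_cong') (simp_all add: V ** Pi_iff)
    also have "\<dots> = (A \<otimes>\<^bsub>Mat R I\<^esub> (B \<otimes>\<^bsub>Mat R I\<^esub> C)) i j"
      unfolding Mat_mult_entry[OF ij]
      by (rule finsum_cong') (use ij c A[THEN Mat_carrierD] in \<open>simp_all add: Mat_mult_entry Pi_iff\<close>)
    finally have 2: "zeval R x (zsum (\<lambda>k. ZMul (V 0 i k) (zsum (\<lambda>l. ZMul (V 1 k l) (V 2 l j)) I)) I) =
        (A \<otimes>\<^bsub>Mat R I\<^esub> (B \<otimes>\<^bsub>Mat R I\<^esub> C)) i j" .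
    show ?thesis by (simp add: p_def a_minus_def 1 2)
  qed
  ultimately show "(A \<otimes>\<^bsub>Mat R I\<^esub> B \<otimes>\<^bsub>Mat R I\<^esub> C) i j = (A \<otimes>\<^bsub>Mat R I\<^esub> (B \<otimes>\<^bsub>Mat R I\<^esub> C)) i j"
    using r_right_minus_eq[OF Mat_carrierD[OF _ ij] Mat_carrierD[OF _ ij],
        OF Mat_mult_closed[OF Mat_mult_closed[OF A(1,2)] A(3)] Mat_mult_closed[OF A(1) Mat_mult_closed[OF A(2,3)]]]
    by simp
qed (intro Mat_mult_closed A)+

lemma finsum_delta_left:
  assumes "finite I" "i \<in> I" "\<And>k. k \<in> I \<Longrightarrow> f k \<in> carrier R"
  shows "(\<Oplus>k\<in>I. (if i = k then \<one> else \<zero>) \<otimes> f k) = f i"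
proof -
  have "(\<Oplus>k\<in>I. (if i = k then \<one> else \<zero>) \<otimes> f k) = (\<Oplus>k\<in>I. if i = k then f k else \<zero>)"
    using assms by (intro finsum_cong') auto
  also have "\<dots> = f i"
    using assms by (intro finsum_singleton) auto
  finally show ?thesis .
qed

lemma finsum_delta_right:
  assumes "finite I" "i \<in> I" "\<And>k. k \<in> I \<Longrightarrow> f k \<in> carrier R"
  shows "(\<Oplus>k\<in>I. f k \<otimes> (if k = i then \<one> else \<zero>)) = f i"
proof -
  have "(\<Oplus>k\<in>I. f k \<otimes> (if k = i then \<one> else \<zero>)) = (\<Oplus>k\<in>I. if i = k then f k else \<zero>)"
    using assms by (intro finsum_cong') auto
  also have "\<dots> = f i"
    using assms by (intro finsum_singleton) auto
  finally show ?thesis .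
qed

lemma Mat_one_closed: "\<one>\<^bsub>Mat R I\<^esub> \<in> carrier (Mat R I)"
  by (auto simp: Mat_def)

lemma monoid_Mat:
  assumes "finite I"
  shows "Group.monoid (Mat R I)"
proof (rule monoidI)
  fix A assume A: "A \<in> carrier (Mat R I)"
  show "\<one>\<^bsub>Mat R I\<^esub> \<otimes>\<^bsub>Mat R I\<^esub> A = A"
    by (rule Mat_eqI[OF Mat_mult_closed[OF Mat_one_closed A] A])
       (simp add: Mat_mult_entry Mat_one_entry finsum_delta_left[OF assms] Mat_carrierD[OF A] cong: finsum_cong)
  show "A \<otimes>\<^bsub>Mat R I\<^esub> \<one>\<^bsub>Mat R I\<^esub> = A"
    by (rule Mat_eqI[OF Mat_mult_closed[OF A Mat_one_closed] A])
       (simp add: Mat_mult_entry Mat_one_entry finsum_delta_right[OF assms] Mat_carrierD[OF A] cong: finsum_cong)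
qed (auto intro: Mat_mult_closed Mat_one_closed Mat_mult_assoc assms)

end

lemma mat_map_closed:
  "h \<in> Ring.ring_hom R S \<Longrightarrow> A \<in> carrier (Mat R I) \<Longrightarrow> mat_map I h A \<in> carrier (Mat S I)"
  unfolding mat_map_def by (rule Mat_carrierI) (auto intro: ring_hom_closed Mat_carrierD)

lemma mat_map_mult:
  assumes "cring R" "cring S" "h \<in> Ring.ring_hom R S" "A \<in> carrier (Mat R I)" "B \<in> carrier (Mat R I)"
  shows "mat_map I h (A \<otimes>\<^bsub>Mat R I\<^esub> B) = mat_map I h A \<otimes>\<^bsub>Mat S I\<^esub> mat_map I h B"
proof (rule Mat_eqI)
  interpret R: cring R by fact
  interpret S: cring S by fact
  interpret hom: ring_hom_cring R S h by unfold_locales (fact assms(3))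
  note closed = assms(4,5)[THEN Mat_carrierD]
  show "mat_map I h (A \<otimes>\<^bsub>Mat R I\<^esub> B) \<in> carrier (Mat S I)"
    "mat_map I h A \<otimes>\<^bsub>Mat S I\<^esub> mat_map I h B \<in> carrier (Mat S I)"
    using assms by (auto intro!: mat_map_closed R.Mat_mult_closed S.Mat_mult_closed)
  fix i j assume "i \<in> I" "j \<in> I"
  then show "mat_map I h (A \<otimes>\<^bsub>Mat R I\<^esub> B) i j = (mat_map I h A \<otimes>\<^bsub>Mat S I\<^esub> mat_map I h B) i j"
    using closed
    by (simp add: Mat_mult_entry) (simp add: mat_map_def Mat_mult_entry hom.hom_finsum Pi_iff o_def cong: S.finsum_cong)
qed

lemma mat_map_one:
  assumes "cring R" "cring S" "h \<in> Ring.ring_hom R S"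
  shows "mat_map I h \<one>\<^bsub>Mat R I\<^esub> = \<one>\<^bsub>Mat S I\<^esub>"
proof -
  interpret R: cring R by fact
  interpret S: cring S by fact
  interpret hom: ring_hom_cring R S h by unfold_locales (fact assms(3))
  show ?thesis
    by (rule Mat_eqI) (auto simp: mat_map_def Mat_one_entry R.Mat_one_closed S.Mat_one_closed
        intro!: Mat_carrierI)
qed

section \<open>The three representations\<close>

lemma finite_rep_index [simp]: "finite (rep_index n \<pi>)"
proof -
  have "rep_index n \<pi> \<subseteq> {xs. set xs \<subseteq> {1..n+1} \<and> length xs \<le> 2}"
    by (cases \<pi>) auto
  then show ?thesis
    by (rule finite_subset) (rule finite_lists_length_le, simp)
qed

lemma sum_rep_index:
  "sum f (rep_index n SC) = (\<Sum>i\<in>{1..n+1}. f [i])"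
  "sum f (rep_index n AD) = (\<Sum>i\<in>{1..n+1}. \<Sum>j\<in>{1..n+1}. f [i, j])"
  "sum f (rep_index n MID) = (\<Sum>i\<in>{1..n+1}. \<Sum>j\<in>{1..n+1}. if i < j then f [i, j] else 0)"
proof -
  have 1: "rep_index n SC = (\<lambda>i. [i]) ` {1..n+1}" by auto
  show "sum f (rep_index n SC) = (\<Sum>i\<in>{1..n+1}. f [i])"
    by (simp only: 1) (subst sum.reindex, auto simp: inj_on_def)
  have 2: "rep_index n AD = (\<lambda>(i, j). [i, j]) ` ({1..n+1} \<times> {1..n+1})"
    by (auto simp: image_iff)
  show "sum f (rep_index n AD) = (\<Sum>i\<in>{1..n+1}. \<Sum>j\<in>{1..n+1}. f [i, j])"
    by (simp only: 2) (subst sum.reindex, auto simp: inj_on_def sum.cartesian_product intro!: sum.cong)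
  have 3: "rep_index n MID = (\<lambda>(i, j). [i, j]) ` {p \<in> {1..n+1} \<times> {1..n+1}. fst p < snd p}"
    by (auto simp: image_iff)
  have "sum f (rep_index n MID) = (\<Sum>p \<in> {p \<in> {1..n+1} \<times> {1..n+1}. fst p < snd p}. f [fst p, snd p])"
    by (simp only: 3) (subst sum.reindex, auto simp: inj_on_def intro!: sum.cong)
  also have "\<dots> = (\<Sum>p\<in>{1..n+1} \<times> {1..n+1}. if fst p < snd p then f [fst p, snd p] else 0)"
    by (subst sum.inter_filter) auto
  also have "\<dots> = (\<Sum>i\<in>{1..n+1}. \<Sum>j\<in>{1..n+1}. if i < j then f [i, j] else 0)"
    by (simp add: sum.cartesian_product case_prod_beta)
  finally show "sum f (rep_index n MID) = (\<Sum>i\<in>{1..n+1}. \<Sum>j\<in>{1..n+1}. if i < j then f [i, j] else 0)" .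
qed

text \<open>In the unrestricted sum the terms with \<open>b < a\<close> fold onto those with
  \<open>a < b\<close> by antisymmetry and produce the minors. Vanishing on the diagonal is a
  separate assumption, since 2 may be a zero divisor. This is the source of the Cauchy-Binet formula
  below.\<close>

lemma sum_antisym:
  fixes T :: "'i::linorder \<Rightarrow> 'i \<Rightarrow> 'a::comm_ring_1"
  assumes I: "finite I" and T: "\<And>a b. T b a = - T a b" "\<And>a. T a a = 0"
  shows "(\<Sum>a\<in>I. \<Sum>b\<in>I. if a < b then (u a * v b - u b * v a) * T a b else 0) =
    (\<Sum>a\<in>I. \<Sum>b\<in>I. u a * v b * T a b)"
proof -
  have "(\<Sum>a\<in>I. \<Sum>b\<in>I. u a * v b * T a b) =
      (\<Sum>a\<in>I. \<Sum>b\<in>I. (if a < b then u a * v b * T a b else 0) + (if b < a then u a * v b * T a b else 0))"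
    by (intro sum.cong refl) (auto simp: T(2) not_less_iff_gr_or_eq)
  also have "\<dots> = (\<Sum>a\<in>I. \<Sum>b\<in>I. if a < b then u a * v b * T a b else 0) +
      (\<Sum>a\<in>I. \<Sum>b\<in>I. if b < a then u a * v b * T a b else 0)"
    by (simp add: sum.distrib)
  also have "(\<Sum>a\<in>I. \<Sum>b\<in>I. if b < a then u a * v b * T a b else 0) =
      (\<Sum>a\<in>I. \<Sum>b\<in>I. if a < b then u b * v a * T b a else 0)"
    by (rule sum.swap)
  also have "(\<Sum>a\<in>I. \<Sum>b\<in>I. if a < b then u a * v b * T a b else 0) + \<dots> =
      (\<Sum>a\<in>I. \<Sum>b\<in>I. if a < b then (u a * v b - u b * v a) * T a b else 0)"
    unfolding sum.distrib[symmetric]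
  proof (intro sum.cong refl)
    fix a b
    show "(if a < b then u a * v b * T a b else 0) + (if a < b then u b * v a * T b a else 0) =
        (if a < b then (u a * v b - u b * v a) * T a b else 0)"
      using T(1)[of a b] by (simp add: algebra_simps)
  qed
  finally show ?thesis by simp
qed

text \<open>The matrix product without extensional restriction, so that matrices can be arbitrary
  functions of two indices.\<close>

definition mmul :: "nat \<Rightarrow> (nat \<Rightarrow> nat \<Rightarrow> 'a::comm_ring_1) \<Rightarrow> (nat \<Rightarrow> nat \<Rightarrow> 'a) \<Rightarrow> nat \<Rightarrow> nat \<Rightarrow> 'a" where
  "mmul n A B i k = (\<Sum>j\<in>{1..n+1}. A i j * B j k)"

text \<open>The argument \<open>B\<close> is treated as an independent matrix multiplied in the
  opposite order, so no invertibility enters. For \<open>MID\<close> this is the Cauchy-Binet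
  formula for minors of size 2.\<close>

lemma class_rep_entry_mult:
  assumes "r \<in> rep_index n \<pi>" "c \<in> rep_index n \<pi>"
  shows "(\<Sum>s\<in>rep_index n \<pi>. rep_entry class_ring \<pi> A B r s * rep_entry class_ring \<pi> A' B' s c) =
    rep_entry class_ring \<pi> (mmul n A A') (mmul n B' B) r c"
proof (cases \<pi>)
  case SC
  then obtain i p where rc: "r = [i]" "c = [p]" using assms by auto
  show ?thesis
    unfolding SC rc sum_rep_index by (simp add: mmul_def)
next
  case AD
  then obtain i j p q where rc: "r = [i, j]" "c = [p, q]" using assms by auto
  show ?thesis
    unfolding AD rc sum_rep_index by (simp add: mmul_def sum_product algebra_simps)
next
  case MID
  then obtain i j p q where rc: "r = [i, j]" "c = [p, q]" using assms by auto
  have "(\<Sum>s\<in>rep_index n \<pi>. rep_entry class_ring \<pi> A B r s * rep_entry class_ring \<pi> A' B' s c) =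
      (\<Sum>a\<in>{1..n+1}. \<Sum>b\<in>{1..n+1}. if a < b then
        (A i a * A j b - A i b * A j a) * (A' a p * A' b q - A' a q * A' b p) else 0)"
    unfolding MID rc sum_rep_index by (simp cong: if_cong)
  also have "\<dots> = (\<Sum>a\<in>{1..n+1}. \<Sum>b\<in>{1..n+1}. A i a * A j b * (A' a p * A' b q - A' a q * A' b p))"
    by (rule sum_antisym) (auto simp: algebra_simps)
  also have "\<dots> = rep_entry class_ring \<pi> (mmul n A A') (mmul n B' B) r c"
    unfolding MID rc by (simp add: mmul_def sum_product algebra_simps sum_subtractf)
  finally show ?thesis .
qed

fun rep_poly :: "isogeny \<Rightarrow> (nat \<Rightarrow> nat \<Rightarrow> 'v zpoly) \<Rightarrow> (nat \<Rightarrow> nat \<Rightarrow> 'v zpoly) \<Rightarrow> nat list \<Rightarrow> nat list \<Rightarrow> 'v zpoly" where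
  "rep_poly SC A B [i] [k] = A i k"
| "rep_poly MID A B [i, j] [k, l] = ZAdd (ZMul (A i k) (A j l)) (ZNeg (ZMul (A i l) (A j k)))"
| "rep_poly AD A B [i, j] [k, l] = ZMul (A i k) (B l j)"
| "rep_poly _ A B _ _ = ZZero"

lemma zeval_rep_poly:
  assumes "r \<in> rep_index n \<pi>" "c \<in> rep_index n \<pi>"
  shows "zeval R x (rep_poly \<pi> A B r c) =
    rep_entry R \<pi> (\<lambda>i k. zeval R x (A i k)) (\<lambda>i k. zeval R x (B i k)) r c"
  using assms by (cases \<pi>) (auto simp: a_minus_def)

lemma zvars_rep_poly:
  assumes "r \<in> rep_index n \<pi>" "c \<in> rep_index n \<pi>"
  shows "zvars (rep_poly \<pi> A B r c) \<subseteq> (\<Union>i\<in>{1..n+1}. \<Union>j\<in>{1..n+1}. zvars (A i j) \<union> zvars (B i j))"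
  using assms by (cases \<pi>) (fastforce)+

lemma rep_entry_cong:
  assumes "r \<in> rep_index n \<pi>" "c \<in> rep_index n \<pi>"
    and "\<And>i j. i \<in> {1..n+1} \<Longrightarrow> j \<in> {1..n+1} \<Longrightarrow> A i j = A' i j"
    and "\<And>i j. i \<in> {1..n+1} \<Longrightarrow> j \<in> {1..n+1} \<Longrightarrow> B i j = B' i j"
  shows "rep_entry R \<pi> A B r c = rep_entry R \<pi> A' B' r c"
  using assms by (cases \<pi>) auto

lemma (in cring) rep_entry_closed:
  assumes "r \<in> rep_index n \<pi>" "c \<in> rep_index n \<pi>"
    and "A \<in> carrier (Mat R {1..n+1})" "B \<in> carrier (Mat R {1..n+1})"
  shows "rep_entry R \<pi> A B r c \<in> carrier R"
  using assms(1,2) assms(3,4)[THEN Mat_carrierD] by (cases \<pi>) auto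

lemma rep_entry_hom:
  assumes "cring R" "cring S" "h \<in> Ring.ring_hom R S"
    and "r \<in> rep_index n \<pi>" "c \<in> rep_index n \<pi>"
    and "A \<in> carrier (Mat R {1..n+1})" "B \<in> carrier (Mat R {1..n+1})"
  shows "h (rep_entry R \<pi> A B r c) = rep_entry S \<pi> (mat_map {1..n+1} h A) (mat_map {1..n+1} h B) r c"
proof -
  interpret R: cring R by fact
  interpret S: cring S by fact
  interpret hom: ring_hom_cring R S h by unfold_locales (fact assms(3))
  show ?thesis
    using assms(4,5) assms(6,7)[THEN Mat_carrierD]
    by (cases \<pi>) (auto simp: a_minus_def mat_map_def)
qed

text \<open>Transferred from \<open>class_rep_entry_mult\<close>; the tags 0, 1, 2, 3 stand for
  \<open>A\<close>, \<open>B\<close>, \<open>A'\<close>, \<open>B'\<close>.\<close>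

lemma (in cring) rep_entry_mult:
  assumes rc: "r \<in> rep_index n \<pi>" "c \<in> rep_index n \<pi>"
    and A: "A \<in> carrier (Mat R {1..n+1})" "B \<in> carrier (Mat R {1..n+1})"
      "A' \<in> carrier (Mat R {1..n+1})" "B' \<in> carrier (Mat R {1..n+1})"
  shows "(\<Oplus>s\<in>rep_index n \<pi>. rep_entry R \<pi> A B r s \<otimes> rep_entry R \<pi> A' B' s c) =
    rep_entry R \<pi> (A \<otimes>\<^bsub>Mat R {1..n+1}\<^esub> A') (B' \<otimes>\<^bsub>Mat R {1..n+1}\<^esub> B) r c"
proof -
  let ?I = "rep_index n \<pi>" and ?J = "{1..n+1}"
  define V :: "nat \<Rightarrow> nat \<Rightarrow> nat \<Rightarrow> (nat \<times> nat \<times> nat) zpoly" where "V k i j = ZVar (k, i, j)" for k i j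
  define x where "x = (\<lambda>(k::nat, i, j). (if k = 0 then A else if k = 1 then B else if k = 2 then A' else B') i j)"
  define q where "q = rep_poly \<pi> (\<lambda>i k. zsum (\<lambda>j. ZMul (V 0 i j) (V 2 j k)) ?J)
     (\<lambda>i k. zsum (\<lambda>j. ZMul (V 3 i j) (V 1 j k)) ?J) r c"
  define s where "s = zsum (\<lambda>s. ZMul (rep_poly \<pi> (V 0) (V 1) r s) (rep_poly \<pi> (V 2) (V 3) s c)) ?I"
  have x: "x v \<in> carrier R" if "v \<in> UNIV \<times> ?J \<times> ?J" for v
    using that A[THEN Mat_carrierD] by (auto simp: x_def)
  have q: "zvars q \<subseteq> UNIV \<times> ?J \<times> ?J"
    unfolding q_def by (rule subset_trans[OF zvars_rep_poly[OF rc]]) (auto simp: zvars_zsum V_def)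
  have v: "zvars (rep_poly \<pi> (V k) (V l) a b) \<subseteq> UNIV \<times> ?J \<times> ?J" if "a \<in> ?I" "b \<in> ?I" for k l a b
    by (rule subset_trans[OF zvars_rep_poly[OF that]]) (auto simp: V_def)
  have s: "zvars s \<subseteq> UNIV \<times> ?J \<times> ?J"
    unfolding s_def using v rc by (subst zvars_zsum) (simp_all add: UN_subset_iff)
  have "zeval R x (ZAdd s (ZNeg q)) = \<zero>"
  proof (rule zeval_eq_0_transfer[OF is_cring])
    fix y :: "_ \<Rightarrow> complex"
    have "zeval class_ring y s = (\<Sum>a\<in>?I.
        rep_entry class_ring \<pi> (\<lambda>i k. zeval class_ring y (V 0 i k)) (\<lambda>i k. zeval class_ring y (V 1 i k)) r a *
        rep_entry class_ring \<pi> (\<lambda>i k. zeval class_ring y (V 2 i k)) (\<lambda>i k. zeval class_ring y (V 3 i k)) a c)"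
      unfolding s_def by (simp add: zeval_rep_poly[OF rc(1)] zeval_rep_poly[OF _ rc(2)])
    then have "zeval class_ring y s = zeval class_ring y q"
      unfolding class_rep_entry_mult[OF rc] q_def zeval_rep_poly[OF rc]
      by (simp add: mmul_def[abs_def])
    then show "zeval class_ring y (ZAdd s (ZNeg q)) = 0" by simp
  next
    show "w \<in> zvars (ZAdd s (ZNeg q)) \<Longrightarrow> x w \<in> carrier R" for w
      using q s x by auto
  qed
  moreover have "zeval R x s \<in> carrier R" "zeval R x q \<in> carrier R"
    using q s x by (auto intro!: zeval_closed)
  ultimately have "zeval R x s = zeval R x q"
    by (simp add: r_right_minus_eq flip: a_minus_def)
  moreover have "zeval R x s = (\<Oplus>s\<in>?I. rep_entry R \<pi> A B r s \<otimes> rep_entry R \<pi> A' B' s c)"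
    unfolding s_def
  proof (subst zeval_zsum)
    show "(\<Oplus>a\<in>?I. zeval R x (ZMul (rep_poly \<pi> (V 0) (V 1) r a) (rep_poly \<pi> (V 2) (V 3) a c))) =
        (\<Oplus>s\<in>?I. rep_entry R \<pi> A B r s \<otimes> rep_entry R \<pi> A' B' s c)"
      using rc by (intro finsum_cong')
        (auto simp: zeval_rep_poly V_def x_def intro!: rep_entry_closed A simp del: rep_index.simps)
    show "x w \<in> carrier R" if "a \<in> ?I" "w \<in> zvars (ZMul (rep_poly \<pi> (V 0) (V 1) r a) (rep_poly \<pi> (V 2) (V 3) a c))" for a w
    proof (rule x)
      have "zvars (ZMul (rep_poly \<pi> (V 0) (V 1) r a) (rep_poly \<pi> (V 2) (V 3) a c)) \<subseteq> UNIV \<times> ?J \<times> ?J"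
        unfolding zpoly.set by (intro Un_least v rc that(1))
      with that(2) show "w \<in> UNIV \<times> ?J \<times> ?J" by (rule rev_subsetD)
    qed
  qed simp
  moreover have "zeval R x q = rep_entry R \<pi> (A \<otimes>\<^bsub>Mat R ?J\<^esub> A') (B' \<otimes>\<^bsub>Mat R ?J\<^esub> B) r c"
    unfolding q_def zeval_rep_poly[OF rc]
  proof (rule rep_entry_cong[OF rc])
    fix i j assume ij: "i \<in> {1..n+1}" "j \<in> {1..n+1}"
    show "zeval R x (zsum (\<lambda>k. ZMul (V 0 i k) (V 2 k j)) ?J) = (A \<otimes>\<^bsub>Mat R ?J\<^esub> A') i j"
      using ij by (subst zeval_zsum) (auto simp: V_def Mat_mult_entry intro!: x, auto simp: x_def)
    show "zeval R x (zsum (\<lambda>k. ZMul (V 3 i k) (V 1 k j)) ?J) = (B' \<otimes>\<^bsub>Mat R ?J\<^esub> B) i j"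
      using ij by (subst zeval_zsum) (auto simp: V_def Mat_mult_entry intro!: x, auto simp: x_def)
  qed
  ultimately show ?thesis by simp
qed

context cring
begin

lemma rep_closed:
  assumes "A \<in> Units (Mat R {1..n+1})"
  shows "rep R n \<pi> A \<in> carrier (Mat R (rep_index n \<pi>))"
proof -
  interpret M: Group.monoid "Mat R {1..n+1}" by (rule monoid_Mat) simp
  show ?thesis unfolding rep_def
    using assms by (intro Mat_carrierI rep_entry_closed) auto
qed

lemma rep_mult:
  assumes "A \<in> Units (Mat R {1..n+1})" "B \<in> Units (Mat R {1..n+1})"
  shows "rep R n \<pi> (A \<otimes>\<^bsub>Mat R {1..n+1}\<^esub> B) = rep R n \<pi> A \<otimes>\<^bsub>Mat R (rep_index n \<pi>)\<^esub> rep R n \<pi> B"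
proof (rule Mat_eqI)
  interpret M: Group.monoid "Mat R {1..n+1}" by (rule monoid_Mat) simp
  show "rep R n \<pi> (A \<otimes>\<^bsub>Mat R {1..n+1}\<^esub> B) \<in> carrier (Mat R (rep_index n \<pi>))"
    "rep R n \<pi> A \<otimes>\<^bsub>Mat R (rep_index n \<pi>)\<^esub> rep R n \<pi> B \<in> carrier (Mat R (rep_index n \<pi>))"
    using assms by (auto intro!: rep_closed Mat_mult_closed)
  have inv: "inv\<^bsub>Mat R {1..n+1}\<^esub> (A \<otimes>\<^bsub>Mat R {1..n+1}\<^esub> B) =
      inv\<^bsub>Mat R {1..n+1}\<^esub> B \<otimes>\<^bsub>Mat R {1..n+1}\<^esub> inv\<^bsub>Mat R {1..n+1}\<^esub> A"
    using group.inv_mult_group[OF M.units_group, of A B] assms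
    by (simp add: units_of_carrier units_of_mult M.units_of_inv)
  fix r c assume rc: "r \<in> rep_index n \<pi>" "c \<in> rep_index n \<pi>"
  have "(rep R n \<pi> A \<otimes>\<^bsub>Mat R (rep_index n \<pi>)\<^esub> rep R n \<pi> B) r c =
      (\<Oplus>s\<in>rep_index n \<pi>. rep_entry R \<pi> A (inv\<^bsub>Mat R {1..n+1}\<^esub> A) r s \<otimes>
        rep_entry R \<pi> B (inv\<^bsub>Mat R {1..n+1}\<^esub> B) s c)"
    unfolding Mat_mult_entry[OF rc] using rc assms
    by (intro finsum_cong') (auto simp: rep_def intro!: rep_entry_closed simp del: rep_index.simps)
  also have "\<dots> = rep_entry R \<pi> (A \<otimes>\<^bsub>Mat R {1..n+1}\<^esub> B)
      (inv\<^bsub>Mat R {1..n+1}\<^esub> B \<otimes>\<^bsub>Mat R {1..n+1}\<^esub> inv\<^bsub>Mat R {1..n+1}\<^esub> A) r c"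
    using assms by (intro rep_entry_mult rc) auto
  also have "\<dots> = rep R n \<pi> (A \<otimes>\<^bsub>Mat R {1..n+1}\<^esub> B) r c"
    using rc assms by (simp add: rep_def inv)
  finally show "rep R n \<pi> (A \<otimes>\<^bsub>Mat R {1..n+1}\<^esub> B) r c =
    (rep R n \<pi> A \<otimes>\<^bsub>Mat R (rep_index n \<pi>)\<^esub> rep R n \<pi> B) r c" ..
qed

lemma rep_one: "rep R n \<pi> \<one>\<^bsub>Mat R {1..n+1}\<^esub> = \<one>\<^bsub>Mat R (rep_index n \<pi>)\<^esub>"
proof (rule Mat_eqI)
  interpret M: Group.monoid "Mat R {1..n+1}" by (rule monoid_Mat) simp
  show "rep R n \<pi> \<one>\<^bsub>Mat R {1..n+1}\<^esub> \<in> carrier (Mat R (rep_index n \<pi>))"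
    by (rule rep_closed) simp
  fix r c assume "r \<in> rep_index n \<pi>" "c \<in> rep_index n \<pi>"
  then show "rep R n \<pi> \<one>\<^bsub>Mat R {1..n+1}\<^esub> r c = \<one>\<^bsub>Mat R (rep_index n \<pi>)\<^esub> r c"
    by (cases \<pi>) (auto simp: rep_def Mat_one_entry a_minus_def split: if_splits)
qed (rule Mat_one_closed)

end



section \<open>Determinants and inverses over a commutative ring type\<close>

lemma mat_det_class:
  fixes A :: "'i \<Rightarrow> 'i \<Rightarrow> 'a::comm_ring_1"
  assumes "finite I"
  shows "mat_det class_ring I A = (\<Sum>p\<in>{p. p permutes I}. of_int (sign p) * (\<Prod>i\<in>I. A i (p i)))"
  unfolding mat_det_def Let_def
  by (simp add: finite_permutations assms sign_def cong: if_cong) (rule sum.cong, auto)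

definition to_mat :: "nat \<Rightarrow> (nat \<Rightarrow> nat \<Rightarrow> 'a) \<Rightarrow> 'a mat" where
  "to_mat m A = mat m m (\<lambda>(i, j). A (i + 1) (j + 1))"

text \<open>The shift between the index sets \<open>{1..m}\<close> and \<open>{0..<m}\<close>
  transports permutations and preserves signs. This gives access to the adjugate matrix of the
  library.\<close>

lemma det_to_mat:
  fixes A :: "nat \<Rightarrow> nat \<Rightarrow> 'a::comm_ring_1"
  shows "det (to_mat m A) = mat_det class_ring {1..m} A"
proof -
  let ?f = "\<lambda>i::nat. i + 1" and ?g = "\<lambda>i::nat. i - 1" and ?A = "{0..<m}" and ?B = "{1..m}"
  have f: "bij_betw ?f ?A ?B" by (rule bij_betw_byWitness[of _ ?g]) auto
  have g: "bij_betw ?g ?B ?A" by (rule bij_betw_byWitness[of _ ?f]) auto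
  have "mat_det class_ring ?B A = (\<Sum>p\<in>{p. p permutes ?B}. of_int (sign p) * (\<Prod>i\<in>?B. A i (p i)))"
    by (simp add: mat_det_class)
  also have "\<dots> = (\<Sum>p\<in>{p. p permutes ?A}. signof p * (\<Prod>i=0..<m. to_mat m A $$ (i, p i)))"
  proof (rule sum.reindex_bij_witness[of _ "map_permutation ?A ?f" "map_permutation ?B ?g"])
    fix p assume "p \<in> {p. p permutes ?B}"
    then have p: "p permutes ?B" by simp
    show "map_permutation ?A ?f (map_permutation ?B ?g p) = p"
      by (rule map_permutation_compose_inv[OF g p]) auto
    show q: "map_permutation ?B ?g p \<in> {p. p permutes ?A}"
      using map_permutation_permutes[OF g p] by simp
    have e: "map_permutation ?B ?g p i = p (i + 1) - 1" if "i < m" for i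
      using map_permutation_apply[of ?g ?B "i + 1" p] g that by (simp add: bij_betw_def)
    have "(\<Prod>i=0..<m. to_mat m A $$ (i, map_permutation ?B ?g p i)) = (\<Prod>i=0..<m. A (i + 1) (p (i + 1)))"
    proof (rule prod.cong[OF refl])
      fix i assume i: "i \<in> {0..<m}"
      then have "p (i + 1) \<in> ?B" using permutes_in_image[OF p, of "i + 1"] by simp
      then have "p (i + 1) - 1 < m" "p (i + 1) - 1 + 1 = p (i + 1)" by auto
      then show "to_mat m A $$ (i, map_permutation ?B ?g p i) = A (i + 1) (p (i + 1))"
        using i e[of i] by (simp add: to_mat_def)
    qed
    also have "\<dots> = (\<Prod>i\<in>?B. A i (p i))"
      by (rule prod.reindex_bij_betw[OF f])
    finally show "signof (map_permutation ?B ?g p) * (\<Prod>i=0..<m. to_mat m A $$ (i, map_permutation ?B ?g p i)) =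
        of_int (sign p) * (\<Prod>i\<in>?B. A i (p i))"
      using g by (simp add: sign_map_permutation[OF _ p] bij_betw_def)
  next
    fix p assume "p \<in> {p. p permutes ?A}"
    then have p: "p permutes ?A" by simp
    show "map_permutation ?B ?g (map_permutation ?A ?f p) = p"
      by (rule map_permutation_compose_inv[OF f p]) auto
    show "map_permutation ?A ?f p \<in> {p. p permutes ?B}"
      using map_permutation_permutes[OF f p] by simp
  qed
  also have "\<dots> = det (to_mat m A)"
    by (rule det_def'[symmetric]) (simp add: to_mat_def)
  finally show ?thesis ..
qed

text \<open>The entry \<open>(j, i)\<close> of the adjugate: the signed minor with row
  \<open>i\<close> and column \<open>j\<close> deleted. The maps \<open>s\<close> and
  \<open>t\<close> list the remaining indices, which start at 1, by positions starting at 0.\<close>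

definition adj_poly :: "nat \<Rightarrow> nat \<Rightarrow> nat \<Rightarrow> (nat \<times> nat) zpoly" where
  "adj_poly n j i =
    (let s = (\<lambda>k. if k < i - 1 then k + 1 else k + 2); t = (\<lambda>k. if k < j - 1 then k + 1 else k + 2);
         sg = (\<lambda>b p. if b then p else ZNeg p)
     in sg (even (i + j))
          (zsum (\<lambda>p. sg (evenperm p) (zprod (\<lambda>k. ZVar (s k, t (p k))) {0..<n})) {p. p permutes {0..<n}}))"

lemma zvars_adj_poly:
  assumes "i \<in> {1..n+1}" "j \<in> {1..n+1}"
  shows "zvars (adj_poly n j i) \<subseteq> {1..n+1} \<times> {1..n+1}"
proof -
  have *: "zvars (if b then p else ZNeg p) = zvars p" for b and p :: "(nat \<times> nat) zpoly"
    by simp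
  have pk: "k < n \<Longrightarrow> p permutes {0..<n} \<Longrightarrow> p k + 1 \<le> n" for p k
    using permutes_in_image[of p "{0..<n}" k] by (simp add: Suc_le_eq flip: Suc_eq_plus1)
  show ?thesis
    unfolding adj_poly_def Let_def * zvars_zsum[OF finite_permutations[OF finite_atLeastLessThan]]
      zvars_zprod[OF finite_atLeastLessThan]
  proof (intro UN_least)
    fix p k assume "p \<in> {p. p permutes {0..<n}}" "k \<in> {0..<n}"
    then show "zvars (ZVar (if k < i - 1 then k + 1 else k + 2, if p k < j - 1 then p k + 1 else p k + 2))
        \<subseteq> {1..n+1} \<times> {1..n+1}"
      using assms pk[of k p] by auto
  qed
qed

lemma zeval_adj_poly:
  fixes A :: "nat \<Rightarrow> nat \<Rightarrow> 'a::comm_ring_1"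
  assumes "i \<in> {1..n+1}" "j \<in> {1..n+1}"
  shows "zeval class_ring (\<lambda>(i, j). A i j) (adj_poly n j i) = adj_mat (to_mat (n + 1) A) $$ (j - 1, i - 1)"
proof -
  let ?M = "to_mat (n + 1) A"
  have d: "mat_delete ?M (i - 1) (j - 1) \<in> carrier_mat n n"
    by (simp add: mat_delete_def to_mat_def)
  have e: "mat_delete ?M (i - 1) (j - 1) $$ (k, l) =
      A (if k < i - 1 then k + 1 else k + 2) (if l < j - 1 then l + 1 else l + 2)" if "k < n" "l < n" for k l
    using that by (simp add: mat_delete_def to_mat_def One_nat_def)
  have "adj_mat ?M $$ (j - 1, i - 1) = cofactor ?M (i - 1) (j - 1)"
  proof -
    have "i - 1 < n + 1" "j - 1 < n + 1" using assms by auto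
    then show ?thesis by (simp add: adj_mat_def to_mat_def)
  qed
  also have "\<dots> = (-1) ^ (i + j) * det (mat_delete ?M (i - 1) (j - 1))"
  proof -
    obtain i' j' where "i = Suc i'" "j = Suc j'" using assms by (metis Suc_le_D atLeastAtMost_iff One_nat_def)
    then show ?thesis by (simp add: cofactor_def)
  qed
  also have "det (mat_delete ?M (i - 1) (j - 1)) =
      (\<Sum>p\<in>{p. p permutes {0..<n}}. signof p * (\<Prod>k=0..<n.
        A (if k < i - 1 then k + 1 else k + 2) (if p k < j - 1 then p k + 1 else p k + 2)))"
    unfolding det_def'[OF d]
  proof (intro sum.cong refl arg_cong2[where f = "(*)"] prod.cong)
    fix p k assume "p \<in> {p. p permutes {0..<n}}" "k \<in> {0..<n}"
    moreover from this have "p k < n" using permutes_in_image[of p "{0..<n}" k] by simp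
    ultimately show "mat_delete ?M (i - 1) (j - 1) $$ (k, p k) =
        A (if k < i - 1 then k + 1 else k + 2) (if p k < j - 1 then p k + 1 else p k + 2)"
      by (intro e) auto
  qed
  also have "(- 1) ^ (i + j) * \<dots> = zeval class_ring (\<lambda>(i, j). A i j) (adj_poly n j i)"
  proof -
    have *: "zeval class_ring x (if b then p else ZNeg p) = (if b then 1 else - 1) * zeval class_ring x p"
      for b x and p :: "(nat \<times> nat) zpoly"
      by (simp add: class_ring_def[symmetric])
    show ?thesis
      unfolding adj_poly_def Let_def * minus_one_power_iff
        zeval_class_zsum[OF finite_permutations[OF finite_atLeastLessThan]]
        zeval_class_zprod[OF finite_atLeastLessThan]
      by (simp add: sign_def if_distrib[of of_int] cong: if_cong)
  qed
  finally show ?thesis ..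
qed

lemma Mat_class_mult:
  "i \<in> {1..n+1} \<Longrightarrow> j \<in> {1..n+1} \<Longrightarrow> (A \<otimes>\<^bsub>Mat class_ring {1..n+1}\<^esub> B) i j = mmul n A B i j"
  by (simp add: Mat_mult_entry mmul_def)

definition inverse_pair :: "nat \<Rightarrow> (nat \<Rightarrow> nat \<Rightarrow> 'a::comm_ring_1) \<Rightarrow> (nat \<Rightarrow> nat \<Rightarrow> 'a) \<Rightarrow> bool" where
  "inverse_pair n A B \<longleftrightarrow> (\<forall>i\<in>{1..n+1}. \<forall>j\<in>{1..n+1}.
     mmul n A B i j = (if i = j then 1 else 0) \<and> mmul n B A i j = (if i = j then 1 else 0))"

text \<open>For determinant 1 the adjugate is the inverse, so the entries of the inverse are integer
  polynomials in those of \<open>A\<close>.\<close>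

lemma SL_inverse:
  fixes A :: "nat \<Rightarrow> nat \<Rightarrow> 'a::comm_ring_1"
  assumes A: "A \<in> SL class_ring (n + 1)"
  defines "B \<equiv> inv\<^bsub>Mat class_ring {1..n+1}\<^esub> A"
  shows "A \<in> Units (Mat class_ring {1..n+1})" "inverse_pair n A B"
    and "i \<in> {1..n+1} \<Longrightarrow> j \<in> {1..n+1} \<Longrightarrow> B j i = zeval class_ring (\<lambda>(i, j). A i j) (adj_poly n j i)"
proof -
  let ?M = "to_mat (n + 1) A" and ?J = "{1..n+1}"
  interpret M: Group.monoid "Mat (class_ring :: 'a ring) ?J"
    by (rule class_ring.monoid_Mat) simp
  define C where "C = (\<lambda>i\<in>?J. \<lambda>j\<in>?J. adj_mat ?M $$ (i - 1, j - 1))"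
  have AM: "A \<in> carrier (Mat class_ring ?J)" and det: "det ?M = 1"
    using A by (auto simp: SL_def det_to_mat)
  have CM: "C \<in> carrier (Mat class_ring ?J)"
    unfolding C_def by (rule Mat_carrierI) simp
  have M: "?M \<in> carrier_mat (n + 1) (n + 1)" by (simp add: to_mat_def)
  note adj = adj_mat[OF M, unfolded det]
  have sum: "(\<Sum>k\<in>?J. f k) = (\<Sum>k=0..<n+1. f (k + 1))" for f :: "nat \<Rightarrow> 'a"
    by (rule sum.reindex_bij_witness[of _ "\<lambda>i. i + 1" "\<lambda>i. i - 1"]) auto
  have AC: "mmul n A C i j = (if i = j then 1 else 0)" if "i \<in> ?J" "j \<in> ?J" for i j
  proof -
    have "mmul n A C i j = (?M * adj_mat ?M) $$ (i - 1, j - 1)"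
      unfolding mmul_def sum using that adj(1) M
      by (auto simp: scalar_prod_def C_def to_mat_def less_diff_conv2 intro!: sum.cong)
    then show ?thesis using that adj(2) by auto
  qed
  have CA: "mmul n C A i j = (if i = j then 1 else 0)" if "i \<in> ?J" "j \<in> ?J" for i j
  proof -
    have "mmul n C A i j = (adj_mat ?M * ?M) $$ (i - 1, j - 1)"
      unfolding mmul_def sum using that adj(1) M
      by (auto simp: scalar_prod_def C_def to_mat_def less_diff_conv2 intro!: sum.cong)
    then show ?thesis using that adj(3) by auto
  qed
  have "A \<otimes>\<^bsub>Mat class_ring ?J\<^esub> C = \<one>\<^bsub>Mat class_ring ?J\<^esub>" "C \<otimes>\<^bsub>Mat class_ring ?J\<^esub> A = \<one>\<^bsub>Mat class_ring ?J\<^esub>"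
    by (rule Mat_eqI[of _ class_ring ?J],
        use AM CM in \<open>simp_all add: Mat_class_mult AC CA Mat_one_entry class_ring.Mat_mult_closed
          class_ring.Mat_one_closed del: class_ring_simps(1)\<close>)+
  then have "C = B" unfolding B_def by (intro M.inv_unique' AM CM)
  with AC CA AM CM \<open>A \<otimes>\<^bsub>Mat class_ring ?J\<^esub> C = \<one>\<^bsub>Mat class_ring ?J\<^esub>\<close> \<open>C \<otimes>\<^bsub>Mat class_ring ?J\<^esub> A = \<one>\<^bsub>Mat class_ring ?J\<^esub>\<close>
  show "A \<in> Units (Mat class_ring ?J)" "inverse_pair n A B"
    by (auto simp: Units_def inverse_pair_def)
  show "B j i = zeval class_ring (\<lambda>(i, j). A i j) (adj_poly n j i)" if "i \<in> ?J" "j \<in> ?J"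
    using that \<open>C = B\<close> by (simp add: zeval_adj_poly C_def flip: \<open>C = B\<close>)
qed

lemma rep_class:
  "r \<in> rep_index n \<pi> \<Longrightarrow> c \<in> rep_index n \<pi> \<Longrightarrow>
    rep R n \<pi> A r c = rep_entry R \<pi> A (inv\<^bsub>Mat R {1..n+1}\<^esub> A) r c"
  by (simp add: rep_def)

lemma rep_entry_inverse:
  fixes A B :: "nat \<Rightarrow> nat \<Rightarrow> 'a::comm_ring_1"
  assumes "inverse_pair n A B" "r \<in> rep_index n \<pi>" "c \<in> rep_index n \<pi>"
  shows "(\<Sum>s\<in>rep_index n \<pi>. rep_entry class_ring \<pi> A B r s * rep_entry class_ring \<pi> B A s c) =
    (if r = c then 1 else 0)"
proof -
  have "(\<Sum>s\<in>rep_index n \<pi>. rep_entry class_ring \<pi> A B r s * rep_entry class_ring \<pi> B A s c) =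
      rep_entry class_ring \<pi> (mmul n A B) (mmul n A B) r c"
    by (rule class_rep_entry_mult[OF assms(2,3)])
  also have "\<dots> = rep_entry class_ring \<pi> (\<lambda>i j. if i = j then 1 else 0) (\<lambda>i j. if i = j then 1 else 0) r c"
    using assms(1) by (intro rep_entry_cong[OF assms(2,3)]) (auto simp: inverse_pair_def)
  also have "\<dots> = (if r = c then 1 else 0)"
    using assms(2,3) by (cases \<pi>) (auto split: if_splits)
  finally show ?thesis .
qed



section \<open>Products, traces and conjugation of matrices over a commutative ring type\<close>

lemma mmul_assoc: "mmul n A (mmul n B C) = mmul n (mmul n A B) C"
proof (intro ext)
  fix i k
  show "mmul n A (mmul n B C) i k = mmul n (mmul n A B) C i k"
    unfolding mmul_def sum_distrib_left sum_distrib_right mult.assoc by (rule sum.swap)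
qed

lemma mmul_cong:
  assumes "\<And>j. j \<in> {1..n+1} \<Longrightarrow> A i j = A' i j" "\<And>j. j \<in> {1..n+1} \<Longrightarrow> B j k = B' j k"
  shows "mmul n A B i k = mmul n A' B' i k"
  unfolding mmul_def using assms by (intro sum.cong) auto

lemma mmul_inverse_cancel:
  assumes "inverse_pair n A B" "i \<in> {1..n+1}"
  shows "mmul n B (mmul n A M) i k = M i k"
proof -
  have "mmul n D M i k = M i k" if "\<And>j. j \<in> {1..n+1} \<Longrightarrow> D i j = (if i = j then 1 else 0)" for D
    unfolding mmul_def using assms(2) that by (simp add: if_distrib[of "\<lambda>x. x * _"] sum.delta' cong: if_cong)
  then show ?thesis
    using assms unfolding mmul_assoc inverse_pair_def by auto
qed

definition tr :: "nat \<Rightarrow> (nat \<Rightarrow> nat \<Rightarrow> 'a::comm_ring_1) \<Rightarrow> 'a" where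
  "tr n A = (\<Sum>i\<in>{1..n+1}. A i i)"

lemma tr_cong: "(\<And>i. i \<in> {1..n+1} \<Longrightarrow> A i i = B i i) \<Longrightarrow> tr n A = tr n B"
  unfolding tr_def by (rule sum.cong) auto

lemma tr_commute: "tr n (mmul n A B) = tr n (mmul n B A)"
  unfolding tr_def mmul_def by (subst sum.swap) (simp add: mult.commute)

lemma tr_conj:
  assumes "inverse_pair n A B"
  shows "tr n (mmul n A (mmul n M B)) = tr n M"
proof -
  have "tr n (mmul n A (mmul n M B)) = tr n (mmul n M (mmul n B A))"
    by (subst tr_commute) (simp only: mmul_assoc)
  also have "\<dots> = tr n (mmul n (mmul n B A) M)" by (rule tr_commute)
  also have "\<dots> = tr n M"
    by (rule tr_cong) (simp add: mmul_inverse_cancel[OF assms] flip: mmul_assoc)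
  finally show ?thesis .
qed

lemma sum_insert_middle:
  fixes F :: "'i \<Rightarrow> 'a::comm_ring_1"
  shows "(\<Sum>s\<in>I. (\<Sum>b\<in>I. F b * Q b s) * (\<Sum>d\<in>I. P s d * G d)) =
    (\<Sum>b\<in>I. \<Sum>d\<in>I. F b * (\<Sum>s\<in>I. Q b s * P s d) * G d)"
  unfolding sum_product
  by (subst sum.swap, rule sum.cong[OF refl], subst sum.swap, rule sum.cong[OF refl])
     (simp add: sum_distrib_left sum_distrib_right mult.assoc)

lemma sum_rotate:
  "(\<Sum>j\<in>J. \<Sum>a\<in>J. \<Sum>b\<in>J. \<Sum>c\<in>J. \<Sum>d\<in>J. f j a b c d) =
    (\<Sum>a\<in>J. \<Sum>b\<in>J. \<Sum>c\<in>J. \<Sum>d\<in>J. \<Sum>j\<in>J. f j a b c d)"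
proof -
  have "(\<Sum>j\<in>J. \<Sum>a\<in>J. \<Sum>b\<in>J. \<Sum>c\<in>J. \<Sum>d\<in>J. f j a b c d) =
      (\<Sum>a\<in>J. \<Sum>j\<in>J. \<Sum>b\<in>J. \<Sum>c\<in>J. \<Sum>d\<in>J. f j a b c d)"
    by (rule sum.swap)
  also have "\<dots> = (\<Sum>a\<in>J. \<Sum>b\<in>J. \<Sum>j\<in>J. \<Sum>c\<in>J. \<Sum>d\<in>J. f j a b c d)"
    by (rule sum.cong[OF refl], rule sum.swap)
  also have "\<dots> = (\<Sum>a\<in>J. \<Sum>b\<in>J. \<Sum>c\<in>J. \<Sum>j\<in>J. \<Sum>d\<in>J. f j a b c d)"
    by (rule sum.cong[OF refl], rule sum.cong[OF refl], rule sum.swap)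
  also have "\<dots> = (\<Sum>a\<in>J. \<Sum>b\<in>J. \<Sum>c\<in>J. \<Sum>d\<in>J. \<Sum>j\<in>J. f j a b c d)"
    by (rule sum.cong[OF refl], rule sum.cong[OF refl], rule sum.cong[OF refl], rule sum.swap)
  finally show ?thesis .
qed

section \<open>A class function on each representation\<close>

text \<open>A matrix on the exterior square with entries \<open>U [i, j] [k, l]\<close>, \<open>i < j\<close>, \<open>k < l\<close>, extended
  antisymmetrically to all \<open>i, j, k, l\<close>.\<close>

definition wedge_poly :: "(nat list \<Rightarrow> nat list \<Rightarrow> 'v zpoly) \<Rightarrow> nat \<Rightarrow> nat \<Rightarrow> nat \<Rightarrow> nat \<Rightarrow> 'v zpoly" where
  "wedge_poly U i j k l =
    (if i < j then if k < l then U [i, j] [k, l] else if l < k then ZNeg (U [i, j] [l, k]) else ZZero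
     else if j < i then if k < l then ZNeg (U [j, i] [k, l]) else if l < k then U [j, i] [l, k] else ZZero
     else ZZero)"

definition wedge :: "(nat list \<Rightarrow> nat list \<Rightarrow> 'a::comm_ring_1) \<Rightarrow> nat \<Rightarrow> nat \<Rightarrow> nat \<Rightarrow> nat \<Rightarrow> 'a" where
  "wedge U i j k l =
    (if i < j then if k < l then U [i, j] [k, l] else if l < k then - U [i, j] [l, k] else 0
     else if j < i then if k < l then - U [j, i] [k, l] else if l < k then U [j, i] [l, k] else 0
     else 0)"

text \<open>The partial trace \<open>Y(U)\<close> is equivariant: conjugating \<open>U\<close> by the image of \<open>A\<close> conjugates \<open>Y(U)\<close>
  by \<open>A\<close>. On the image of \<open>A\<close> itself it is \<open>A\<close>, \<open>tr(A) A - A\<^sup>2\<close> and \<open>tr(A) A\<^sup>-\<^sup>1\<close>, respectively.\<close>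

fun ptrace_poly :: "nat \<Rightarrow> isogeny \<Rightarrow> (nat list \<Rightarrow> nat list \<Rightarrow> 'v zpoly) \<Rightarrow> nat \<Rightarrow> nat \<Rightarrow> 'v zpoly" where
  "ptrace_poly n SC U i k = U [i] [k]"
| "ptrace_poly n MID U i k = zsum (\<lambda>j. wedge_poly U i j k j) {1..n+1}"
| "ptrace_poly n AD U i k = zsum (\<lambda>j. U [j, k] [j, i]) {1..n+1}"

fun ptrace :: "nat \<Rightarrow> isogeny \<Rightarrow> (nat list \<Rightarrow> nat list \<Rightarrow> 'a::comm_ring_1) \<Rightarrow> nat \<Rightarrow> nat \<Rightarrow> 'a" where
  "ptrace n SC U i k = U [i] [k]"
| "ptrace n MID U i k = (\<Sum>j\<in>{1..n+1}. wedge U i j k j)"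
| "ptrace n AD U i k = (\<Sum>j\<in>{1..n+1}. U [j, k] [j, i])"

lemma zeval_ptrace_poly:
  "zeval class_ring x (ptrace_poly n \<pi> U i k) = ptrace n \<pi> (\<lambda>r c. zeval class_ring x (U r c)) i k"
  by (cases \<pi>) (auto simp: wedge_poly_def wedge_def class_ring.zeval_ZZero intro!: sum.cong)

lemma ptrace_cong:
  assumes "\<And>r c. r \<in> rep_index n \<pi> \<Longrightarrow> c \<in> rep_index n \<pi> \<Longrightarrow> U r c = U' r c"
    and "i \<in> {1..n+1}" "k \<in> {1..n+1}"
  shows "ptrace n \<pi> U i k = ptrace n \<pi> U' i k"
  using assms by (cases \<pi>) (auto simp: wedge_def intro!: sum.cong)

lemma sum_wedge:
  assumes "finite I"
  shows "(\<Sum>a\<in>I. \<Sum>b\<in>I. if a < b then (u a * v b - u b * v a) * wedge U a b k l else 0) =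
      (\<Sum>a\<in>I. \<Sum>b\<in>I. u a * v b * wedge U a b k l)"
    "(\<Sum>c\<in>I. \<Sum>d\<in>I. if c < d then (u c * v d - u d * v c) * wedge U i j c d else 0) =
      (\<Sum>c\<in>I. \<Sum>d\<in>I. u c * v d * wedge U i j c d)"
  by (rule sum_antisym[OF assms]; simp add: wedge_def)+

text \<open>After antisymmetric extension, conjugation on the exterior square becomes conjugation by
  the tensor square, with unrestricted sums. The ordered sums are unfolded twice by antisymmetry,
  once for columns and once for rows.\<close>

lemma wedge_conj:
  fixes A B :: "nat \<Rightarrow> nat \<Rightarrow> 'a::comm_ring_1"
  assumes "i \<in> {1..n+1}" "j \<in> {1..n+1}" "k \<in> {1..n+1}" "l \<in> {1..n+1}"
  shows "wedge (\<lambda>r c. \<Sum>s\<in>rep_index n MID. \<Sum>t\<in>rep_index n MID.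
      rep_entry class_ring MID A B r s * U s t * rep_entry class_ring MID B A t c) i j k l =
    (\<Sum>a\<in>{1..n+1}. \<Sum>b\<in>{1..n+1}. A i a * A j b *
       (\<Sum>c\<in>{1..n+1}. \<Sum>d\<in>{1..n+1}. B c k * B d l * wedge U a b c d))"
proof -
  let ?J = "{1..n+1}"
  define W where "W i j k l = (\<Sum>a\<in>?J. \<Sum>b\<in>?J. A i a * A j b *
       (\<Sum>c\<in>?J. \<Sum>d\<in>?J. B c k * B d l * wedge U a b c d))" for i j k l
  have inner: "(\<Sum>c\<in>?J. \<Sum>d\<in>?J. if c < d then U [a, b] [c, d] * (B c k * B d l - B c l * B d k) else 0) =
      (\<Sum>c\<in>?J. \<Sum>d\<in>?J. B c k * B d l * wedge U a b c d)" if "a < b" for a b k l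
    unfolding sum_wedge(2)[of ?J "\<lambda>c. B c k" "\<lambda>d. B d l", OF finite_atLeastAtMost, symmetric]
    using that by (intro sum.cong refl) (auto simp: wedge_def algebra_simps)
  \<comment> \<open>The inner sum is antisymmetric in \<open>a\<close> and \<open>b\<close>; writing
    it as a \<open>wedge\<close> with the dummy column pair \<open>0 < 1\<close> makes
    \<open>sum_wedge(1)\<close> applicable.\<close>
  have wsum: "(\<Sum>c\<in>?J. \<Sum>d\<in>?J. B c k * B d l * wedge U a b c d) =
      wedge (\<lambda>r _. \<Sum>c\<in>?J. \<Sum>d\<in>?J. B c k * B d l * wedge U (r ! 0) (r ! 1) c d) a b 0 1" for a b k l
    by (auto simp: wedge_def sum_negf[symmetric] intro!: sum.cong sum.neutral)
  have base: "(\<Sum>s\<in>rep_index n MID. \<Sum>t\<in>rep_index n MID.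
      rep_entry class_ring MID A B [i, j] s * U s t * rep_entry class_ring MID B A t [k, l]) = W i j k l" for i j k l
  proof -
    have "(\<Sum>s\<in>rep_index n MID. \<Sum>t\<in>rep_index n MID.
      rep_entry class_ring MID A B [i, j] s * U s t * rep_entry class_ring MID B A t [k, l]) =
      (\<Sum>a\<in>?J. \<Sum>b\<in>?J. if a < b then (A i a * A j b - A i b * A j a) *
         (\<Sum>c\<in>?J. \<Sum>d\<in>?J. if c < d then U [a, b] [c, d] * (B c k * B d l - B c l * B d k) else 0) else 0)"
      unfolding sum_rep_index
      by (intro sum.cong refl if_cong)
         (auto simp: sum_distrib_left if_distrib[of "\<lambda>x. _ * x"] mult.assoc cong: if_cong intro!: sum.cong)
    also have "\<dots> = (\<Sum>a\<in>?J. \<Sum>b\<in>?J. if a < b then (A i a * A j b - A i b * A j a) *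
         (\<Sum>c\<in>?J. \<Sum>d\<in>?J. B c k * B d l * wedge U a b c d) else 0)"
      by (intro sum.cong refl if_cong) (simp add: inner)
    also have "\<dots> = W i j k l"
      unfolding W_def by (subst (1 2) wsum) (rule sum_wedge(1), simp)
    finally show ?thesis .
  qed
  define Z where "Z r c = (\<Sum>s\<in>rep_index n MID. \<Sum>t\<in>rep_index n MID.
      rep_entry class_ring MID A B r s * U s t * rep_entry class_ring MID B A t c)" for r c
  have r: "rep_entry class_ring MID A B [j, i] s = - rep_entry class_ring MID A B [i, j] s"
    "rep_entry class_ring MID A B [i, i] s = 0"
    "rep_entry class_ring MID B A s [j, i] = - rep_entry class_ring MID B A s [i, j]"
    "rep_entry class_ring MID B A s [i, i] = 0"
    if "s \<in> rep_index n MID" for i j s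
    using that by auto
  have Z: "Z [j, i] c = - Z [i, j] c" "Z r [j, i] = - Z r [i, j]" "Z [i, i] c = 0" "Z r [i, i] = 0" for i j r c
    unfolding Z_def sum_negf[symmetric]
    by (auto intro!: sum.cong sum.neutral simp: r(2,4) r(1)[of _ j i] r(3)[of _ j i] simp del: rep_index.simps rep_entry.simps)
  \<comment> \<open>\<open>Z\<close> is given by a formula that is antisymmetric already, so
    extending its values at ordered pairs changes nothing.\<close>
  have "wedge Z i j k l = Z [i, j] [k, l]"
    by (auto simp: wedge_def Z(3,4) not_less_iff_gr_or_eq Z(1)[of j i] Z(2)[of _ l k])
  then show ?thesis
    using base[of i j k l] unfolding Z_def W_def by simp
qed

text \<open>The summation over the contracted index \<open>j\<close> joins a factor of
  \<open>A\<close> with one of \<open>B\<close> into an entry of \<open>mmul n B A\<close>, a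
  Kronecker delta. The remaining factors conjugate the partial trace. In the case \<open>AD\<close>
  the indices \<open>i\<close> and \<open>k\<close> occur exchanged, which turns the dual action
  into conjugation by \<open>A\<close> itself.\<close>

lemma ptrace_conj:
  fixes A B :: "nat \<Rightarrow> nat \<Rightarrow> 'a::comm_ring_1"
  assumes AB: "inverse_pair n A B" and ik: "i \<in> {1..n+1}" "k \<in> {1..n+1}"
  shows "ptrace n \<pi> (\<lambda>r c. \<Sum>s\<in>rep_index n \<pi>. \<Sum>t\<in>rep_index n \<pi>.
      rep_entry class_ring \<pi> A B r s * U s t * rep_entry class_ring \<pi> B A t c) i k =
    mmul n A (mmul n (ptrace n \<pi> U) B) i k"
proof (cases \<pi>)
  case SC
  then show ?thesis unfolding SC
    by (simp add: sum_rep_index mmul_def sum_distrib_left mult.assoc del: rep_index.simps)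
next
  case AD
  let ?J = "{1..n+1}"
  have "ptrace n AD (\<lambda>r c. \<Sum>s\<in>rep_index n AD. \<Sum>t\<in>rep_index n AD.
      rep_entry class_ring AD A B r s * U s t * rep_entry class_ring AD B A t c) i k =
     (\<Sum>j\<in>?J. \<Sum>a\<in>?J. \<Sum>b\<in>?J. \<Sum>c\<in>?J. \<Sum>d\<in>?J. A j a * B b k * U [a, b] [c, d] * (B c j * A i d))"
    by (simp add: sum_rep_index del: rep_index.simps)
  also have "\<dots> = (\<Sum>a\<in>?J. \<Sum>b\<in>?J. \<Sum>c\<in>?J. \<Sum>d\<in>?J. \<Sum>j\<in>?J. A j a * B b k * U [a, b] [c, d] * (B c j * A i d))"
    by (rule sum_rotate)
  also have "\<dots> = (\<Sum>a\<in>?J. \<Sum>b\<in>?J. \<Sum>c\<in>?J. \<Sum>d\<in>?J. mmul n B A c a * (B b k * U [a, b] [c, d] * A i d))"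
    unfolding mmul_def sum_distrib_right by (intro sum.cong refl) (simp add: mult_ac)
  also have "\<dots> = (\<Sum>a\<in>?J. \<Sum>b\<in>?J. \<Sum>c\<in>?J. if c = a then \<Sum>d\<in>?J. B b k * U [a, b] [c, d] * A i d else 0)"
    using AB by (intro sum.cong refl) (auto simp: inverse_pair_def intro!: sum.neutral)
  also have "\<dots> = (\<Sum>a\<in>?J. \<Sum>b\<in>?J. \<Sum>d\<in>?J. B b k * U [a, b] [a, d] * A i d)"
    by (rule sum.cong[OF refl], rule sum.cong[OF refl]) simp
  also have "\<dots> = (\<Sum>d\<in>?J. \<Sum>b\<in>?J. \<Sum>a\<in>?J. B b k * U [a, b] [a, d] * A i d)"
  proof -
    have "(\<Sum>a\<in>?J. \<Sum>b\<in>?J. \<Sum>d\<in>?J. f a b d) = (\<Sum>d\<in>?J. \<Sum>b\<in>?J. \<Sum>a\<in>?J. f a b d)"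
      for f :: "nat \<Rightarrow> nat \<Rightarrow> nat \<Rightarrow> 'a"
    proof -
      have "(\<Sum>a\<in>?J. \<Sum>b\<in>?J. \<Sum>d\<in>?J. f a b d) = (\<Sum>a\<in>?J. \<Sum>d\<in>?J. \<Sum>b\<in>?J. f a b d)"
        by (rule sum.cong[OF refl], rule sum.swap)
      also have "\<dots> = (\<Sum>d\<in>?J. \<Sum>a\<in>?J. \<Sum>b\<in>?J. f a b d)" by (rule sum.swap)
      also have "\<dots> = (\<Sum>d\<in>?J. \<Sum>b\<in>?J. \<Sum>a\<in>?J. f a b d)"
        by (rule sum.cong[OF refl], rule sum.swap)
      finally show ?thesis .
    qed
    then show ?thesis .
  qed
  also have "\<dots> = mmul n A (mmul n (ptrace n AD U) B) i k"
    by (simp add: mmul_def sum_distrib_left sum_distrib_right mult_ac)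
  finally show ?thesis unfolding AD .
next
  case MID
  let ?J = "{1..n+1}"
  have "ptrace n MID (\<lambda>r c. \<Sum>s\<in>rep_index n MID. \<Sum>t\<in>rep_index n MID.
      rep_entry class_ring MID A B r s * U s t * rep_entry class_ring MID B A t c) i k =
     (\<Sum>j\<in>?J. \<Sum>a\<in>?J. \<Sum>b\<in>?J. \<Sum>c\<in>?J. \<Sum>d\<in>?J. A i a * A j b * (B c k * B d j * wedge U a b c d))"
    using ik by (simp add: wedge_conj sum_distrib_left del: rep_index.simps rep_entry.simps)
  also have "\<dots> = (\<Sum>a\<in>?J. \<Sum>b\<in>?J. \<Sum>c\<in>?J. \<Sum>d\<in>?J. \<Sum>j\<in>?J. A i a * A j b * (B c k * B d j * wedge U a b c d))"
    by (rule sum_rotate)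
  also have "\<dots> = (\<Sum>a\<in>?J. \<Sum>b\<in>?J. \<Sum>c\<in>?J. \<Sum>d\<in>?J. mmul n B A d b * (A i a * B c k * wedge U a b c d))"
    unfolding mmul_def sum_distrib_right by (intro sum.cong refl) (simp add: mult_ac)
  also have "\<dots> = (\<Sum>a\<in>?J. \<Sum>b\<in>?J. \<Sum>c\<in>?J. \<Sum>d\<in>?J. if d = b then A i a * B c k * wedge U a b c d else 0)"
    using AB by (intro sum.cong refl) (auto simp: inverse_pair_def)
  also have "\<dots> = (\<Sum>a\<in>?J. \<Sum>b\<in>?J. \<Sum>c\<in>?J. A i a * B c k * wedge U a b c b)"
    by (rule sum.cong[OF refl], rule sum.cong[OF refl], rule sum.cong[OF refl]) simp
  also have "\<dots> = (\<Sum>a\<in>?J. \<Sum>c\<in>?J. \<Sum>b\<in>?J. A i a * B c k * wedge U a b c b)"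
    by (rule sum.cong[OF refl], rule sum.swap)
  also have "\<dots> = mmul n A (mmul n (ptrace n MID U) B) i k"
    by (simp add: mmul_def sum_distrib_left sum_distrib_right mult_ac)
  finally show ?thesis unfolding MID .
qed

lemma ptrace_rep:
  fixes A B :: "nat \<Rightarrow> nat \<Rightarrow> 'a::comm_ring_1"
  shows "ptrace n MID (rep_entry class_ring MID A B) i k = tr n A * A i k - mmul n A A i k"
    "ptrace n AD (rep_entry class_ring AD A B) i k = tr n A * B i k"
proof -
  have w: "wedge (rep_entry class_ring MID A B) i j k l = A i k * A j l - A i l * A j k" for i j k l
    by (auto simp: wedge_def)
  show "ptrace n MID (rep_entry class_ring MID A B) i k = tr n A * A i k - mmul n A A i k"
    by (simp add: w sum_subtractf tr_def mmul_def sum_distrib_left mult.commute)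
  show "ptrace n AD (rep_entry class_ring AD A B) i k = tr n A * B i k"
    by (simp add: tr_def sum_distrib_right)
qed

definition square_poly :: "nat \<Rightarrow> isogeny \<Rightarrow> nat list \<Rightarrow> nat list \<Rightarrow> (nat list \<times> nat list) zpoly" where
  "square_poly n \<pi> r c = zsum (\<lambda>s. ZMul (ZVar (r, s)) (ZVar (s, c))) (rep_index n \<pi>)"

text \<open>\<open>tr U\<close> for the standard module and \<open>tr (Y(U)\<^sup>2 Y(U\<^sup>2))\<close> for the others. Simpler class functions
  such as \<open>tr U\<close> or \<open>tr (Y(U)\<^sup>3)\<close> do not detect the exceptional automorphism in the latter case: the
  first is invariant under the outer automorphism, and the \<open>\<delta>\<close>-part of the second is divisible by \<open>3\<close>.\<close>

definition class_poly :: "nat \<Rightarrow> isogeny \<Rightarrow> (nat list \<times> nat list) zpoly" where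
  "class_poly n \<pi> =
    (let J = {1..n+1}; Y = ptrace_poly n \<pi> (\<lambda>r c. ZVar (r, c)); Y2 = ptrace_poly n \<pi> (square_poly n \<pi>)
     in if \<pi> = SC then zsum (\<lambda>i. Y i i) J
        else zsum (\<lambda>i. zsum (\<lambda>k. zsum (\<lambda>j. ZMul (ZMul (Y i j) (Y j k)) (Y2 k i)) J) J) J)"

lemma zeval_class_poly:
  "zeval class_ring (\<lambda>(r, c). U r c) (class_poly n \<pi>) =
    (if \<pi> = SC then tr n (ptrace n SC U)
     else tr n (mmul n (mmul n (ptrace n \<pi> U) (ptrace n \<pi> U))
       (ptrace n \<pi> (\<lambda>r c. \<Sum>s\<in>rep_index n \<pi>. U r s * U s c))))"
  by (simp add: class_poly_def Let_def zeval_ptrace_poly square_poly_def tr_def mmul_def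
      sum_distrib_right)

text \<open>Both squaring on the representation space and the partial trace commute with
  conjugation, and the final trace removes the conjugating matrix. The matrix \<open>U\<close> is
  arbitrary, as the generic argument in \<open>chevalley_conj\<close> requires.\<close>

lemma class_poly_conj:
  fixes A B :: "nat \<Rightarrow> nat \<Rightarrow> 'a::comm_ring_1"
  assumes AB: "inverse_pair n A B"
  shows "zeval class_ring (\<lambda>(r, c). \<Sum>s\<in>rep_index n \<pi>. \<Sum>t\<in>rep_index n \<pi>.
      rep_entry class_ring \<pi> A B r s * U s t * rep_entry class_ring \<pi> B A t c) (class_poly n \<pi>) =
    zeval class_ring (\<lambda>(r, c). U r c) (class_poly n \<pi>)"
proof -
  let ?I = "rep_index n \<pi>" and ?J = "{1..n+1}"
  let ?P = "rep_entry class_ring \<pi> A B" and ?Q = "rep_entry class_ring \<pi> B A"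
  define Z where "Z M r c = (\<Sum>s\<in>?I. \<Sum>t\<in>?I. ?P r s * M s t * ?Q t c)" for M r c
  have AB': "inverse_pair n B A" using AB by (auto simp: inverse_pair_def)
  have Y: "ptrace n \<pi> (Z M) i k = mmul n A (mmul n (ptrace n \<pi> M) B) i k" if "i \<in> ?J" "k \<in> ?J" for M i k
    unfolding Z_def[abs_def] by (rule ptrace_conj[OF AB that])
  have sq: "(\<Sum>s\<in>?I. Z U r s * Z U s c) = Z (\<lambda>r c. \<Sum>s\<in>?I. U r s * U s c) r c" for r c
  proof -
    have "(\<Sum>s\<in>?I. Z U r s * Z U s c) =
        (\<Sum>s\<in>?I. (\<Sum>b\<in>?I. (\<Sum>a\<in>?I. ?P r a * U a b) * ?Q b s) * (\<Sum>d\<in>?I. ?P s d * (\<Sum>e\<in>?I. U d e * ?Q e c)))"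
      unfolding Z_def by (subst sum.swap) (simp add: sum_distrib_left sum_distrib_right mult.assoc)
    also have "\<dots> = (\<Sum>b\<in>?I. \<Sum>d\<in>?I. (\<Sum>a\<in>?I. ?P r a * U a b) * (\<Sum>s\<in>?I. ?Q b s * ?P s d) * (\<Sum>e\<in>?I. U d e * ?Q e c))"
      by (rule sum_insert_middle)
    also have "\<dots> = (\<Sum>b\<in>?I. \<Sum>d\<in>?I. if b = d then (\<Sum>a\<in>?I. ?P r a * U a b) * (\<Sum>e\<in>?I. U d e * ?Q e c) else 0)"
      by (intro sum.cong refl) (simp add: rep_entry_inverse[OF AB'])
    also have "\<dots> = (\<Sum>b\<in>?I. (\<Sum>a\<in>?I. ?P r a * U a b) * (\<Sum>e\<in>?I. U b e * ?Q e c))"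
      by (intro sum.cong refl) simp
    also have "\<dots> = (\<Sum>a\<in>?I. \<Sum>e\<in>?I. \<Sum>b\<in>?I. ?P r a * U a b * (U b e * ?Q e c))"
      unfolding sum_product by (subst sum.swap, rule sum.cong[OF refl], rule sum.swap)
    also have "\<dots> = Z (\<lambda>r c. \<Sum>s\<in>?I. U r s * U s c) r c"
      by (simp add: Z_def sum_distrib_left sum_distrib_right mult.assoc)
    finally show ?thesis .
  qed
  let ?Y = "ptrace n \<pi> U" and ?Y2 = "ptrace n \<pi> (\<lambda>r c. \<Sum>s\<in>?I. U r s * U s c)"
  let ?C = "\<lambda>M. mmul n A (mmul n M B)"
  have CC: "mmul n (?C M) (?C N) i k = ?C (mmul n M N) i k" if "i \<in> ?J" "k \<in> ?J" for M N i k
  proof -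
    have "mmul n (?C M) (?C N) i k = mmul n (mmul n A M) (mmul n B (mmul n A (mmul n N B))) i k"
      by (simp only: mmul_assoc)
    also have "\<dots> = mmul n (mmul n A M) (mmul n N B) i k"
      by (rule mmul_cong[OF refl], rule mmul_inverse_cancel[OF AB])
    finally show ?thesis by (simp only: mmul_assoc)
  qed
  have "tr n (ptrace n \<pi> (Z U)) = tr n ?Y"
    using Y[of _ _ U] by (subst tr_conj[OF AB, symmetric]) (rule tr_cong)
  moreover have "tr n (mmul n (mmul n (ptrace n \<pi> (Z U)) (ptrace n \<pi> (Z U)))
       (ptrace n \<pi> (\<lambda>r c. \<Sum>s\<in>?I. Z U r s * Z U s c))) = tr n (mmul n (mmul n ?Y ?Y) ?Y2)"
  proof (rule trans[OF tr_cong tr_conj[OF AB]])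
    fix i assume i: "i \<in> ?J"
    have "mmul n (mmul n (ptrace n \<pi> (Z U)) (ptrace n \<pi> (Z U)))
        (ptrace n \<pi> (\<lambda>r c. \<Sum>s\<in>?I. Z U r s * Z U s c)) i i = mmul n (mmul n (?C ?Y) (?C ?Y)) (?C ?Y2) i i"
      unfolding sq using i Y by (intro mmul_cong) auto
    also have "\<dots> = mmul n (?C (mmul n ?Y ?Y)) (?C ?Y2) i i"
      by (intro mmul_cong CC i refl)
    also have "\<dots> = ?C (mmul n (mmul n ?Y ?Y) ?Y2) i i"
      by (rule CC[OF i i])
    finally show "mmul n (mmul n (ptrace n \<pi> (Z U)) (ptrace n \<pi> (Z U)))
        (ptrace n \<pi> (\<lambda>r c. \<Sum>s\<in>?I. Z U r s * Z U s c)) i i = ?C (mmul n (mmul n ?Y ?Y) ?Y2) i i" .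
  qed
  ultimately have "zeval class_ring (\<lambda>(r, c). Z U r c) (class_poly n \<pi>) =
      zeval class_ring (\<lambda>(r, c). U r c) (class_poly n \<pi>)"
    unfolding zeval_class_poly by (auto simp del: ptrace.simps)
  then show ?thesis unfolding Z_def .
qed

lemma zvars_ptrace_poly:
  assumes U: "\<And>r c. r \<in> rep_index n \<pi> \<Longrightarrow> c \<in> rep_index n \<pi> \<Longrightarrow> zvars (U r c) \<subseteq> rep_index n \<pi> \<times> rep_index n \<pi>"
    and ik: "i \<in> {1..n+1}" "k \<in> {1..n+1}"
  shows "zvars (ptrace_poly n \<pi> U i k) \<subseteq> rep_index n \<pi> \<times> rep_index n \<pi>"
proof (cases \<pi>)
  case SC
  then show ?thesis using U[of "[i]" "[k]"] ik by simp
next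
  case AD
  have "zvars (U [j, k] [j, i]) \<subseteq> rep_index n \<pi> \<times> rep_index n \<pi>" if "j \<in> {1..n+1}" for j
    by (rule U) (use AD that ik in auto)
  then show ?thesis unfolding AD by (simp add: zvars_zsum UN_subset_iff)
next
  case MID
  have "zvars (wedge_poly U i j k j) \<subseteq> rep_index n \<pi> \<times> rep_index n \<pi>" if "j \<in> {1..n+1}" for j
  proof -
    have "i < j \<Longrightarrow> [i, j] \<in> rep_index n \<pi>" "j < i \<Longrightarrow> [j, i] \<in> rep_index n \<pi>"
      "k < j \<Longrightarrow> [k, j] \<in> rep_index n \<pi>" "j < k \<Longrightarrow> [j, k] \<in> rep_index n \<pi>"
      using MID that ik by auto
    then show ?thesis
      using U unfolding wedge_poly_def by (simp del: rep_index.simps)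
  qed
  then show ?thesis unfolding MID by (simp add: zvars_zsum UN_subset_iff)
qed

lemma zvars_class_poly: "zvars (class_poly n \<pi>) \<subseteq> rep_index n \<pi> \<times> rep_index n \<pi>"
proof -
  have sq: "zvars (square_poly n \<pi> r c) \<subseteq> rep_index n \<pi> \<times> rep_index n \<pi>"
    if "r \<in> rep_index n \<pi>" "c \<in> rep_index n \<pi>" for r c
    using that by (auto simp: square_poly_def zvars_zsum simp del: rep_index.simps)
  have "zvars (ptrace_poly n \<pi> (\<lambda>r c. ZVar (r, c)) i k) \<subseteq> rep_index n \<pi> \<times> rep_index n \<pi>"
    "zvars (ptrace_poly n \<pi> (square_poly n \<pi>) i k) \<subseteq> rep_index n \<pi> \<times> rep_index n \<pi>"
    if "i \<in> {1..n+1}" "k \<in> {1..n+1}" for i k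
    by (rule zvars_ptrace_poly[OF _ that], simp)+ (rule zvars_ptrace_poly[OF sq that])
  then show ?thesis
    by (cases "\<pi> = SC")
       (simp_all add: class_poly_def Let_def zvars_zsum UN_subset_iff del: rep_index.simps ptrace_poly.simps)
qed



section \<open>Invariance under the Chevalley groups\<close>

text \<open>Laplace expansion along the first two rows: every term is a product of complementary
  minors of size 2, which are entries of the exterior square.\<close>

lemma det_4:
  fixes A :: "nat \<Rightarrow> nat \<Rightarrow> 'a::comm_ring_1"
  shows "mat_det class_ring {1..4} A =
    (A 1 1 * A 2 2 - A 1 2 * A 2 1) * (A 3 3 * A 4 4 - A 3 4 * A 4 3)
    - (A 1 1 * A 2 3 - A 1 3 * A 2 1) * (A 3 2 * A 4 4 - A 3 4 * A 4 2)
    + (A 1 1 * A 2 4 - A 1 4 * A 2 1) * (A 3 2 * A 4 3 - A 3 3 * A 4 2)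
    + (A 1 2 * A 2 3 - A 1 3 * A 2 2) * (A 3 1 * A 4 4 - A 3 4 * A 4 1)
    - (A 1 2 * A 2 4 - A 1 4 * A 2 2) * (A 3 1 * A 4 3 - A 3 3 * A 4 1)
    + (A 1 3 * A 2 4 - A 1 4 * A 2 3) * (A 3 1 * A 4 2 - A 3 2 * A 4 1)"
proof -
  have f: "finite {2::nat, 3, 4}" "1 \<notin> {2::nat, 3, 4}" "finite {3::nat, 4}" "2 \<notin> {3::nat, 4}"
    "finite {4::nat}" "3 \<notin> {4::nat}" by auto
  have J: "{1..4} = {1::nat, 2, 3, 4}" by auto
  show ?thesis
    unfolding J mat_det_class[OF finite.insertI[OF f(1)]]
    unfolding sum_over_permutations_insert[OF f(1,2)]
    unfolding sum_over_permutations_insert[OF f(3,4)]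
    unfolding sum_over_permutations_insert[OF f(5,6)]
    unfolding permutes_sing
    by (simp add: sign_swap_id permutation_swap_id sign_compose permutation_compose sign_id)
       (simp add: transpose_def algebra_simps)
qed

text \<open>Filtering the increasing list keeps the order, so the complement of an index of the
  exterior square for \<open>n = 3\<close> is again such an index.\<close>

definition complement :: "nat list \<Rightarrow> nat list" where
  "complement r = filter (\<lambda>i. i \<notin> set r) [1, 2, 3, 4]"

text \<open>For \<open>MID\<close> this is Jacobi's formula for the minors of an inverse matrix of determinant \<open>1\<close>.\<close>

fun inv_poly :: "nat \<Rightarrow> isogeny \<Rightarrow> nat list \<Rightarrow> nat list \<Rightarrow> (nat list \<times> nat list) zpoly" where
  "inv_poly n SC [i] [k] = zsubst (\<lambda>(a, b). ZVar ([a], [b])) (adj_poly n i k)"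
| "inv_poly n MID r c =
    (if even (sum_list r + sum_list c) then ZVar (complement c, complement r)
     else ZNeg (ZVar (complement c, complement r)))"
| "inv_poly n AD [i, j] [k, l] = ZVar ([l, k], [j, i])"
| "inv_poly n _ _ _ = ZZero"

lemma rep_index_3_MID: "rep_index 3 MID = {[1, 2], [1, 3], [1, 4], [2, 3], [2, 4], [3, 4]}"
proof -
  have J: "{1..3+1} = {1::nat, 2, 3, 4}" by auto
  have "rep_index 3 MID = (\<lambda>(i, j). [i, j]) ` {p \<in> {1..3+1} \<times> {1..3+1}. fst p < snd p}"
    by (auto simp: image_iff)
  also have "{p \<in> {1..3+1} \<times> {1..3+1}. fst p < snd p} = {(1::nat, 2::nat), (1, 3), (1, 4), (2, 3), (2, 4), (3, 4)}"
    unfolding J by auto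
  finally show ?thesis by simp
qed

lemma zvars_inv_poly:
  assumes "n = 3 \<or> \<pi> \<noteq> MID" "r \<in> rep_index n \<pi>" "c \<in> rep_index n \<pi>"
  shows "zvars (inv_poly n \<pi> r c) \<subseteq> rep_index n \<pi> \<times> rep_index n \<pi>"
proof (cases \<pi>)
  case SC
  then obtain i k where "r = [i]" "c = [k]" "i \<in> {1..n+1}" "k \<in> {1..n+1}" using assms by auto
  with SC zvars_adj_poly[of k n i] show ?thesis
    by (auto simp: zvars_zsubst)
next
  case MID
  have "complement s \<in> rep_index 3 MID" if "s \<in> rep_index 3 MID" for s
    using that unfolding rep_index_3_MID by (auto simp: complement_def)
  then show ?thesis using assms MID by (auto simp del: rep_index.simps)
next
  case AD
  then show ?thesis using assms by auto
qed

text \<open>Each entry is a Laplace expansion with column pairs \<open>complement r\<close> and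
  \<open>c\<close>. For \<open>r = c\<close> these are complementary and give the determinant;
  otherwise they share a column and the expansion vanishes.\<close>

lemma MID_inverse:
  fixes A B :: "nat \<Rightarrow> nat \<Rightarrow> 'a::comm_ring_1"
  assumes det: "mat_det class_ring {1..4} A = 1"
    and rc: "r \<in> rep_index 3 MID" "c \<in> rep_index 3 MID"
  shows "(\<Sum>s\<in>rep_index 3 MID. zeval class_ring (\<lambda>(r, c). rep_entry class_ring MID A B r c) (inv_poly 3 MID r s) *
      rep_entry class_ring MID A B s c) = (if r = c then 1 else 0)"
proof -
  have "(\<Sum>s\<in>rep_index 3 MID. zeval class_ring (\<lambda>(r, c). rep_entry class_ring MID A B r c) (inv_poly 3 MID r s) *
      rep_entry class_ring MID A B s c) = (if r = c then mat_det class_ring {1..4} A else 0)"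
    using rc unfolding rep_index_3_MID det_4
    by (elim insertE emptyE; hypsubst; simp add: complement_def; simp add: algebra_simps)
  with det show ?thesis by simp
qed

lemma zeval_inv_poly:
  fixes A :: "nat \<Rightarrow> nat \<Rightarrow> 'a::comm_ring_1"
  assumes "n = 3 \<or> \<pi> \<noteq> MID" "A \<in> SL class_ring (n + 1)" "r \<in> rep_index n \<pi>" "c \<in> rep_index n \<pi>"
  defines "B \<equiv> inv\<^bsub>Mat class_ring {1..n+1}\<^esub> A"
  shows "zeval class_ring (\<lambda>(r, c). rep_entry class_ring \<pi> A B r c) (inv_poly n \<pi> r c) =
    rep_entry class_ring \<pi> B A r c"
proof (cases \<pi>)
  case SC
  then obtain i k where ik: "r = [i]" "c = [k]" "i \<in> {1..n+1}" "k \<in> {1..n+1}" using assms by auto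
  have *: "(\<lambda>v. zeval class_ring (\<lambda>(r, c). rep_entry class_ring SC A B r c) (case v of (a, b) \<Rightarrow> ZVar ([a], [b]))) =
      (\<lambda>(i, j). A i j)" by auto
  show ?thesis
    using SL_inverse(3)[OF assms(2) ik(4,3)] ik SC unfolding B_def[symmetric]
    by (simp add: zeval_zsubst *)
next
  case MID
  then have n: "n = 3" using assms by simp
  let ?I = "rep_index n \<pi>" and ?P = "rep_entry class_ring \<pi> A B" and ?Q = "rep_entry class_ring \<pi> B A"
  let ?H = "\<lambda>r c. zeval class_ring (\<lambda>(r, c). rep_entry class_ring \<pi> A B r c) (inv_poly n \<pi> r c)"
  have "mat_det class_ring {1..4} A = 1" using assms(2) n by (simp add: SL_def)
  \<comment> \<open>\<open>?H\<close> is a left inverse of \<open>?P\<close> and \<open>?Q\<close>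
    is a right inverse, so the two agree.\<close>
  from MID_inverse[OF this, where B = B] have HP: "(\<Sum>s\<in>?I. ?H r s * ?P s t) = (if r = t then 1 else 0)"
    if "t \<in> ?I" for t
    using that assms(3) unfolding MID n by blast
  have PQ: "(\<Sum>t\<in>?I. ?P s t * ?Q t c) = (if s = c then 1 else 0)" if "s \<in> ?I" for s
    by (rule rep_entry_inverse[OF SL_inverse(2)[OF assms(2), folded B_def] that assms(4)])
  have "?H r c = (\<Sum>s\<in>?I. ?H r s * (if s = c then 1 else 0))"
    using assms(4) by (simp add: if_distrib[of "\<lambda>x. _ * x"] del: rep_index.simps cong: if_cong)
  also have "\<dots> = (\<Sum>s\<in>?I. ?H r s * (\<Sum>t\<in>?I. ?P s t * ?Q t c))"
    by (intro sum.cong refl) (simp add: PQ)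
  also have "\<dots> = (\<Sum>t\<in>?I. (\<Sum>s\<in>?I. ?H r s * ?P s t) * ?Q t c)"
    unfolding sum_distrib_left sum_distrib_right mult.assoc by (rule sum.swap)
  also have "\<dots> = (\<Sum>t\<in>?I. if r = t then ?Q t c else 0)"
    by (intro sum.cong refl) (simp add: HP)
  also have "\<dots> = ?Q r c" using assms(3) by (simp del: rep_index.simps)
  finally show ?thesis .
next
  case AD
  \<comment> \<open>The entries are products of an entry of \<open>A\<close> and one of its inverse,
    so exchanging the two matrices only permutes the indices.\<close>
  then show ?thesis using assms(3,4) by (auto simp: mult.commute)
qed

definition chevalley_inv ::
  "('a, 'r) ring_scheme \<Rightarrow> nat \<Rightarrow> isogeny \<Rightarrow> (nat list \<Rightarrow> nat list \<Rightarrow> 'a) \<Rightarrow> nat list \<Rightarrow> nat list \<Rightarrow> 'a" where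
  "chevalley_inv S n \<pi> h =
    (\<lambda>r\<in>rep_index n \<pi>. \<lambda>c\<in>rep_index n \<pi>. zeval S (\<lambda>(r, c). h r c) (inv_poly n \<pi> r c))"

context cring
begin

text \<open>That the candidate polynomials give a two-sided inverse is itself a family of integer
  polynomial relations on the complex group, so the definition of \<open>chevalley_group\<close>
  imposes it on every point.\<close>

lemma chevalley_inverse:
  assumes n: "n = 3 \<or> \<pi> \<noteq> MID" and h: "h \<in> chevalley_group R n \<pi>"
  shows "chevalley_inv R n \<pi> h \<in> carrier (Mat R (rep_index n \<pi>))"
    "h \<otimes>\<^bsub>Mat R (rep_index n \<pi>)\<^esub> chevalley_inv R n \<pi> h = \<one>\<^bsub>Mat R (rep_index n \<pi>)\<^esub>"
    "chevalley_inv R n \<pi> h \<otimes>\<^bsub>Mat R (rep_index n \<pi>)\<^esub> h = \<one>\<^bsub>Mat R (rep_index n \<pi>)\<^esub>"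
proof -
  let ?I = "rep_index n \<pi>" and ?x = "\<lambda>(r, c). h r c"
  have hM: "h \<in> carrier (Mat R ?I)" using h by (simp add: chevalley_group_def)
  have x: "?x v \<in> carrier R" if "v \<in> ?I \<times> ?I" for v
    using that Mat_carrierD[OF hM] by auto
  have ip: "zeval R ?x (inv_poly n \<pi> r c) \<in> carrier R" if "r \<in> ?I" "c \<in> ?I" for r c
    using zvars_inv_poly[OF n that] by (intro zeval_closed x) auto
  show M: "chevalley_inv R n \<pi> h \<in> carrier (Mat R ?I)"
    unfolding chevalley_inv_def by (rule Mat_carrierI) (rule ip)
  have rel: "zeval R ?x p = \<zero>" if "zvars p \<subseteq> ?I \<times> ?I"
    "\<And>A. A \<in> SL class_ring (n + 1) \<Longrightarrow>
      zeval class_ring (\<lambda>(r, c). rep (class_ring :: complex ring) n \<pi> A r c) p = 0" for p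
    using h that by (simp add: chevalley_group_def complex_ring_eq)
  have rep: "zeval class_ring (\<lambda>(r, c). rep (class_ring :: complex ring) n \<pi> A r c) p =
      zeval class_ring (\<lambda>(r, c). rep_entry class_ring \<pi> A (inv\<^bsub>Mat class_ring {1..n+1}\<^esub> A) r c) p"
    if "zvars p \<subseteq> ?I \<times> ?I" for A p
    using that by (intro zeval_cong) (auto simp: rep_class simp del: rep_index.simps)
  have v: "zvars (inv_poly n \<pi> r c) \<subseteq> ?I \<times> ?I" if "r \<in> ?I" "c \<in> ?I" for r c
    by (rule zvars_inv_poly[OF n that])
  have vx: "h a b \<in> carrier R" if "r \<in> ?I" "c \<in> ?I" "(a, b) \<in> zvars (inv_poly n \<pi> r c)" for r c a b
    using x[OF subsetD[OF v[OF that(1,2)] that(3)]] by simp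
  {
    fix r c assume rc: "r \<in> ?I" "c \<in> ?I"
    let ?d = "if r = c then ZOne else ZZero"
    define p where "p = zsum (\<lambda>s. ZMul (ZVar (r, s)) (inv_poly n \<pi> s c)) ?I"
    define q where "q = zsum (\<lambda>s. ZMul (inv_poly n \<pi> r s) (ZVar (s, c))) ?I"
    have vp: "zvars p \<subseteq> ?I \<times> ?I" "zvars q \<subseteq> ?I \<times> ?I"
      unfolding p_def q_def zvars_zsum[OF finite_rep_index] zpoly.set
      using rc v by (auto simp del: rep_index.simps)
    have 1: "zeval R ?x (ZAdd p (ZNeg ?d)) = \<zero>"
    proof (rule rel)
      fix A :: "nat \<Rightarrow> nat \<Rightarrow> complex" assume A: "A \<in> SL class_ring (n + 1)"
      show "zeval class_ring (\<lambda>(r, c). rep class_ring n \<pi> A r c) (ZAdd p (ZNeg ?d)) = 0"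
        using rc vp rep_entry_inverse[OF SL_inverse(2)[OF A] rc]
        by (subst rep) (auto simp: p_def zeval_inv_poly[OF n A] class_ring.zeval_ZZero simp del: rep_index.simps)
    qed (use vp in auto)
    have 2: "zeval R ?x (ZAdd q (ZNeg ?d)) = \<zero>"
    proof (rule rel)
      fix A :: "nat \<Rightarrow> nat \<Rightarrow> complex" assume A: "A \<in> SL class_ring (n + 1)"
      have "inverse_pair n (inv\<^bsub>Mat class_ring {1..n+1}\<^esub> A) A"
        using SL_inverse(2)[OF A] by (auto simp: inverse_pair_def)
      from rep_entry_inverse[OF this rc]
      show "zeval class_ring (\<lambda>(r, c). rep class_ring n \<pi> A r c) (ZAdd q (ZNeg ?d)) = 0"
        using rc vp
        by (subst rep) (auto simp: q_def zeval_inv_poly[OF n A] class_ring.zeval_ZZero simp del: rep_index.simps)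
    qed (use vp in auto)
    have c: "zeval R ?x p \<in> carrier R" "zeval R ?x q \<in> carrier R"
      by (rule zeval_closed[OF x[OF subsetD[OF vp(1)]]], assumption,
          rule zeval_closed[OF x[OF subsetD[OF vp(2)]]], assumption)
    have d: "zeval R ?x ?d = \<one>\<^bsub>Mat R ?I\<^esub> r c"
      using rc by (simp add: Mat_one_entry)
    have "zeval R ?x p = (h \<otimes>\<^bsub>Mat R ?I\<^esub> chevalley_inv R n \<pi> h) r c"
      unfolding p_def Mat_mult_entry[OF rc]
      by (subst zeval_zsum[OF finite_rep_index])
         (use rc vx ip Mat_carrierD[OF hM] in \<open>auto simp: chevalley_inv_def intro!: finsum_cong' simp del: rep_index.simps\<close>)
    moreover have "zeval R ?x q = (chevalley_inv R n \<pi> h \<otimes>\<^bsub>Mat R ?I\<^esub> h) r c"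
      unfolding q_def Mat_mult_entry[OF rc]
      by (subst zeval_zsum[OF finite_rep_index])
         (use rc vx ip Mat_carrierD[OF hM] in \<open>auto simp: chevalley_inv_def intro!: finsum_cong' simp del: rep_index.simps\<close>)
    ultimately have "(h \<otimes>\<^bsub>Mat R ?I\<^esub> chevalley_inv R n \<pi> h) r c = \<one>\<^bsub>Mat R ?I\<^esub> r c"
      "(chevalley_inv R n \<pi> h \<otimes>\<^bsub>Mat R ?I\<^esub> h) r c = \<one>\<^bsub>Mat R ?I\<^esub> r c"
      using 1 2 c d Mat_carrierD[OF Mat_one_closed rc]
      by (simp_all add: r_right_minus_eq flip: a_minus_def)
  }
  then show "h \<otimes>\<^bsub>Mat R ?I\<^esub> chevalley_inv R n \<pi> h = \<one>\<^bsub>Mat R ?I\<^esub>"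
    "chevalley_inv R n \<pi> h \<otimes>\<^bsub>Mat R ?I\<^esub> h = \<one>\<^bsub>Mat R ?I\<^esub>"
    by (auto intro!: Mat_eqI[of _ R ?I] Mat_mult_closed hM M Mat_one_closed simp del: rep_index.simps)
qed

text \<open>The entries of \<open>h\<close> are the constrained variables (\<open>Inl\<close>),
  those of \<open>u\<close> the free ones (\<open>Inr\<close>). Over the complex numbers the
  relation is \<open>class_poly_conj\<close>, and \<open>integral_point_extend\<close> carries it
  over.\<close>

lemma chevalley_conj:
  assumes n: "n = 3 \<or> \<pi> \<noteq> MID" and h: "h \<in> chevalley_group R n \<pi>"
    and u: "u \<in> carrier (Mat R (rep_index n \<pi>))"
  defines "M \<equiv> Mat R (rep_index n \<pi>)"
  shows "zeval R (\<lambda>(r, c). (h \<otimes>\<^bsub>M\<^esub> u \<otimes>\<^bsub>M\<^esub> inv\<^bsub>M\<^esub> h) r c) (class_poly n \<pi>) =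
    zeval R (\<lambda>(r, c). u r c) (class_poly n \<pi>)"
proof -
  let ?I = "rep_index n \<pi>" and ?F = "class_poly n \<pi>"
  interpret M: Group.monoid M unfolding M_def by (rule monoid_Mat) simp
  have hM: "h \<in> carrier (Mat R ?I)" using h by (simp add: chevalley_group_def)
  note H = chevalley_inverse[OF n h]
  have inv: "inv\<^bsub>M\<^esub> h = chevalley_inv R n \<pi> h"
    using H hM unfolding M_def[symmetric] by (intro M.inv_unique'[symmetric])
  define y where "y = (\<lambda>(r, c). h r c)"
  define x where "x v = (if v \<in> ?I \<times> ?I then (case v of (r, c) \<Rightarrow> u r c) else \<zero>)" for v
  \<comment> \<open>Entries of the conjugated matrix as polynomials; the inverse of \<open>h\<close>
    has been replaced by its polynomial expression \<open>inv_poly\<close>.\<close>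
  define Z where "Z = (\<lambda>(r, c). zsum (\<lambda>t. ZMul (zsum (\<lambda>s. ZMul (ZVar (Inl (r, s))) (ZVar (Inr (s, t)))) ?I)
     (zsubst (\<lambda>v. ZVar (Inl v)) (inv_poly n \<pi> t c))) ?I)"
  define p where "p = ZAdd (zsubst Z ?F) (ZNeg (zsubst (\<lambda>v. ZVar (Inr v)) ?F))"
  have vZ: "zvars (Z (r, c)) \<subseteq> Inl ` (?I \<times> ?I) \<union> Inr ` (?I \<times> ?I)" if "r \<in> ?I" "c \<in> ?I" for r c
    unfolding Z_def prod.case zvars_zsum[OF finite_rep_index] zpoly.set zvars_zsubst
  proof (intro UN_least Un_least)
    fix t s assume t: "t \<in> ?I" and s: "s \<in> ?I"
    show "{Inl (r, s)} \<subseteq> Inl ` (?I \<times> ?I) \<union> Inr ` (?I \<times> ?I)" "{Inr (s, t)} \<subseteq> Inl ` (?I \<times> ?I) \<union> Inr ` (?I \<times> ?I)"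
      using that s t by blast+
  next
    fix t v assume t: "t \<in> ?I" and v: "v \<in> zvars (inv_poly n \<pi> t c)"
    show "{Inl v} \<subseteq> Inl ` (?I \<times> ?I) \<union> Inr ` (?I \<times> ?I)"
      using subsetD[OF zvars_inv_poly[OF n t that(2)] v] by blast
  qed
  have vp: "zvars p \<subseteq> Inl ` (?I \<times> ?I) \<union> Inr ` (?I \<times> ?I)"
    unfolding p_def zpoly.set zvars_zsubst
  proof (intro Un_least UN_least)
    fix v assume "v \<in> zvars ?F"
    then obtain r c where v: "v = (r, c)" and rc: "r \<in> ?I" "c \<in> ?I" using zvars_class_poly[of n \<pi>] by auto
    show "zvars (Z v) \<subseteq> Inl ` (?I \<times> ?I) \<union> Inr ` (?I \<times> ?I)"
      unfolding v by (rule vZ[OF rc])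
    show "{Inr v} \<subseteq> Inl ` (?I \<times> ?I) \<union> Inr ` (?I \<times> ?I)"
      using v rc by blast
  qed
  have xc: "x v \<in> carrier R" for v
    using Mat_carrierD[OF u] by (auto simp: x_def)
  have yc: "y v \<in> carrier R" if "v \<in> ?I \<times> ?I" for v
    using that Mat_carrierD[OF hM] by (auto simp: y_def)
  have yx: "case_sum y x v \<in> carrier R" if "v \<in> Inl ` (?I \<times> ?I) \<union> Inr ` (?I \<times> ?I)" for v
    using that xc yc by auto
  have "zeval R (case_sum y x) p = \<zero>"
  proof (rule integral_point_extend[OF is_cring _ _ _ xc])
    show "integral_point ((\<lambda>A. \<lambda>(r, c). rep class_ring n \<pi> A r c) ` SL class_ring (n + 1)) (?I \<times> ?I) R y"
      using h yc by (auto simp: integral_point_def chevalley_group_def complex_ring_eq y_def)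
    show "Inl -` zvars p \<subseteq> ?I \<times> ?I" using vp by blast
    fix c z
    assume "c \<in> (\<lambda>A. \<lambda>(r, c). rep (class_ring :: complex ring) n \<pi> A r c) ` SL class_ring (n + 1)"
    then obtain A where A: "A \<in> SL class_ring (n + 1)" "c = (\<lambda>(r, c). rep class_ring n \<pi> A r c)" by auto
    define B where "B = inv\<^bsub>Mat class_ring {1..n+1}\<^esub> A"
    have c: "c (r, t) = rep_entry class_ring \<pi> A B r t" if "r \<in> ?I" "t \<in> ?I" for r t
      using that A(2) by (simp add: rep_class B_def)
    have ci: "zeval class_ring c (inv_poly n \<pi> r t) = rep_entry class_ring \<pi> B A r t" if "r \<in> ?I" "t \<in> ?I" for r t
    proof -
      have "zeval class_ring c (inv_poly n \<pi> r t) =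
          zeval class_ring (\<lambda>(r, c). rep_entry class_ring \<pi> A B r c) (inv_poly n \<pi> r t)"
        using zvars_inv_poly[OF n that] c by (intro zeval_cong) auto
      then show ?thesis using zeval_inv_poly[OF n A(1) that] by (simp add: B_def)
    qed
    have Zc: "zeval class_ring (case_sum c z) (Z (r, t)) = (\<Sum>s\<in>?I. \<Sum>t'\<in>?I.
        rep_entry class_ring \<pi> A B r s * z (s, t') * rep_entry class_ring \<pi> B A t' t)" if "r \<in> ?I" "t \<in> ?I" for r t
      using that by (subst sum.swap) (simp add: Z_def zeval_zsubst c ci sum_distrib_right del: rep_index.simps)
    have "zeval class_ring (case_sum c z) (zsubst Z ?F) =
        zeval class_ring (\<lambda>(r, c). \<Sum>s\<in>?I. \<Sum>t\<in>?I.
          rep_entry class_ring \<pi> A B r s * (\<lambda>r c. z (r, c)) s t * rep_entry class_ring \<pi> B A t c) ?F"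
      unfolding zeval_zsubst using zvars_class_poly[of n \<pi>] by (intro zeval_cong) (auto simp: Zc)
    also have "\<dots> = zeval class_ring (\<lambda>(r, c). z (r, c)) ?F"
      by (rule class_poly_conj) (use SL_inverse(2)[OF A(1)] in \<open>simp add: B_def\<close>)
    finally show "zeval class_ring (case_sum c z) p = 0"
      by (simp add: p_def zeval_zsubst)
  qed
  moreover have closed: "zeval R (case_sum y x) (zsubst Z ?F) \<in> carrier R"
      "zeval R (case_sum y x) (zsubst (\<lambda>v. ZVar (Inr v)) ?F) \<in> carrier R"
    by (rule zeval_closed, rule yx, rule subsetD[OF vp], simp add: p_def)+
  ultimately have "zeval R (case_sum y x) (zsubst Z ?F) = zeval R (case_sum y x) (zsubst (\<lambda>v. ZVar (Inr v)) ?F)"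
    by (simp add: p_def r_right_minus_eq flip: a_minus_def)
  also have "\<dots> = zeval R (\<lambda>(r, c). u r c) ?F"
    unfolding zeval_zsubst using zvars_class_poly[of n \<pi>] by (intro zeval_cong) (auto simp: x_def)
  also have "zeval R (case_sum y x) (zsubst Z ?F) = zeval R (\<lambda>(r, c). (h \<otimes>\<^bsub>M\<^esub> u \<otimes>\<^bsub>M\<^esub> inv\<^bsub>M\<^esub> h) r c) ?F"
    unfolding zeval_zsubst
  proof (rule zeval_cong)
    fix v assume "v \<in> zvars ?F"
    then obtain r c where v: "v = (r, c)" and rc: "r \<in> ?I" "c \<in> ?I" using zvars_class_poly[of n \<pi>] by auto
    have yxI: "a \<in> ?I \<Longrightarrow> b \<in> ?I \<Longrightarrow> case_sum y x (Inl (a, b)) = h a b"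
      "a \<in> ?I \<Longrightarrow> b \<in> ?I \<Longrightarrow> case_sum y x (Inr (a, b)) = u a b" for a b
      by (simp_all add: y_def x_def)
    have inner: "zeval R (case_sum y x) (zsum (\<lambda>s. ZMul (ZVar (Inl (r, s))) (ZVar (Inr (s, t)))) ?I) = (h \<otimes>\<^bsub>M\<^esub> u) r t"
      if "t \<in> ?I" for t
    proof -
      have "zeval R (case_sum y x) (zsum (\<lambda>s. ZMul (ZVar (Inl (r, s))) (ZVar (Inr (s, t)))) ?I) =
          (\<Oplus>s\<in>?I. zeval R (case_sum y x) (ZMul (ZVar (Inl (r, s))) (ZVar (Inr (s, t)))))"
        by (rule zeval_zsum[OF finite_rep_index]) (use rc that in \<open>auto intro!: xc yc simp del: rep_index.simps\<close>)
      also have "\<dots> = (h \<otimes>\<^bsub>M\<^esub> u) r t"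
        unfolding M_def Mat_mult_entry[OF rc(1) that]
        by (rule finsum_cong') (use rc that Mat_carrierD[OF hM] Mat_carrierD[OF u] in \<open>auto simp: yxI simp del: rep_index.simps sum.case\<close>)
      finally show ?thesis .
    qed
    have outer: "zeval R (case_sum y x) (zsubst (\<lambda>v. ZVar (Inl v)) (inv_poly n \<pi> t c)) = (inv\<^bsub>M\<^esub> h) t c"
      if "t \<in> ?I" for t
      using that rc unfolding inv by (simp add: chevalley_inv_def zeval_zsubst y_def)
    have "zeval R (case_sum y x) (Z (r, c)) = (\<Oplus>t\<in>?I. zeval R (case_sum y x)
       (ZMul (zsum (\<lambda>s. ZMul (ZVar (Inl (r, s))) (ZVar (Inr (s, t)))) ?I)
         (zsubst (\<lambda>v. ZVar (Inl v)) (inv_poly n \<pi> t c))))"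
      unfolding Z_def prod.case
    proof (rule zeval_zsum[OF finite_rep_index])
      fix t v assume t: "t \<in> ?I" and v: "v \<in> zvars (ZMul (zsum (\<lambda>s. ZMul (ZVar (Inl (r, s))) (ZVar (Inr (s, t)))) ?I)
         (zsubst (\<lambda>v. ZVar (Inl v)) (inv_poly n \<pi> t c)))"
      have "v \<in> zvars (Z (r, c))"
        unfolding Z_def prod.case zvars_zsum[OF finite_rep_index] using t v by blast
      then show "case_sum y x v \<in> carrier R" using vZ[OF rc] by (intro yx) blast
    qed
    also have "\<dots> = (h \<otimes>\<^bsub>M\<^esub> u \<otimes>\<^bsub>M\<^esub> inv\<^bsub>M\<^esub> h) r c"
      unfolding M_def Mat_mult_entry[OF rc] unfolding M_def[symmetric]
    proof (rule finsum_cong')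
      have "(h \<otimes>\<^bsub>M\<^esub> u) r t \<in> carrier R" "(inv\<^bsub>M\<^esub> h) t c \<in> carrier R" if "t \<in> ?I" for t
        using Mat_carrierD[OF Mat_mult_closed[OF hM u] rc(1) that] Mat_carrierD[OF H(1) that rc(2)]
        by (simp_all add: M_def inv[unfolded M_def])
      then show "(\<lambda>t. (h \<otimes>\<^bsub>M\<^esub> u) r t \<otimes> (inv\<^bsub>M\<^esub> h) t c) \<in> ?I \<rightarrow> carrier R" by auto
    qed (simp_all add: inner outer)
    finally show "zeval R (case_sum y x) (Z v) = (case v of (r, c) \<Rightarrow> (h \<otimes>\<^bsub>M\<^esub> u \<otimes>\<^bsub>M\<^esub> inv\<^bsub>M\<^esub> h) r c)"
      by (simp add: v)
  qed
  finally show ?thesis .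
qed

end



section \<open>Invariance under the torus\<close>

text \<open>The simple roots with index at least \<open>i\<close> telescope to the difference of the
  weights with indices \<open>i\<close> and \<open>n + 1\<close>. Subtracting the same sum for
  \<open>k\<close> cancels the last weight.\<close>

lemma std_weight_diff_in_root_lattice:
  assumes "i \<in> {1..n+1}" "k \<in> {1..n+1}"
  shows "std_weight n i - std_weight n k \<in> root_lattice n"
proof -
  have tele: "(\<Sum>l=1..m. (if i \<le> l then 1 else 0) * (f l - f (l + 1))) = f i - f (m + 1)"
    if "i \<in> {1..m+1}" for i m and f :: "nat \<Rightarrow> int"
    using that
  proof (induction m)
    case (Suc m)
    show ?case
    proof (cases "i \<le> m + 1")
      case True
      then show ?thesis using Suc by (simp add: sum.cl_ivl_Suc One_nat_def)
    next
      case False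
      then have "i = Suc m + 1" using Suc.prems by simp
      then show ?thesis by (auto intro!: sum.neutral)
    qed
  qed auto
  have "(\<Sum>l=1..n. ((if i \<le> l then 1 else 0) - (if k \<le> l then 1 else 0)) * simple_root n l j) =
      std_weight n i j - std_weight n k j" for j
    using tele[OF assms(1), of "\<lambda>l. std_weight n l j"] tele[OF assms(2), of "\<lambda>l. std_weight n l j"]
    by (simp add: simple_root_def left_diff_distrib sum_subtractf)
  then show ?thesis
    unfolding root_lattice_def by (auto intro!: exI[of _ "\<lambda>l. (if i \<le> l then 1 else 0) - (if k \<le> l then 1 else 0)"])
qed

lemma root_lattice_add:
  assumes "v \<in> root_lattice n" "w \<in> root_lattice n"
  shows "v + w \<in> root_lattice n"
proof -
  obtain c d where v: "v = (\<lambda>j. \<Sum>i=1..n. c i * simple_root n i j)"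
    and w: "w = (\<lambda>j. \<Sum>i=1..n. d i * simple_root n i j)"
    using assms unfolding root_lattice_def by blast
  have "v + w = (\<lambda>j. \<Sum>i=1..n. (c i + d i) * simple_root n i j)"
    unfolding v w plus_fun_def distrib_right sum.distrib ..
  then show ?thesis unfolding root_lattice_def mem_Collect_eq by (rule exI[where x = "\<lambda>i. c i + d i"])
qed

lemma std_weight_in_weight_lattice: "std_weight n i \<in> weight_lattice n"
  by (auto simp: std_weight_def fund_weight_def weight_lattice_def)

lemma root_lattice_subset: "root_lattice n \<subseteq> isogeny_lattice n \<pi>"
proof (cases \<pi>)
  case SC
  then show ?thesis
    by (auto simp: root_lattice_def weight_lattice_def simple_root_def std_weight_def fund_weight_def
        intro!: sum.neutral)
next
  case MID
  show ?thesis
  proof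
    fix v assume "v \<in> root_lattice n"
    then show "v \<in> isogeny_lattice n \<pi>" unfolding MID
      by (auto intro!: exI[of _ v] exI[of _ "0::int"])
  qed
qed auto

lemma rep_weight_in_lattice:
  assumes r: "r \<in> rep_index n \<pi>" and n: "n \<ge> 2"
  shows "rep_weight n \<pi> r \<in> isogeny_lattice n \<pi>"
proof (cases \<pi>)
  case SC
  then show ?thesis using r std_weight_in_weight_lattice by auto
next
  case AD
  then show ?thesis using r std_weight_diff_in_root_lattice by auto
next
  case MID
  then obtain i j where ij: "r = [i, j]" "i \<in> {1..n+1}" "j \<in> {1..n+1}" using r by auto
  \<comment> \<open>The second fundamental weight is the sum of the first two standard weights; the
    rest of the weight is then a sum of two differences lying in the root lattice.\<close>
  define v where "v = (std_weight n i - std_weight n 1) + (std_weight n j - std_weight n 2)"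
  have "v \<in> root_lattice n"
    unfolding v_def using ij n by (intro root_lattice_add std_weight_diff_in_root_lattice) auto
  moreover have f: "fund_weight n 2 l = std_weight n 1 l + std_weight n 2 l" for l
    by (auto simp: std_weight_def fund_weight_def)
  have "rep_weight n \<pi> r = (\<lambda>j. v j + 1 * fund_weight n 2 j)"
    by (simp add: MID ij v_def fun_eq_iff f)
  ultimately show ?thesis
    unfolding MID isogeny_lattice.simps mem_Collect_eq by (intro exI[of _ v] exI[of _ "1::int"]) simp
qed

context cring
begin

text \<open>All orders of the two indices carry the same factor \<open>g\<close>, so the signs of
  the antisymmetric extension do not interfere with scaling.\<close>

lemma zeval_wedge_poly_scale:
  assumes "\<And>r c. r \<in> rep_index n MID \<Longrightarrow> c \<in> rep_index n MID \<Longrightarrow> zeval R x (U r c) \<in> carrier R"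
    and "\<And>r c. r \<in> rep_index n MID \<Longrightarrow> c \<in> rep_index n MID \<Longrightarrow> e r c \<in> carrier R"
    and "\<And>r c. r \<in> rep_index n MID \<Longrightarrow> c \<in> rep_index n MID \<Longrightarrow> zeval R x' (U r c) = e r c \<otimes> zeval R x (U r c)"
    and "\<And>r c. r \<in> {[i, j], [j, i]} \<Longrightarrow> c \<in> {[k, j], [j, k]} \<Longrightarrow> r \<in> rep_index n MID \<Longrightarrow> c \<in> rep_index n MID \<Longrightarrow> e r c = g"
    and "i \<in> {1..n+1}" "j \<in> {1..n+1}" "k \<in> {1..n+1}" "g \<in> carrier R"
  shows "zeval R x' (wedge_poly U i j k j) = g \<otimes> zeval R x (wedge_poly U i j k j)"
proof -
  have "i < j \<Longrightarrow> [i, j] \<in> rep_index n MID" "j < i \<Longrightarrow> [j, i] \<in> rep_index n MID"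
    "k < j \<Longrightarrow> [k, j] \<in> rep_index n MID" "j < k \<Longrightarrow> [j, k] \<in> rep_index n MID"
    using assms(5-7) by auto
  with assms(1-4,8) show ?thesis
    unfolding wedge_poly_def by (auto simp: r_minus simp del: rep_index.simps)
qed

end

text \<open>Conjugation by a torus element multiplies each entry by the character value of a weight
  difference. Invariance is read off from the weights, without first placing
  \<open>torus_element\<close> in \<open>chevalley_group\<close>.\<close>

locale torus_scaling = cring R for R :: "('a, 'r) ring_scheme" (structure) +
  fixes n :: nat and \<pi> :: isogeny and \<chi> :: "weight \<Rightarrow> 'a"
  assumes n: "n \<ge> 2" and chi: "\<chi> \<in> hom (weight_group (isogeny_lattice n \<pi>)) (units_of R)"
begin

definition e where char_weight: "e r = \<chi> (rep_weight n \<pi> r)"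
definition g where char_diff: "g i k = \<chi> (std_weight n i - std_weight n k)"

lemma chi_Units: "v \<in> isogeny_lattice n \<pi> \<Longrightarrow> \<chi> v \<in> Units R"
  using chi by (auto simp: hom_def weight_group_def units_of_def)

lemma chi_add: "v \<in> isogeny_lattice n \<pi> \<Longrightarrow> w \<in> isogeny_lattice n \<pi> \<Longrightarrow> \<chi> (v + w) = \<chi> v \<otimes> \<chi> w"
  using chi by (auto simp: hom_def weight_group_def units_of_def)

lemma diff_in: "i \<in> {1..n+1} \<Longrightarrow> k \<in> {1..n+1} \<Longrightarrow> std_weight n i - std_weight n k \<in> isogeny_lattice n \<pi>"
  using std_weight_diff_in_root_lattice root_lattice_subset by blast

lemma e_Units: "r \<in> rep_index n \<pi> \<Longrightarrow> e r \<in> Units R"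
  unfolding char_weight by (intro chi_Units rep_weight_in_lattice n)

lemma g_Units: "i \<in> {1..n+1} \<Longrightarrow> k \<in> {1..n+1} \<Longrightarrow> g i k \<in> Units R"
  unfolding char_diff by (intro chi_Units diff_in)

lemma g_trans:
  assumes "i \<in> {1..n+1}" "j \<in> {1..n+1}" "k \<in> {1..n+1}"
  shows "g i j \<otimes> g j k = g i k"
proof -
  have "\<chi> ((std_weight n i - std_weight n j) + (std_weight n j - std_weight n k)) = g i j \<otimes> g j k"
    unfolding char_diff using assms by (intro chi_add diff_in)
  then show ?thesis by (simp add: char_diff)
qed

lemma g_refl:
  assumes "i \<in> {1..n+1}"
  shows "g i i = \<one>"
  using g_trans[OF assms assms assms] g_Units[OF assms assms]
  by (metis Units_closed Units_l_cancel one_closed r_one)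

lemma e_quotient:
  assumes "r \<in> rep_index n \<pi>" "c \<in> rep_index n \<pi>" "i \<in> {1..n+1}" "k \<in> {1..n+1}"
    and "rep_weight n \<pi> r = (std_weight n i - std_weight n k) + rep_weight n \<pi> c"
  shows "e r \<otimes> inv (e c) = g i k"
proof -
  have "e r = g i k \<otimes> e c"
    unfolding char_weight char_diff assms(5) using assms by (intro chi_add diff_in rep_weight_in_lattice n)
  then show ?thesis
    using e_Units[OF assms(2)] g_Units[OF assms(3,4)] by (simp add: m_assoc Units_closed)
qed

text \<open>The contracted index contributes the same weight to row and column, so entry
  \<open>(i, k)\<close> of the partial trace has weight
  \<open>std_weight n i - std_weight n k\<close> in all three cases.\<close>

lemma ptrace_poly_scale:
  assumes U: "\<And>r c. r \<in> rep_index n \<pi> \<Longrightarrow> c \<in> rep_index n \<pi> \<Longrightarrow> zvars (U r c) \<subseteq> rep_index n \<pi> \<times> rep_index n \<pi>"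
    and x: "\<And>v. v \<in> rep_index n \<pi> \<times> rep_index n \<pi> \<Longrightarrow> x v \<in> carrier R"
    and x': "\<And>v. v \<in> rep_index n \<pi> \<times> rep_index n \<pi> \<Longrightarrow> x' v \<in> carrier R"
    and s: "\<And>r c. r \<in> rep_index n \<pi> \<Longrightarrow> c \<in> rep_index n \<pi> \<Longrightarrow>
      zeval R x' (U r c) = e r \<otimes> inv (e c) \<otimes> zeval R x (U r c)"
    and ik: "i \<in> {1..n+1}" "k \<in> {1..n+1}"
  shows "zeval R x' (ptrace_poly n \<pi> U i k) = g i k \<otimes> zeval R x (ptrace_poly n \<pi> U i k)"
    "zeval R x (ptrace_poly n \<pi> U i k) \<in> carrier R"
proof -
  let ?I = "rep_index n \<pi>" and ?J = "{1..n+1}"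
  have Ux: "zeval R x (U r c) \<in> carrier R" if "r \<in> ?I" "c \<in> ?I" for r c
    using zeval_closed[OF x[OF subsetD[OF U[OF that]]]] .
  have gc: "g i k \<in> carrier R" using g_Units[OF ik] by auto
  have ec: "e r \<otimes> inv (e c) \<in> carrier R" if "r \<in> ?I" "c \<in> ?I" for r c
    using e_Units that by auto
  have sum: "zeval R x' (zsum f ?J) = g i k \<otimes> zeval R x (zsum f ?J) \<and> zeval R x (zsum f ?J) \<in> carrier R"
    if f: "\<And>j. j \<in> ?J \<Longrightarrow> zvars (f j) \<subseteq> ?I \<times> ?I"
      and fs: "\<And>j. j \<in> ?J \<Longrightarrow> zeval R x' (f j) = g i k \<otimes> zeval R x (f j)" for f
  proof -
    have c: "zeval R x (f j) \<in> carrier R" if "j \<in> ?J" for j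
      using zeval_closed[OF x[OF subsetD[OF f[OF that]]]] .
    have "zeval R x' (zsum f ?J) = (\<Oplus>j\<in>?J. zeval R x' (f j))"
      by (rule zeval_zsum[OF _ x'[OF subsetD[OF f]]]) simp_all
    also have "\<dots> = (\<Oplus>j\<in>?J. g i k \<otimes> zeval R x (f j))"
      using c gc fs by (intro finsum_cong') auto
    also have "\<dots> = g i k \<otimes> (\<Oplus>j\<in>?J. zeval R x (f j))"
      using c gc by (intro finsum_rdistr[symmetric]) auto
    also have "(\<Oplus>j\<in>?J. zeval R x (f j)) = zeval R x (zsum f ?J)"
      by (rule zeval_zsum[OF _ x[OF subsetD[OF f]], symmetric]) simp_all
    finally have "zeval R x' (zsum f ?J) = g i k \<otimes> zeval R x (zsum f ?J)" .
    moreover have "zeval R x (zsum f ?J) \<in> carrier R"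
      using zeval_zsum[OF _ x[OF subsetD[OF f]], of ?J f] c by (auto intro!: finsum_closed)
    ultimately show ?thesis by blast
  qed
  show "zeval R x' (ptrace_poly n \<pi> U i k) = g i k \<otimes> zeval R x (ptrace_poly n \<pi> U i k)"
    "zeval R x (ptrace_poly n \<pi> U i k) \<in> carrier R"
  proof (atomize (full), cases \<pi>)
    case SC
    then have "[i] \<in> ?I" "[k] \<in> ?I" using ik by auto
    moreover have "e [i] \<otimes> inv (e [k]) = g i k"
      using SC ik calculation by (intro e_quotient) auto
    ultimately show "zeval R x' (ptrace_poly n \<pi> U i k) = g i k \<otimes> zeval R x (ptrace_poly n \<pi> U i k) \<and>
        zeval R x (ptrace_poly n \<pi> U i k) \<in> carrier R"
      using s Ux SC by simp
  next
    case AD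
    have m: "[j, l] \<in> ?I" if "j \<in> ?J" "l \<in> ?J" for j l using that AD by auto
    have "zeval R x' (U [j, k] [j, i]) = g i k \<otimes> zeval R x (U [j, k] [j, i])" if "j \<in> ?J" for j
    proof -
      have "e [j, k] \<otimes> inv (e [j, i]) = g i k"
        using AD ik that by (intro e_quotient m) auto
      with s[OF m m] that ik show ?thesis by simp
    qed
    then show "zeval R x' (ptrace_poly n \<pi> U i k) = g i k \<otimes> zeval R x (ptrace_poly n \<pi> U i k) \<and>
        zeval R x (ptrace_poly n \<pi> U i k) \<in> carrier R"
      using sum[of "\<lambda>j. U [j, k] [j, i]"] U[OF m m] ik unfolding AD ptrace_poly.simps by blast
  next
    case MID
    have ef: "e r \<otimes> inv (e c) = g i k"
      if "r \<in> {[i, j], [j, i]}" "c \<in> {[k, j], [j, k]}" "r \<in> ?I" "c \<in> ?I" "j \<in> ?J" for r c j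
      using that MID ik by (intro e_quotient) (auto simp: MID)
    have sc: "zeval R x' (wedge_poly U i j k j) = g i k \<otimes> zeval R x (wedge_poly U i j k j)" if "j \<in> ?J" for j
      by (rule zeval_wedge_poly_scale[where n = n and e = "\<lambda>r c. e r \<otimes> inv (e c)"])
         (use Ux ec s ef that ik gc in \<open>simp_all add: MID del: rep_index.simps\<close>)
    have "zvars (wedge_poly U i j k j) \<subseteq> ?I \<times> ?I" if "j \<in> ?J" for j
    proof -
      have "i < j \<Longrightarrow> [i, j] \<in> ?I" "j < i \<Longrightarrow> [j, i] \<in> ?I" "k < j \<Longrightarrow> [k, j] \<in> ?I" "j < k \<Longrightarrow> [j, k] \<in> ?I"
        using MID that ik by auto
      then show ?thesis using U unfolding wedge_poly_def by (simp del: rep_index.simps)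
    qed
    then show "zeval R x' (ptrace_poly n \<pi> U i k) = g i k \<otimes> zeval R x (ptrace_poly n \<pi> U i k) \<and>
        zeval R x (ptrace_poly n \<pi> U i k) \<in> carrier R"
      using sum[of "\<lambda>j. wedge_poly U i j k j"] sc unfolding MID ptrace_poly.simps by blast
  qed
qed

text \<open>Squaring preserves the scaling rule because intermediate weights cancel. In the traces
  the factors run around a cycle, \<open>g i j\<close>, \<open>g j k\<close>, \<open>g k i\<close>,
  and multiply to one.\<close>

lemma class_poly_scale:
  assumes x: "\<And>v. v \<in> rep_index n \<pi> \<times> rep_index n \<pi> \<Longrightarrow> x v \<in> carrier R"
    and s: "\<And>r c. r \<in> rep_index n \<pi> \<Longrightarrow> c \<in> rep_index n \<pi> \<Longrightarrow> x' (r, c) = e r \<otimes> x (r, c) \<otimes> inv (e c)"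
  shows "zeval R x' (class_poly n \<pi>) = zeval R x (class_poly n \<pi>)"
proof -
  let ?I = "rep_index n \<pi>" and ?J = "{1..n+1}"
  have ec: "e r \<in> carrier R" "inv (e r) \<in> carrier R" if "r \<in> ?I" for r
    using e_Units[OF that] by auto
  have x': "x' v \<in> carrier R" if "v \<in> ?I \<times> ?I" for v
    using that s x ec by auto
  have xx: "x (r, c) \<in> carrier R" "x' (r, c) \<in> carrier R" if "r \<in> ?I" "c \<in> ?I" for r c
    using that x x' by auto
  have sqv: "zvars (square_poly n \<pi> r c) \<subseteq> ?I \<times> ?I" if "r \<in> ?I" "c \<in> ?I" for r c
    using that by (auto simp: square_poly_def zvars_zsum simp del: rep_index.simps)
  have s1: "zeval R x' (ZVar (r, c)) = e r \<otimes> inv (e c) \<otimes> zeval R x (ZVar (r, c))" if "r \<in> ?I" "c \<in> ?I" for r c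
    using that s ec xx by (simp add: m_ac)
  have s2: "zeval R x' (square_poly n \<pi> r c) = e r \<otimes> inv (e c) \<otimes> zeval R x (square_poly n \<pi> r c)"
    if rc: "r \<in> ?I" "c \<in> ?I" for r c
  proof -
    have ev: "zeval R y (square_poly n \<pi> r c) = (\<Oplus>t\<in>?I. y (r, t) \<otimes> y (t, c))"
      if "\<And>v. v \<in> ?I \<times> ?I \<Longrightarrow> y v \<in> carrier R" for y
      unfolding square_poly_def
      by (subst zeval_zsum) (use rc that in \<open>auto simp del: rep_index.simps\<close>)
    have "x' (r, t) \<otimes> x' (t, c) = e r \<otimes> inv (e c) \<otimes> (x (r, t) \<otimes> x (t, c))" if "t \<in> ?I" for t
    proof -
      have "x' (r, t) \<otimes> x' (t, c) = (e t \<otimes> inv (e t)) \<otimes> (e r \<otimes> inv (e c) \<otimes> (x (r, t) \<otimes> x (t, c)))"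
        using that rc ec xx by (simp add: s m_ac)
      then show ?thesis using e_Units[OF that] that rc ec xx by simp
    qed
    then have "(\<Oplus>t\<in>?I. x' (r, t) \<otimes> x' (t, c)) = (\<Oplus>t\<in>?I. e r \<otimes> inv (e c) \<otimes> (x (r, t) \<otimes> x (t, c)))"
      using rc ec xx by (intro finsum_cong') auto
    also have "\<dots> = e r \<otimes> inv (e c) \<otimes> (\<Oplus>t\<in>?I. x (r, t) \<otimes> x (t, c))"
      using rc ec xx by (intro finsum_rdistr[symmetric]) auto
    finally show ?thesis by (simp add: ev x x')
  qed
  have Y1: "zeval R x' (ptrace_poly n \<pi> (\<lambda>r c. ZVar (r, c)) i k) = g i k \<otimes> zeval R x (ptrace_poly n \<pi> (\<lambda>r c. ZVar (r, c)) i k)"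
    "zeval R x (ptrace_poly n \<pi> (\<lambda>r c. ZVar (r, c)) i k) \<in> carrier R" if "i \<in> ?J" "k \<in> ?J" for i k
    by (rule ptrace_poly_scale[OF _ x x' s1 that]; simp)+
  have Y2: "zeval R x' (ptrace_poly n \<pi> (square_poly n \<pi>) i k) = g i k \<otimes> zeval R x (ptrace_poly n \<pi> (square_poly n \<pi>) i k)"
    "zeval R x (ptrace_poly n \<pi> (square_poly n \<pi>) i k) \<in> carrier R" if "i \<in> ?J" "k \<in> ?J" for i k
    by (rule ptrace_poly_scale[OF sqv x x' s2 that]; assumption)+
  define Y where "Y = ptrace_poly n \<pi> (\<lambda>r c. ZVar (r, c))"
  define Y' where "Y' = ptrace_poly n \<pi> (square_poly n \<pi>)"
  note Y1 = Y1[folded Y_def] and Y2 = Y2[folded Y'_def]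
  have vY: "zvars (Y i k) \<subseteq> ?I \<times> ?I" "zvars (Y' i k) \<subseteq> ?I \<times> ?I" if "i \<in> ?J" "k \<in> ?J" for i k
    unfolding Y_def Y'_def by (rule zvars_ptrace_poly[OF _ that], simp)+ (rule zvars_ptrace_poly[OF sqv that])
  have sum: "zeval R x' (zsum f ?J) = zeval R x (zsum f ?J)"
    if vf: "\<And>j. j \<in> ?J \<Longrightarrow> zvars (f j) \<subseteq> ?I \<times> ?I" and ef: "\<And>j. j \<in> ?J \<Longrightarrow> zeval R x' (f j) = zeval R x (f j)" for f
  proof -
    have "zeval R x (f j) \<in> carrier R" if "j \<in> ?J" for j
      by (rule zeval_closed[OF x[OF subsetD[OF vf[OF that]]]])
    then have "(\<Oplus>j\<in>?J. zeval R x' (f j)) = (\<Oplus>j\<in>?J. zeval R x (f j))"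
      using ef by (intro finsum_cong') auto
    moreover have "zeval R y (zsum f ?J) = (\<Oplus>j\<in>?J. zeval R y (f j))"
      if "\<And>v. v \<in> ?I \<times> ?I \<Longrightarrow> y v \<in> carrier R" for y
      by (rule zeval_zsum[OF _ that[OF subsetD[OF vf]]]) simp_all
    ultimately show ?thesis using x x' by simp
  qed
  show ?thesis
  proof (cases "\<pi> = SC")
    case True
    have "zeval R x' (zsum (\<lambda>i. Y i i) ?J) = zeval R x (zsum (\<lambda>i. Y i i) ?J)"
      by (rule sum) (use vY Y1 in \<open>auto simp: g_refl\<close>)
    then show ?thesis using True by (simp add: class_poly_def Let_def Y_def)
  next
    case False
    have "zeval R x' (zsum (\<lambda>i. zsum (\<lambda>k. zsum (\<lambda>j. ZMul (ZMul (Y i j) (Y j k)) (Y' k i)) ?J) ?J) ?J) =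
        zeval R x (zsum (\<lambda>i. zsum (\<lambda>k. zsum (\<lambda>j. ZMul (ZMul (Y i j) (Y j k)) (Y' k i)) ?J) ?J) ?J)"
    proof (intro sum)
      fix i k j assume ijk: "i \<in> ?J" "k \<in> ?J" "j \<in> ?J"
      have gc: "g a b \<in> carrier R" if "a \<in> ?J" "b \<in> ?J" for a b using g_Units[OF that] by auto
      have "zeval R x' (ZMul (ZMul (Y i j) (Y j k)) (Y' k i)) =
          (g i j \<otimes> g j k \<otimes> g k i) \<otimes> zeval R x (ZMul (ZMul (Y i j) (Y j k)) (Y' k i))"
        using ijk gc Y1 Y2 by (simp add: m_ac)
      also have "g i j \<otimes> g j k \<otimes> g k i = \<one>"
        using ijk by (simp add: g_trans g_refl)
      finally show "zeval R x' (ZMul (ZMul (Y i j) (Y j k)) (Y' k i)) = zeval R x (ZMul (ZMul (Y i j) (Y j k)) (Y' k i))"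
        using ijk Y1 Y2 by simp
    qed (use vY in \<open>simp_all add: zvars_zsum UN_subset_iff\<close>)
    then show ?thesis using False by (simp add: class_poly_def Let_def Y_def Y'_def)
  qed
qed

lemma torus_conj:
  assumes u: "u \<in> carrier (Mat R (rep_index n \<pi>))"
  defines "M \<equiv> Mat R (rep_index n \<pi>)" and "h \<equiv> torus_element R n \<pi> \<chi>"
  shows "zeval R (\<lambda>(r, c). (h \<otimes>\<^bsub>M\<^esub> u \<otimes>\<^bsub>M\<^esub> inv\<^bsub>M\<^esub> h) r c) (class_poly n \<pi>) =
    zeval R (\<lambda>(r, c). u r c) (class_poly n \<pi>)"
proof -
  let ?I = "rep_index n \<pi>"
  interpret M: Group.monoid M unfolding M_def by (rule monoid_Mat) simp
  have ec: "e r \<in> carrier R" "inv (e r) \<in> carrier R" if "r \<in> ?I" for r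
    using e_Units[OF that] by auto
  define diag where "diag d = (\<lambda>r\<in>?I. \<lambda>c\<in>?I. if r = c then d r else \<zero>)" for d :: "nat list \<Rightarrow> 'a"
  have h: "h = diag e" unfolding h_def torus_element_def diag_def char_weight ..
  have dM: "diag d \<in> carrier M" if "\<And>r. r \<in> ?I \<Longrightarrow> d r \<in> carrier R" for d
    unfolding diag_def M_def by (rule Mat_carrierI) (use that in auto)
  have left: "(diag d \<otimes>\<^bsub>M\<^esub> v) r c = d r \<otimes> v r c"
    if "\<And>r. r \<in> ?I \<Longrightarrow> d r \<in> carrier R" "v \<in> carrier M" "r \<in> ?I" "c \<in> ?I" for d v r c
  proof -
    have "(\<Oplus>t\<in>?I. diag d r t \<otimes> v t c) = (\<Oplus>t\<in>?I. if r = t then d t \<otimes> v t c else \<zero>)"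
      using that Mat_carrierD[OF that(2)[unfolded M_def]]
      by (intro finsum_cong') (auto simp: diag_def simp del: rep_index.simps)
    also have "\<dots> = d r \<otimes> v r c"
      using that Mat_carrierD[OF that(2)[unfolded M_def]]
      by (intro finsum_singleton) (auto simp del: rep_index.simps)
    finally show ?thesis unfolding M_def Mat_mult_entry[OF that(3,4)] .
  qed
  have right: "(v \<otimes>\<^bsub>M\<^esub> diag d) r c = v r c \<otimes> d c"
    if "\<And>r. r \<in> ?I \<Longrightarrow> d r \<in> carrier R" "v \<in> carrier M" "r \<in> ?I" "c \<in> ?I" for d v r c
  proof -
    have "(\<Oplus>t\<in>?I. v r t \<otimes> diag d t c) = (\<Oplus>t\<in>?I. if c = t then v r t \<otimes> d t else \<zero>)"
      using that Mat_carrierD[OF that(2)[unfolded M_def]]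
      by (intro finsum_cong') (auto simp: diag_def simp del: rep_index.simps)
    also have "\<dots> = v r c \<otimes> d c"
      using that Mat_carrierD[OF that(2)[unfolded M_def]]
      by (intro finsum_singleton) (auto simp del: rep_index.simps)
    finally show ?thesis unfolding M_def Mat_mult_entry[OF that(3,4)] .
  qed
  let ?d = "diag (\<lambda>r. inv (e r))"
  have he: "diag e \<in> carrier M" "?d \<in> carrier M" by (auto intro!: dM ec)
  have d: "diag d r c = (if r = c then d r else \<zero>)" if "r \<in> ?I" "c \<in> ?I" for d r c
    using that by (simp add: diag_def)
  have "diag d \<otimes>\<^bsub>M\<^esub> diag d' = \<one>\<^bsub>M\<^esub>"
    if "\<And>r. r \<in> ?I \<Longrightarrow> d r \<in> carrier R" "\<And>r. r \<in> ?I \<Longrightarrow> d' r \<in> carrier R"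
      "\<And>r. r \<in> ?I \<Longrightarrow> d r \<otimes> d' r = \<one>" for d d'
  proof (rule Mat_eqI[of _ R ?I])
    show "diag d \<otimes>\<^bsub>M\<^esub> diag d' \<in> carrier (Mat R ?I)" "\<one>\<^bsub>M\<^esub> \<in> carrier (Mat R ?I)"
      using dM[OF that(1)] dM[OF that(2)] M.m_closed M.one_closed by (simp_all add: M_def)
    fix r c assume rc: "r \<in> ?I" "c \<in> ?I"
    have "(diag d \<otimes>\<^bsub>M\<^esub> diag d') r c = d r \<otimes> diag d' r c"
      using that rc by (intro left dM)
    also have "\<dots> = \<one>\<^bsub>M\<^esub> r c"
      using that rc by (simp add: d M_def Mat_one_entry)
    finally show "(diag d \<otimes>\<^bsub>M\<^esub> diag d') r c = \<one>\<^bsub>M\<^esub> r c" .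
  qed
  then have "diag e \<otimes>\<^bsub>M\<^esub> ?d = \<one>\<^bsub>M\<^esub>" "?d \<otimes>\<^bsub>M\<^esub> diag e = \<one>\<^bsub>M\<^esub>"
    using e_Units ec by auto
  then have inv: "inv\<^bsub>M\<^esub> h = ?d" unfolding h by (intro M.inv_unique'[symmetric] he)
  show ?thesis
  proof (rule class_poly_scale)
    show "(case v of (r, c) \<Rightarrow> u r c) \<in> carrier R" if "v \<in> ?I \<times> ?I" for v
      using that Mat_carrierD[OF u] by auto
    show "(case (r, c) of (r, c) \<Rightarrow> (h \<otimes>\<^bsub>M\<^esub> u \<otimes>\<^bsub>M\<^esub> inv\<^bsub>M\<^esub> h) r c) =
        e r \<otimes> (case (r, c) of (r, c) \<Rightarrow> u r c) \<otimes> inv (e c)" if "r \<in> ?I" "c \<in> ?I" for r c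
      using that he u unfolding inv unfolding h prod.case
      by (subst right) (auto simp: left ec u[folded M_def] intro!: M.m_closed simp del: rep_index.simps)
  qed
qed

end



section \<open>Standard automorphisms and the class function\<close>

definition class_fun :: "('a, 'r) ring_scheme \<Rightarrow> nat \<Rightarrow> isogeny \<Rightarrow> (nat list \<Rightarrow> nat list \<Rightarrow> 'a) \<Rightarrow> 'a" where
  "class_fun R n \<pi> x = zeval R (\<lambda>(r, c). x r c) (class_poly n \<pi>)"

lemma class_fun_map:
  assumes "cring R" "cring S" "h \<in> Ring.ring_hom R S" "x \<in> carrier (Mat R (rep_index n \<pi>))"
  shows "class_fun S n \<pi> (mat_map (rep_index n \<pi>) h x) = h (class_fun R n \<pi> x)"
proof -
  have v: "(case v of (r, c) \<Rightarrow> x r c) \<in> carrier R" if "v \<in> zvars (class_poly n \<pi>)" for v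
    using that zvars_class_poly[of n \<pi>] Mat_carrierD[OF assms(4)] by auto
  have "h (class_fun R n \<pi> x) = zeval S (\<lambda>v. h (case v of (r, c) \<Rightarrow> x r c)) (class_poly n \<pi>)"
    unfolding class_fun_def by (rule zeval_hom[OF assms(1-3) v])
  also have "\<dots> = class_fun S n \<pi> (mat_map (rep_index n \<pi>) h x)"
    unfolding class_fun_def using zvars_class_poly[of n \<pi>] by (intro zeval_cong) (auto simp: mat_map_def)
  finally show ?thesis ..
qed

lemma (in cring) class_fun_closed:
  assumes "x \<in> carrier (Mat R (rep_index n \<pi>))"
  shows "class_fun R n \<pi> x \<in> carrier R"
  unfolding class_fun_def using zvars_class_poly[of n \<pi>] Mat_carrierD[OF assms] by (auto intro!: zeval_closed)

text \<open>Invariance takes place over the extension \<open>S\<close>; it descends to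
  \<open>R\<close> because \<iota> is injective and commutes with evaluating integer
  polynomials.\<close>

lemma conj_over_class_fun:
  assumes R: "cring R" and ext: "involution_extension R \<theta> S \<theta>' \<iota>"
    and G: "carrier (E_grp R \<theta> n \<pi>) \<subseteq> carrier (Mat R (rep_index n \<pi>))"
    and conj: "is_conj_over R \<theta> n \<pi> S \<iota> g \<phi>"
    and inv: "\<And>u. u \<in> carrier (Mat S (rep_index n \<pi>)) \<Longrightarrow>
      class_fun S n \<pi> (g \<otimes>\<^bsub>Mat S (rep_index n \<pi>)\<^esub> u \<otimes>\<^bsub>Mat S (rep_index n \<pi>)\<^esub> inv\<^bsub>Mat S (rep_index n \<pi>)\<^esub> g) = class_fun S n \<pi> u"
    and x: "x \<in> carrier (E_grp R \<theta> n \<pi>)" "\<phi> x \<in> carrier (E_grp R \<theta> n \<pi>)"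
  shows "class_fun R n \<pi> (\<phi> x) = class_fun R n \<pi> x"
proof -
  let ?I = "rep_index n \<pi>"
  interpret R: cring R by fact
  have S: "cring S" "\<iota> \<in> Ring.ring_hom R S" "inj_on \<iota> (carrier R)"
    using ext by (auto simp: involution_extension_def)
  have xM: "x \<in> carrier (Mat R ?I)" "\<phi> x \<in> carrier (Mat R ?I)" using x G by auto
  have "\<iota> (class_fun R n \<pi> (\<phi> x)) = class_fun S n \<pi> (mat_map ?I \<iota> (\<phi> x))"
    by (rule class_fun_map[OF R S(1,2) xM(2), symmetric])
  also have "\<dots> = class_fun S n \<pi> (mat_map ?I \<iota> x)"
    using conj x(1) inv[OF mat_map_closed[OF S(2) xM(1)]] by (simp add: is_conj_over_def Let_def)
  also have "\<dots> = \<iota> (class_fun R n \<pi> x)"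
    by (rule class_fun_map[OF R S(1,2) xM(1)])
  finally show ?thesis
    using S(3) R.class_fun_closed xM by (auto dest: inj_onD)
qed

text \<open>Central automorphisms fix these elements, and commutators are among them.\<close>

definition center_kernel :: "('g, 'x) monoid_scheme \<Rightarrow> 'g set" where
  "center_kernel G =
    {x \<in> carrier G. \<forall>z\<in>hom G (G\<lparr>carrier := group_center G\<rparr>). z x = \<one>\<^bsub>G\<^esub>}"

text \<open>Precomposing a homomorphism to the center with \<phi> gives another one. This lets the
  factors of a composition be applied in succession.\<close>

lemma center_kernel_auto:
  assumes "\<phi> \<in> auto G" "x \<in> center_kernel G"
  shows "\<phi> x \<in> center_kernel G"
proof -
  have \<phi>: "\<phi> \<in> hom G G" using assms(1) by (simp add: auto_def)
  have "\<phi> x \<in> carrier G" using \<phi> assms(2) by (auto simp: center_kernel_def hom_def)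
  moreover have "z (\<phi> x) = \<one>\<^bsub>G\<^esub>" if "z \<in> hom G (G\<lparr>carrier := group_center G\<rparr>)" for z
  proof -
    have "(\<lambda>y. z (\<phi> y)) \<in> hom G (G\<lparr>carrier := group_center G\<rparr>)"
      using \<phi> that by (auto simp: hom_def Pi_iff)
    then show ?thesis using assms(2) by (auto simp: center_kernel_def)
  qed
  ultimately show ?thesis by (simp add: center_kernel_def)
qed

text \<open>The image of such a homomorphism is central, hence commutative. Inverses are given by
  the equations they satisfy, the form supplied by explicit words.\<close>

lemma commutator_in_center_kernel:
  fixes G (structure)
  assumes "group G" "u \<in> carrier G" "v \<in> carrier G" "u' \<in> carrier G" "v' \<in> carrier G"
    and "u \<otimes>\<^bsub>G\<^esub> u' = \<one>\<^bsub>G\<^esub>" "v \<otimes>\<^bsub>G\<^esub> v' = \<one>\<^bsub>G\<^esub>"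
  shows "u \<otimes>\<^bsub>G\<^esub> v \<otimes>\<^bsub>G\<^esub> u' \<otimes>\<^bsub>G\<^esub> v' \<in> center_kernel G"
proof -
  interpret group G by fact
  have "z (u \<otimes> v \<otimes> u' \<otimes> v') = \<one>" if z: "z \<in> hom G (G\<lparr>carrier := group_center G\<rparr>)" for z
  proof -
    have c: "z a \<in> carrier G" "z a \<otimes> b = b \<otimes> z a" if "a \<in> carrier G" "b \<in> carrier G" for a b
      using z that by (auto simp: hom_def group_center_def Pi_iff)
    have m: "z (a \<otimes> b) = z a \<otimes> z b" if "a \<in> carrier G" "b \<in> carrier G" for a b
      using z that by (auto simp: hom_def)
    have "z \<one> \<otimes> z \<one> = z \<one>" using m[of \<one> \<one>] by simp
    then have z1: "z \<one> = \<one>" using c[of \<one> \<one>] by (metis l_cancel_one one_closed)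
    have "z (u \<otimes> v \<otimes> u' \<otimes> v') = z u \<otimes> (z v \<otimes> z u') \<otimes> z v'"
      using assms(2-5) c(1) by (simp add: m m_assoc)
    also have "\<dots> = (z u \<otimes> z u') \<otimes> (z v \<otimes> z v')"
      using assms c(1) by (simp add: c(2)[of v "z u'"] m_assoc)
    also have "\<dots> = \<one>"
      using assms by (simp add: z1 flip: m)
    finally show ?thesis .
  qed
  then show ?thesis using assms by (simp add: center_kernel_def)
qed

lemma standard_aut_class_fun:
  fixes R :: "'a ring"
  assumes R: "cring R" and n: "n = 3 \<or> (n = 4 \<and> \<pi> \<noteq> MID)"
    and grp: "group (E_grp R \<theta> n \<pi>)"
    and G: "carrier (E_grp R \<theta> n \<pi>) \<subseteq> carrier (Mat R (rep_index n \<pi>))"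
    and \<phi>: "\<phi> \<in> standard_auts TYPE('b) R \<theta> n \<pi>"
  shows "\<exists>\<mu>\<in>Ring.ring_hom R R. \<forall>x\<in>center_kernel (E_grp R \<theta> n \<pi>). class_fun R n \<pi> (\<phi> x) = \<mu> (class_fun R n \<pi> x)"
proof -
  let ?E = "E_grp R \<theta> n \<pi>"
  let ?K = "center_kernel ?E" and ?f = "class_fun R n \<pi>"
  have KE: "x \<in> carrier ?E" if "x \<in> ?K" for x using that by (simp add: center_kernel_def)
  have id: "(\<lambda>x. x) \<in> Ring.ring_hom R R" by (rule ring_hom_memI) auto
  define F where "F = inner_auts TYPE('b) R \<theta> n \<pi> \<union> diagonal_auts TYPE('b) R \<theta> n \<pi> \<union> ring_auts R \<theta> n \<pi> \<union>
       central_auts ?E"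
  have factor: "(\<forall>x\<in>?K. f x \<in> ?K) \<and> (\<exists>\<mu>\<in>Ring.ring_hom R R. \<forall>x\<in>?K. ?f (f x) = \<mu> (?f x))" if "f \<in> F" for f
  proof -
    have auto: "f \<in> auto ?E"
      using that by (auto simp: F_def inner_auts_def diagonal_auts_def ring_auts_def central_auts_def)
    then have K: "f x \<in> ?K" if "x \<in> ?K" for x using that by (rule center_kernel_auto)
    from that consider "f \<in> inner_auts TYPE('b) R \<theta> n \<pi>" | "f \<in> diagonal_auts TYPE('b) R \<theta> n \<pi>"
      | "f \<in> ring_auts R \<theta> n \<pi>" | "f \<in> central_auts ?E"
      by (auto simp: F_def)
    then have "\<exists>\<mu>\<in>Ring.ring_hom R R. \<forall>x\<in>?K. ?f (f x) = \<mu> (?f x)"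
    proof cases
      case 1
      then obtain S :: "'b ring" and \<theta>' \<iota> g where S: "involution_extension R \<theta> S \<theta>' \<iota>"
        "g \<in> twisted_group S \<theta>' n \<pi>" "is_conj_over R \<theta> n \<pi> S \<iota> g f"
        by (auto simp: inner_auts_def)
      interpret S: cring S using S(1) by (simp add: involution_extension_def)
      have "?f (f x) = ?f x" if "x \<in> ?K" for x
      proof (rule conj_over_class_fun[OF R S(1) G S(3) _ KE KE])
        show "class_fun S n \<pi> (g \<otimes>\<^bsub>Mat S (rep_index n \<pi>)\<^esub> u \<otimes>\<^bsub>Mat S (rep_index n \<pi>)\<^esub> inv\<^bsub>Mat S (rep_index n \<pi>)\<^esub> g) = class_fun S n \<pi> u"
          if "u \<in> carrier (Mat S (rep_index n \<pi>))" for u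
          unfolding class_fun_def by (rule S.chevalley_conj) (use n S(2) that in \<open>auto simp: twisted_group_def\<close>)
      qed (use that K in auto)
      then show ?thesis by (intro bexI[OF _ id]) simp
    next
      case 2
      then obtain S :: "'b ring" and \<theta>' \<iota> \<chi> where S: "involution_extension R \<theta> S \<theta>' \<iota>"
        "\<chi> \<in> Hom1 n (isogeny_lattice n \<pi>) S \<theta>'" "is_conj_over R \<theta> n \<pi> S \<iota> (torus_element S n \<pi> \<chi>) f"
        by (auto simp: diagonal_auts_def)
      interpret S: cring S using S(1) by (simp add: involution_extension_def)
      interpret torus_scaling S n \<pi> \<chi>
        by unfold_locales (use n S(2) in \<open>auto simp: Hom1_def\<close>)
      have "?f (f x) = ?f x" if "x \<in> ?K" for x
      proof (rule conj_over_class_fun[OF R S(1) G S(3) _ KE KE])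
        show "class_fun S n \<pi> (torus_element S n \<pi> \<chi> \<otimes>\<^bsub>Mat S (rep_index n \<pi>)\<^esub> u \<otimes>\<^bsub>Mat S (rep_index n \<pi>)\<^esub>
            inv\<^bsub>Mat S (rep_index n \<pi>)\<^esub> torus_element S n \<pi> \<chi>) = class_fun S n \<pi> u"
          if "u \<in> carrier (Mat S (rep_index n \<pi>))" for u
          unfolding class_fun_def by (rule torus_conj[OF that])
      qed (use that K in auto)
      then show ?thesis by (intro bexI[OF _ id]) simp
    next
      case 3
      then obtain \<mu> where \<mu>: "\<mu> \<in> ring_iso R R" "\<forall>x\<in>carrier ?E. f x = mat_map (rep_index n \<pi>) \<mu> x"
        by (auto simp: ring_auts_def)
      then have h: "\<mu> \<in> Ring.ring_hom R R" by (simp add: ring_iso_def)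
      have "?f (f x) = \<mu> (?f x)" if "x \<in> ?K" for x
        using class_fun_map[OF R R h] KE[OF that] G \<mu>(2) by auto
      then show ?thesis by (intro bexI[OF _ h]) simp
    next
      case 4
      then obtain z where z: "z \<in> hom ?E (?E\<lparr>carrier := group_center ?E\<rparr>)" "\<forall>x\<in>carrier ?E. f x = x \<otimes>\<^bsub>?E\<^esub> z x"
        by (auto simp: central_auts_def)
      have "f x = x" if "x \<in> ?K" for x
        using that z group.is_monoid[OF grp] by (auto simp: center_kernel_def monoid.r_one)
      then show ?thesis by (intro bexI[OF _ id]) simp
    qed
    with K show ?thesis by blast
  qed
  \<comment> \<open>The induction keeps stability of the kernel beside the identity for the class
    function, since the outer factor is applied to the image under the inner one. The ring maps of
    the factors compose accordingly.\<close>
  have "(\<forall>x\<in>?K. f x \<in> ?K) \<and> (\<exists>\<mu>\<in>Ring.ring_hom R R. \<forall>x\<in>?K. ?f (f x) = \<mu> (?f x))"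
    if "f \<in> compositions (carrier ?E) F" for f
    using that
  proof induction
    case (single f)
    then show ?case by (rule factor)
  next
    case (comp f g)
    obtain \<mu> where \<mu>: "\<mu> \<in> Ring.ring_hom R R" "\<forall>x\<in>?K. ?f (f x) = \<mu> (?f x)" and f: "\<forall>x\<in>?K. f x \<in> ?K"
      using factor[OF comp(1)] by blast
    obtain \<nu> where \<nu>: "\<nu> \<in> Ring.ring_hom R R" "\<forall>x\<in>?K. ?f (g x) = \<nu> (?f x)" and g: "\<forall>x\<in>?K. g x \<in> ?K"
      using comp.IH by blast
    have fg: "compose (carrier ?E) f g x = f (g x)" if "x \<in> ?K" for x
      using KE[OF that] by (simp add: compose_def)
    have "\<mu> \<circ> \<nu> \<in> Ring.ring_hom R R" using ring_hom_trans[OF \<nu>(1) \<mu>(1)] .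
    moreover have "?f (compose (carrier ?E) f g x) = (\<mu> \<circ> \<nu>) (?f x)" if "x \<in> ?K" for x
      using that \<mu>(2) \<nu>(2) g by (simp add: fg)
    ultimately show ?case using f g fg by (intro conjI ballI bexI[of _ "\<mu> \<circ> \<nu>"]) simp_all
  qed
  with \<phi> show ?thesis by (simp add: standard_auts_def F_def)
qed

section \<open>The elementary groups\<close>

text \<open>\<open>E_sc\<close> keeps the operations of \<open>Mat\<close>, while
  \<open>generate\<close> works in the group of units; both give the same structure on the generated
  set.\<close>

lemma units_of_carrier_update: "(units_of (Mat R I))\<lparr>carrier := H\<rparr> = (Mat R I)\<lparr>carrier := H\<rparr>"
  by (simp add: units_of_def Mat_def)

locale elementary_group = cring R for R :: "'a ring" (structure) +
  fixes \<theta> :: "'a \<Rightarrow> 'a" and n :: nat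
  assumes root_Units: "root_elements R \<theta> n \<subseteq> Units (Mat R {1..n+1})"
begin

abbreviation "M \<equiv> Mat R {1..n+1}"

sublocale M: Group.monoid M by (rule monoid_Mat) simp

lemma subgroup_E: "subgroup (generate (units_of M) (root_elements R \<theta> n)) (units_of M)"
  by (rule group.generate_is_subgroup[OF M.units_group]) (use root_Units in \<open>simp add: units_of_carrier\<close>)

lemma carrier_E_sc: "carrier (E_sc R \<theta> n) = generate (units_of M) (root_elements R \<theta> n)"
  by (simp add: E_sc_def)

lemma mult_E_sc [simp]: "x \<otimes>\<^bsub>E_sc R \<theta> n\<^esub> y = x \<otimes>\<^bsub>M\<^esub> y" and one_E_sc [simp]: "\<one>\<^bsub>E_sc R \<theta> n\<^esub> = \<one>\<^bsub>M\<^esub>"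
  by (simp_all add: E_sc_def)

lemma group_E_sc: "group (E_sc R \<theta> n)"
  using subgroup.subgroup_is_group[OF subgroup_E M.units_group]
  by (simp add: E_sc_def units_of_carrier_update)

lemma E_sc_Units: "x \<in> carrier (E_sc R \<theta> n) \<Longrightarrow> x \<in> Units M"
  using subgroup.subset[OF subgroup_E] by (auto simp: carrier_E_sc units_of_carrier)

lemma root_in_E_sc: "x \<in> root_elements R \<theta> n \<Longrightarrow> x \<in> carrier (E_sc R \<theta> n)"
  by (simp add: carrier_E_sc generate.incl)

lemma inv_E_sc:
  assumes "x \<in> carrier (E_sc R \<theta> n)"
  shows "inv\<^bsub>E_sc R \<theta> n\<^esub> x = inv\<^bsub>M\<^esub> x" "inv\<^bsub>M\<^esub> x \<in> carrier (E_sc R \<theta> n)"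
proof -
  interpret E: group "E_sc R \<theta> n" by (rule group_E_sc)
  have c: "inv\<^bsub>E_sc R \<theta> n\<^esub> x \<in> carrier M" using E_sc_Units[OF E.inv_closed[OF assms]] M.Units_closed by blast
  have "inv\<^bsub>E_sc R \<theta> n\<^esub> x = inv\<^bsub>M\<^esub> x"
    using E.r_inv[OF assms] E.l_inv[OF assms] c M.Units_closed[OF E_sc_Units[OF assms]]
    by (intro M.inv_unique') auto
  then show "inv\<^bsub>E_sc R \<theta> n\<^esub> x = inv\<^bsub>M\<^esub> x" "inv\<^bsub>M\<^esub> x \<in> carrier (E_sc R \<theta> n)"
    using E.inv_closed[OF assms] by simp_all
qed

lemma mult_E_grp [simp]: "x \<otimes>\<^bsub>E_grp R \<theta> n \<pi>\<^esub> y = x \<otimes>\<^bsub>Mat R (rep_index n \<pi>)\<^esub> y"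
  and one_E_grp [simp]: "\<one>\<^bsub>E_grp R \<theta> n \<pi>\<^esub> = \<one>\<^bsub>Mat R (rep_index n \<pi>)\<^esub>"
  and carrier_E_grp: "carrier (E_grp R \<theta> n \<pi>) = rep R n \<pi> ` carrier (E_sc R \<theta> n)"
  by (simp_all add: E_grp_def)

lemma rep_mult_E_sc:
  "x \<in> carrier (E_sc R \<theta> n) \<Longrightarrow> y \<in> carrier (E_sc R \<theta> n) \<Longrightarrow>
    rep R n \<pi> x \<otimes>\<^bsub>Mat R (rep_index n \<pi>)\<^esub> rep R n \<pi> y = rep R n \<pi> (x \<otimes>\<^bsub>M\<^esub> y)"
  by (simp add: rep_mult E_sc_Units)

lemma E_grp_subset: "carrier (E_grp R \<theta> n \<pi>) \<subseteq> carrier (Mat R (rep_index n \<pi>))"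
  by (auto simp: carrier_E_grp intro: rep_closed E_sc_Units)

lemma group_E_grp: "group (E_grp R \<theta> n \<pi>)"
proof (rule groupI)
  interpret E: group "E_sc R \<theta> n" by (rule group_E_sc)
  interpret I: Group.monoid "Mat R (rep_index n \<pi>)" by (rule monoid_Mat) simp
  note c = subsetD[OF E_grp_subset]
  show "\<one>\<^bsub>E_grp R \<theta> n \<pi>\<^esub> \<in> carrier (E_grp R \<theta> n \<pi>)"
    using E.one_closed rep_one[of n \<pi>] by (force simp: carrier_E_grp)
  fix x assume x: "x \<in> carrier (E_grp R \<theta> n \<pi>)"
  then show "\<one>\<^bsub>E_grp R \<theta> n \<pi>\<^esub> \<otimes>\<^bsub>E_grp R \<theta> n \<pi>\<^esub> x = x" using c by simp
  obtain a where a: "x = rep R n \<pi> a" "a \<in> carrier (E_sc R \<theta> n)" using x by (auto simp: carrier_E_grp)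
  have "rep R n \<pi> (inv\<^bsub>M\<^esub> a) \<otimes>\<^bsub>Mat R (rep_index n \<pi>)\<^esub> x = \<one>\<^bsub>Mat R (rep_index n \<pi>)\<^esub>"
    using a inv_E_sc(2)[OF a(2)] E_sc_Units[OF a(2)] by (simp add: rep_mult_E_sc rep_one)
  then show "\<exists>y\<in>carrier (E_grp R \<theta> n \<pi>). y \<otimes>\<^bsub>E_grp R \<theta> n \<pi>\<^esub> x = \<one>\<^bsub>E_grp R \<theta> n \<pi>\<^esub>"
    using inv_E_sc(2)[OF a(2)] by (auto simp: carrier_E_grp)
  fix y assume y: "y \<in> carrier (E_grp R \<theta> n \<pi>)"
  then obtain b where b: "y = rep R n \<pi> b" "b \<in> carrier (E_sc R \<theta> n)" by (auto simp: carrier_E_grp)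
  show "x \<otimes>\<^bsub>E_grp R \<theta> n \<pi>\<^esub> y \<in> carrier (E_grp R \<theta> n \<pi>)"
    using E.m_closed[OF a(2) b(2)] by (auto simp: a b rep_mult_E_sc carrier_E_grp)
  fix z assume "z \<in> carrier (E_grp R \<theta> n \<pi>)"
  then show "x \<otimes>\<^bsub>E_grp R \<theta> n \<pi>\<^esub> y \<otimes>\<^bsub>E_grp R \<theta> n \<pi>\<^esub> z = x \<otimes>\<^bsub>E_grp R \<theta> n \<pi>\<^esub> (y \<otimes>\<^bsub>E_grp R \<theta> n \<pi>\<^esub> z)"
    using x y c by (simp add: I.m_assoc)
qed

lemma auto_fixing_roots:
  assumes "\<Phi> \<in> auto (E_sc R \<theta> n)" "\<And>x. x \<in> root_elements R \<theta> n \<Longrightarrow> \<Phi> x = x" "x \<in> carrier (E_sc R \<theta> n)"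
  shows "\<Phi> x = x"
proof -
  interpret E: group "E_sc R \<theta> n" by (rule group_E_sc)
  interpret h: group_hom "E_sc R \<theta> n" "E_sc R \<theta> n" \<Phi>
    by unfold_locales (use assms(1) in \<open>simp add: auto_def\<close>)
  have "x \<in> generate (units_of M) (root_elements R \<theta> n)" using assms(3) by (simp add: carrier_E_sc)
  then show ?thesis
  proof induction
    case one
    then show ?case using h.hom_one by (simp add: units_of_one)
  next
    case (incl r)
    then show ?case by (rule assms(2))
  next
    case (inv r)
    then have "inv\<^bsub>units_of M\<^esub> r = inv\<^bsub>E_sc R \<theta> n\<^esub> r"
      using root_Units inv_E_sc(1)[OF root_in_E_sc] by (auto simp: M.units_of_inv)
    then show ?case using h.hom_inv[OF root_in_E_sc[OF inv]] assms(2)[OF inv] by simp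
  next
    case (eng a b)
    then have "a \<in> carrier (E_sc R \<theta> n)" "b \<in> carrier (E_sc R \<theta> n)" by (simp_all add: carrier_E_sc)
    from h.hom_mult[OF this] eng show ?case by (simp add: units_of_mult)
  qed
qed

end

section \<open>Matrices given by lists\<close>

text \<open>Rows as lists permit products to be found by evaluation. List positions start at 0,
  matrix indices at 1.\<close>

definition lmat :: "nat \<Rightarrow> 'a list list \<Rightarrow> nat \<Rightarrow> nat \<Rightarrow> 'a" where
  "lmat m L = (\<lambda>i\<in>{1..m}. \<lambda>j\<in>{1..m}. L ! (i - 1) ! (j - 1))"

definition lmul :: "('a, 'r) ring_scheme \<Rightarrow> nat \<Rightarrow> 'a list list \<Rightarrow> 'a list list \<Rightarrow> 'a list list" where
  "lmul R m K L =
    map (\<lambda>i. map (\<lambda>j. foldr (\<lambda>k s. K ! i ! k \<otimes>\<^bsub>R\<^esub> L ! k ! j \<oplus>\<^bsub>R\<^esub> s) [0..<m] \<zero>\<^bsub>R\<^esub>) [0..<m]) [0..<m]"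

definition llin :: "('a, 'r) ring_scheme \<Rightarrow> nat \<Rightarrow> ('a \<times> nat \<times> nat) list \<Rightarrow> 'a list list" where
  "llin R m xs =
    map (\<lambda>i. map (\<lambda>j. foldr (\<lambda>(a, k, l) s. if k = i \<and> l = j then a \<oplus>\<^bsub>R\<^esub> s else s) xs \<zero>\<^bsub>R\<^esub>) [1..<m+1]) [1..<m+1]"

definition is_lmat :: "('a, 'r) ring_scheme \<Rightarrow> nat \<Rightarrow> 'a list list \<Rightarrow> bool" where
  "is_lmat R m L \<longleftrightarrow> length L = m \<and> (\<forall>l\<in>set L. length l = m \<and> set l \<subseteq> carrier R)"

lemma lmat_carrier:
  assumes "is_lmat R m L"
  shows "lmat m L \<in> carrier (Mat R {1..m})"
  unfolding lmat_def
proof (rule Mat_carrierI)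
  fix i j assume "i \<in> {1..m}" "j \<in> {1..m}"
  then have "i - 1 < length L" "j - 1 < m" using assms by (auto simp: is_lmat_def)
  moreover from this have "length (L ! (i - 1)) = m" "set (L ! (i - 1)) \<subseteq> carrier R"
    using assms nth_mem[of "i - 1" L] by (simp_all add: is_lmat_def)
  ultimately show "L ! (i - 1) ! (j - 1) \<in> carrier R"
    using nth_mem[of "j - 1" "L ! (i - 1)"] by (simp add: subset_iff)
qed

lemma lin_lmat: "lin R m xs = lmat m (llin R m xs)"
proof (rule ext)+
  fix i j
  show "lin R m xs i j = lmat m (llin R m xs) i j"
  proof (cases "i \<in> {1..m} \<and> j \<in> {1..m}")
    case True
    then have "[1..<m+1] ! (i - 1) = i" "[1..<m+1] ! (j - 1) = j" "i - 1 < m" "j - 1 < m"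
      by (auto simp: nth_upt)
    then show ?thesis using True by (simp add: lin_def lmat_def llin_def del: upt_Suc)
  qed (auto simp: lin_def lmat_def)
qed

lemma lmat_one: "\<one>\<^bsub>Mat R {1..m}\<^esub> = lmat m (map (\<lambda>i. map (\<lambda>j. if i = j then \<one>\<^bsub>R\<^esub> else \<zero>\<^bsub>R\<^esub>) [0..<m]) [0..<m])"
proof (rule ext)+
  fix i j
  show "\<one>\<^bsub>Mat R {1..m}\<^esub> i j = lmat m (map (\<lambda>i. map (\<lambda>j. if i = j then \<one>\<^bsub>R\<^esub> else \<zero>\<^bsub>R\<^esub>) [0..<m]) [0..<m]) i j"
  proof (cases "i \<in> {1..m} \<and> j \<in> {1..m}")
    case True
    then have "i - 1 < m" "j - 1 < m" "i - 1 = j - 1 \<longleftrightarrow> i = j" by auto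
    then show ?thesis using True by (simp add: Mat_def lmat_def)
  qed (auto simp: Mat_def lmat_def)
qed

lemma (in cring) lmat_mult:
  assumes "is_lmat R m K" "is_lmat R m L"
  shows "lmat m K \<otimes>\<^bsub>Mat R {1..m}\<^esub> lmat m L = lmat m (lmul R m K L)"
proof (rule ext)+
  fix i j
  note c = assms[THEN lmat_carrier, THEN Mat_carrierD]
  show "(lmat m K \<otimes>\<^bsub>Mat R {1..m}\<^esub> lmat m L) i j = lmat m (lmul R m K L) i j"
  proof (cases "i \<in> {1..m} \<and> j \<in> {1..m}")
    case True
    have fs: "finsum R f (Suc ` set ks) = foldr (\<lambda>k s. f (Suc k) \<oplus> s) ks \<zero>"
      if "distinct ks" "f \<in> Suc ` set ks \<rightarrow> carrier R" for f and ks :: "nat list"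
      using that
    proof (induction ks)
      case (Cons k ks)
      then have "finsum R f (insert (Suc k) (Suc ` set ks)) = f (Suc k) \<oplus> finsum R f (Suc ` set ks)"
        by (intro finsum_insert) (auto simp: Pi_iff)
      then show ?case using Cons by simp
    qed simp
    have J: "{1..m} = Suc ` set [0..<m]" by (auto simp: image_Suc_atLeastLessThan One_nat_def)
    have "(lmat m K \<otimes>\<^bsub>Mat R {1..m}\<^esub> lmat m L) i j = (\<Oplus>k\<in>{1..m}. lmat m K i k \<otimes> lmat m L k j)"
      using True by (intro Mat_mult_entry) auto
    also have "\<dots> = foldr (\<lambda>k s. lmat m K i (Suc k) \<otimes> lmat m L (Suc k) j \<oplus> s) [0..<m] \<zero>"
      unfolding J by (rule fs) (use True c in \<open>auto simp: One_nat_def\<close>)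
    also have "\<dots> = foldr (\<lambda>k s. K ! (i - 1) ! k \<otimes> L ! k ! (j - 1) \<oplus> s) [0..<m] \<zero>"
      by (rule foldr_cong) (use True in \<open>auto simp: lmat_def One_nat_def\<close>)
    also have "\<dots> = lmat m (lmul R m K L) i j"
    proof -
      have "i - 1 < m" "j - 1 < m" using True by auto
      then show ?thesis using True by (simp add: lmat_def lmul_def)
    qed
    finally show ?thesis .
  qed (auto simp: Mat_def lmat_def)
qed



section \<open>Root elements are invertible\<close>

lemma (in cring) lmat_Units:
  assumes "is_lmat R m K" "is_lmat R m L"
    and "lmat m (lmul R m K L) = \<one>\<^bsub>Mat R {1..m}\<^esub>" "lmat m (lmul R m L K) = \<one>\<^bsub>Mat R {1..m}\<^esub>"
  shows "lmat m K \<in> Units (Mat R {1..m})"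
  using assms(1,2)[THEN lmat_carrier] assms(3,4) lmat_mult[OF assms(1,2)] lmat_mult[OF assms(2,1)]
  by (auto simp: Units_def)

text \<open>The inverses are explicit: negate the parameter, or replace \<open>(t, u)\<close> by
  \<open>(- t, \<theta> u)\<close> in the two-parameter case, where
  \<open>t * \<theta> t = u + \<theta> u\<close> makes the corner entry cancel.\<close>

lemma (in cring) root_elements_Units:
  assumes \<theta>: "ring_involution R \<theta>" and n: "n = 3 \<or> n = 4"
  shows "root_elements R \<theta> n \<subseteq> Units (Mat R {1..n+1})"
proof -
  have h: "\<theta> \<in> Ring.ring_hom R R" using \<theta> by (simp add: ring_involution_def ring_iso_def)
  interpret h: ring_hom_cring R R \<theta> by unfold_locales (fact h)
  have tt: "\<theta> (\<theta> r) = r" if "r \<in> carrier R" for r using \<theta> that by (simp add: ring_involution_def)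
  have upt: "[0..<4] = [0, 1, 2, 3]" "[0..<5] = [0, 1, 2, 3, 4::nat]"
    "[1..<4 + 1] = [1, 2, 3, 4]" "[1..<5 + 1] = [1, 2, 3, 4, 5::nat]" "[1..<Suc 4] = [1, 2, 3, 4]" "[1..<Suc 5] = [1, 2, 3, 4, 5::nat]"
    "[1..<5] = [1, 2, 3, 4::nat]" "[1..<6] = [1, 2, 3, 4, 5::nat]"
    by (simp_all add: upt_rec One_nat_def)
  note ev = llin_def lmul_def idm_def cf_def upt is_lmat_def lmat_one nth_Cons' x2_4_list_def xm2_4_list_def
  have num: "3 + 1 = (4::nat)" "4 + 1 = (5::nat)" by simp_all
  have x1_3: "x1 R \<theta> 3 t \<in> Units (Mat R {1..4})" if t: "t \<in> carrier R" for t
    unfolding x1_def lin_lmat num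
    by (rule lmat_Units[where L = "llin R 4 (idm R 4 @ [(\<ominus> t, 1, 2), (\<theta> (\<ominus> t), 3, 4)])"])
       (use t in \<open>simp_all add: ev r_neg l_neg\<close>)
  have xm1_3: "xm1 R \<theta> 3 t \<in> Units (Mat R {1..4})" if t: "t \<in> carrier R" for t
    unfolding xm1_def lin_lmat num
    by (rule lmat_Units[where L = "llin R 4 (idm R 4 @ [(\<ominus> t, 2, 1), (\<theta> (\<ominus> t), 4, 3)])"])
       (use t in \<open>simp_all add: ev r_neg l_neg\<close>)
  have x2_3: "x2_3 R s \<in> Units (Mat R {1..4})" if s: "s \<in> carrier R" for s
    unfolding x2_3_def lin_lmat num
    by (rule lmat_Units[where L = "llin R 4 (idm R 4 @ [(\<ominus> s, 2, 3)])"])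
       (use s in \<open>simp_all add: ev r_neg l_neg\<close>)
  have xm2_3: "xm2_3 R s \<in> Units (Mat R {1..4})" if s: "s \<in> carrier R" for s
    unfolding xm2_3_def lin_lmat num
    by (rule lmat_Units[where L = "llin R 4 (idm R 4 @ [(\<ominus> s, 3, 2)])"])
       (use s in \<open>simp_all add: ev r_neg l_neg\<close>)
  have x1_4: "x1 R \<theta> 4 t \<in> Units (Mat R {1..5})" if t: "t \<in> carrier R" for t
    unfolding x1_def lin_lmat num
    by (rule lmat_Units[where L = "llin R 5 (idm R 5 @ [(\<ominus> t, 1, 2), (\<theta> (\<ominus> t), 4, 5)])"])
       (use t in \<open>simp_all add: ev r_neg l_neg\<close>)
  have xm1_4: "xm1 R \<theta> 4 t \<in> Units (Mat R {1..5})" if t: "t \<in> carrier R" for t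
    unfolding xm1_def lin_lmat num
    by (rule lmat_Units[where L = "llin R 5 (idm R 5 @ [(\<ominus> t, 2, 1), (\<theta> (\<ominus> t), 5, 4)])"])
       (use t in \<open>simp_all add: ev r_neg l_neg\<close>)
  have x2_4: "lin R 5 (x2_4_list R \<theta> t u) \<in> Units (Mat R {1..5})" "lin R 5 (xm2_4_list R \<theta> t u) \<in> Units (Mat R {1..5})"
    if "(t, u) \<in> param_A R \<theta>" for t u
  proof -
    have tu: "t \<in> carrier R" "u \<in> carrier R" "t \<otimes> \<theta> t = u \<oplus> \<theta> u"
      using that by (auto simp: param_A_def)
    \<comment> \<open>The corner entries of the two products with the proposed inverse, in the order
      in which \<open>lmul\<close> adds the summands.\<close>
    have e: "\<theta> u \<oplus> (\<ominus> (u \<oplus> \<theta> u) \<oplus> u) = \<zero>" "u \<oplus> (\<ominus> (u \<oplus> \<theta> u) \<oplus> \<theta> u) = \<zero>"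
    proof -
      have "\<theta> u \<oplus> (\<ominus> w \<oplus> u) = (u \<oplus> \<theta> u) \<oplus> \<ominus> w" "u \<oplus> (\<ominus> w \<oplus> \<theta> u) = (u \<oplus> \<theta> u) \<oplus> \<ominus> w"
        if "w \<in> carrier R" for w
        using tu(1,2) that by (simp_all add: a_ac)
      then show "\<theta> u \<oplus> (\<ominus> (u \<oplus> \<theta> u) \<oplus> u) = \<zero>" "u \<oplus> (\<ominus> (u \<oplus> \<theta> u) \<oplus> \<theta> u) = \<zero>"
        using tu(1,2) by (simp_all add: r_neg)
    qed
    have tu': "t \<otimes> \<theta> t = u \<oplus> \<theta> u" "\<theta> t \<otimes> t = u \<oplus> \<theta> u"
      using tu by (simp_all add: m_comm)
    show "lin R 5 (x2_4_list R \<theta> t u) \<in> Units (Mat R {1..5})"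
      unfolding lin_lmat
      by (rule lmat_Units[where L = "llin R 5 (x2_4_list R \<theta> (\<ominus> t) (\<theta> u))"])
         (use tu(1,2) in \<open>simp_all add: ev r_neg l_neg l_minus r_minus e tu'\<close>)
    show "lin R 5 (xm2_4_list R \<theta> t u) \<in> Units (Mat R {1..5})"
      unfolding lin_lmat
      by (rule lmat_Units[where L = "llin R 5 (xm2_4_list R \<theta> (\<ominus> t) (\<theta> u))"])
         (use tu(1,2) in \<open>simp_all add: ev r_neg l_neg l_minus r_minus e tu'\<close>)
  qed
  show ?thesis
    using n x1_3 xm1_3 x2_3 xm2_3 x1_4 xm1_4 x2_4 by (auto simp: root_elements_def sym_part_def)
qed

section \<open>Dual numbers\<close>

text \<open>\<open>Dual a b\<close> is \<open>a + b e\<close> with \<open>e\<close> of square zero;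
  \<open>e\<close> models \<delta>.\<close>

datatype dual = Dual int int

instantiation dual :: comm_ring_1
begin

fun plus_dual :: "dual \<Rightarrow> dual \<Rightarrow> dual" where
  "Dual a b + Dual c d = Dual (a + c) (b + d)"
fun minus_dual :: "dual \<Rightarrow> dual \<Rightarrow> dual" where
  "Dual a b - Dual c d = Dual (a - c) (b - d)"
fun times_dual :: "dual \<Rightarrow> dual \<Rightarrow> dual" where
  "Dual a b * Dual c d = Dual (a * c) (a * d + b * c)"
fun uminus_dual :: "dual \<Rightarrow> dual" where
  "- Dual a b = Dual (- a) (- b)"
definition zero_dual :: dual where "0 = Dual 0 0"
definition one_dual :: dual where "1 = Dual 1 0"

instance
proof
  fix a b c :: dual
  show "a + b + c = a + (b + c)" "a + b = b + a" "0 + a = a" "- a + a = 0" "a - b = a + - b"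
    "a * b * c = a * (b * c)" "a * b = b * a" "1 * a = a" "(a + b) * c = a * c + b * c"
    by (cases a; cases b; cases c; simp add: zero_dual_def one_dual_def algebra_simps)+
  show "(0 :: dual) \<noteq> 1" by (simp add: zero_dual_def one_dual_def)
qed

end

definition dual_embed :: "('a, 'r) ring_scheme \<Rightarrow> 'a \<Rightarrow> dual \<Rightarrow> 'a" where
  "dual_embed R \<delta> x = (case x of Dual a b \<Rightarrow> int_embed R a \<oplus>\<^bsub>R\<^esub> int_embed R b \<otimes>\<^bsub>R\<^esub> \<delta>)"

context cring
begin

lemma int_embed_ring_hom: "ring_hom_cring class_ring R (int_embed R)"
  using int_embed_hom[OF is_cring] class_ring.is_cring is_cring
  by (simp add: ring_hom_cring_def ring_hom_cring_axioms_def)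

lemma int_embed_closed [simp]: "int_embed R k \<in> carrier R"
  by (rule ring_hom_closed[OF int_embed_hom[OF is_cring]]) simp

lemma int_embed_simps:
  "int_embed R 0 = \<zero>" "int_embed R 1 = \<one>" "int_embed R (a + b) = int_embed R a \<oplus> int_embed R b"
  "int_embed R (a * b) = int_embed R a \<otimes> int_embed R b" "int_embed R (- a) = \<ominus> int_embed R a"
proof -
  interpret h: ring_hom_cring class_ring R "int_embed R" by (rule int_embed_ring_hom)
  show "int_embed R 0 = \<zero>" "int_embed R 1 = \<one>" "int_embed R (a + b) = int_embed R a \<oplus> int_embed R b"
    "int_embed R (a * b) = int_embed R a \<otimes> int_embed R b" "int_embed R (- a) = \<ominus> int_embed R a"
    using h.hom_zero h.hom_one h.hom_add[of a b] h.hom_mult[of a b] h.hom_a_inv[of a] by simp_all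
qed

text \<open>Multiplicativity is exactly where the vanishing of the square of \<delta>
  enters.\<close>

lemma dual_embed_hom:
  assumes "\<delta> \<in> carrier R" "\<delta> \<otimes> \<delta> = \<zero>"
  shows "dual_embed R \<delta> \<in> Ring.ring_hom class_ring R"
proof (rule ring_hom_memI)
  fix x y :: dual
  obtain a b c d where xy: "x = Dual a b" "y = Dual c d" by (cases x; cases y) auto
  show "dual_embed R \<delta> x \<in> carrier R" using assms by (simp add: xy dual_embed_def)
  show "dual_embed R \<delta> (x \<oplus>\<^bsub>class_ring\<^esub> y) = dual_embed R \<delta> x \<oplus> dual_embed R \<delta> y"
    using assms by (simp add: xy dual_embed_def int_embed_simps l_distr a_ac)
  have "int_embed R b \<otimes> \<delta> \<otimes> (int_embed R d \<otimes> \<delta>) = int_embed R b \<otimes> int_embed R d \<otimes> (\<delta> \<otimes> \<delta>)"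
    using assms(1) by (simp add: m_ac)
  also have "\<dots> = \<zero>" using assms by simp
  finally show "dual_embed R \<delta> (x \<otimes>\<^bsub>class_ring\<^esub> y) = dual_embed R \<delta> x \<otimes> dual_embed R \<delta> y"
    using assms(1) by (simp add: xy dual_embed_def int_embed_simps l_distr r_distr) (simp add: a_ac m_ac)
qed (use assms in \<open>simp add: dual_embed_def one_dual_def int_embed_simps\<close>)

end

lemma hom_int_embed:
  assumes "cring R" "cring S" "h \<in> Ring.ring_hom R S"
  shows "h (int_embed R k) = int_embed S k"
proof -
  interpret R: cring R by fact
  interpret S: cring S by fact
  interpret h: ring_hom_cring R S h by unfold_locales (fact assms(3))
  have pos: "h (int_embed R (int m)) = int_embed S (int m)" for m
    by (induction m) (simp_all add: R.int_embed_simps S.int_embed_simps)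
  show ?thesis
    by (cases k rule: int_cases2) (simp_all add: pos R.int_embed_simps S.int_embed_simps)
qed

section \<open>The class function on matrices given by lists\<close>

definition lprod :: "nat \<Rightarrow> 'a::comm_ring_1 list list \<Rightarrow> 'a list list \<Rightarrow> 'a list list" where
  "lprod m K L = map (\<lambda>i. map (\<lambda>j. foldr (\<lambda>k s. K ! i ! k * L ! k ! j + s) [0..<m] 0) [0..<m]) [0..<m]"

definition ltr :: "nat \<Rightarrow> 'a::comm_ring_1 list list \<Rightarrow> 'a" where
  "ltr m L = foldr (\<lambda>i s. L ! i ! i + s) [0..<m] 0"

definition lptrace :: "nat \<Rightarrow> 'a::comm_ring_1 list list \<Rightarrow> 'a list list \<Rightarrow> 'a list list" where
  "lptrace m A A2 = (let t = ltr m A in map (\<lambda>i. map (\<lambda>j. t * A ! i ! j - A2 ! i ! j) [0..<m]) [0..<m])"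

text \<open>The class function on the image of \<open>A\<close>, with \<open>B\<close> the inverse
  of \<open>A\<close>, in terms of matrices of size \<open>m\<close> only. For \<open>AD\<close> the
  partial traces of the image and of its square are \<open>tr(A) B\<close> and
  \<open>tr(A^2) B^2\<close>, which gives \<open>tr(A)^2 tr(A^2) tr(B^4)\<close>.\<close>

fun class_value :: "nat \<Rightarrow> isogeny \<Rightarrow> 'a::comm_ring_1 list list \<Rightarrow> 'a list list \<Rightarrow> 'a" where
  "class_value m SC A B = ltr m A"
| "class_value m MID A B =
    (let A2 = lprod m A A; Y = lptrace m A A2
     in ltr m (lprod m (lprod m Y Y) (lptrace m A2 (lprod m A2 A2))))"
| "class_value m AD A B =
    (let A2 = lprod m A A; B2 = lprod m B B
     in ltr m A * ltr m A * ltr m A2 * ltr m (lprod m B2 B2))"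

lemma lmul_class: "lmul class_ring = lprod"
  by (simp add: fun_eq_iff lmul_def lprod_def)

lemma is_lmat_lprod: "is_lmat class_ring m (lprod m K L)"
  by (auto simp: is_lmat_def lprod_def)

lemma mmul_lmat:
  assumes "is_lmat class_ring (n+1) K" "is_lmat class_ring (n+1) L" "i \<in> {1..n+1}" "j \<in> {1..n+1}"
  shows "mmul n (lmat (n+1) K) (lmat (n+1) L) i j = lmat (n+1) (lprod (n+1) K L) i j"
  using class_ring.lmat_mult[OF assms(1,2)] Mat_class_mult[OF assms(3,4), of "lmat (n+1) K" "lmat (n+1) L"]
  by (simp add: lmul_class)

lemma tr_lmat: "tr n (lmat (n+1) L) = ltr (n+1) L"
proof -
  have fold: "distinct xs \<Longrightarrow> (\<Sum>i\<in>set xs. f i) = foldr (\<lambda>i s. f i + s) xs 0" for f :: "nat \<Rightarrow> 'a" and xs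
    by (induction xs) auto
  have "tr n (lmat (n+1) L) = (\<Sum>i\<in>set [0..<n+1]. L ! i ! i)"
    unfolding tr_def
    by (rule sum.reindex_bij_witness[of _ "\<lambda>i. i + 1" "\<lambda>i. i - 1"]) (auto simp: lmat_def)
  also have "\<dots> = foldr (\<lambda>i s. L ! i ! i + s) [0..<n+1] 0"
    by (rule fold) simp
  finally show ?thesis by (simp add: ltr_def)
qed

lemma is_lmat_lptrace: "is_lmat class_ring m (lptrace m A A2)"
  by (auto simp: is_lmat_def lptrace_def Let_def)

lemma lmat_lptrace:
  assumes "i \<in> {1..n+1}" "j \<in> {1..n+1}"
  shows "lmat (n+1) (lptrace (n+1) A A2) i j = tr n (lmat (n+1) A) * lmat (n+1) A i j - lmat (n+1) A2 i j"
proof -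
  have "i - 1 < n + 1" "j - 1 < n + 1" using assms by auto
  then show ?thesis using assms by (simp add: tr_lmat) (simp add: lmat_def lptrace_def Let_def)
qed

lemma class_fun_lmat:
  assumes A: "is_lmat class_ring (n+1) A" and B: "is_lmat class_ring (n+1) B"
  shows "class_fun class_ring n \<pi> (\<lambda>r\<in>rep_index n \<pi>. \<lambda>c\<in>rep_index n \<pi>.
      rep_entry class_ring \<pi> (lmat (n+1) A) (lmat (n+1) B) r c) = class_value (n+1) \<pi> A B"
proof -
  let ?I = "rep_index n \<pi>" and ?J = "{1..n+1}" and ?l = "lmat (n+1)"
  let ?A2 = "lprod (n+1) A A" and ?B2 = "lprod (n+1) B B"
  define P where "P A B = rep_entry class_ring \<pi> (?l A) (?l B)" for A B :: "'a list list"
  note lp = is_lmat_lprod is_lmat_lptrace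
  have "class_fun class_ring n \<pi> (\<lambda>r\<in>?I. \<lambda>c\<in>?I. P A B r c) = zeval class_ring (\<lambda>(r, c). P A B r c) (class_poly n \<pi>)"
    unfolding class_fun_def using zvars_class_poly[of n \<pi>] by (intro zeval_cong) auto
  also have "\<dots> = class_value (n+1) \<pi> A B"
  proof (cases "\<pi> = SC")
    case True
    have "tr n (ptrace n SC (P A B)) = tr n (?l A)"
      by (rule tr_cong) (simp add: P_def True)
    then show ?thesis by (simp add: zeval_class_poly True tr_lmat del: ptrace.simps)
  next
    case False
    have sq: "(\<Sum>s\<in>?I. P A B r s * P A B s c) = P ?A2 ?B2 r c" if "r \<in> ?I" "c \<in> ?I" for r c
      unfolding P_def class_rep_entry_mult[OF that]
      using A B by (intro rep_entry_cong[OF that]) (simp_all add: mmul_lmat)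
    have "tr n (mmul n (mmul n (ptrace n \<pi> (P A B)) (ptrace n \<pi> (P A B)))
        (ptrace n \<pi> (\<lambda>r c. \<Sum>s\<in>?I. P A B r s * P A B s c))) =
      tr n (mmul n (mmul n (ptrace n \<pi> (P A B)) (ptrace n \<pi> (P A B))) (ptrace n \<pi> (P ?A2 ?B2)))"
      by (intro tr_cong mmul_cong refl ptrace_cong sq)
    also have "\<dots> = class_value (n+1) \<pi> A B"
    proof (cases \<pi>)
      case MID
      have Y: "ptrace n \<pi> (P A' B') i k = ?l (lptrace (n+1) A' (lprod (n+1) A' A')) i k"
        if "is_lmat class_ring (n+1) A'" "i \<in> ?J" "k \<in> ?J" for A' B' i k
        using that unfolding P_def MID ptrace_rep(1) by (simp add: lmat_lptrace mmul_lmat)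
      let ?Y = "lptrace (n+1) A ?A2" and ?Y2 = "lptrace (n+1) ?A2 (lprod (n+1) ?A2 ?A2)"
      have "tr n (mmul n (mmul n (ptrace n \<pi> (P A B)) (ptrace n \<pi> (P A B))) (ptrace n \<pi> (P ?A2 ?B2))) =
          tr n (mmul n (mmul n (?l ?Y) (?l ?Y)) (?l ?Y2))"
        by (intro tr_cong mmul_cong Y A lp)
      also have "\<dots> = tr n (mmul n (?l (lprod (n+1) ?Y ?Y)) (?l ?Y2))"
        by (intro tr_cong mmul_cong mmul_lmat lp refl)
      also have "\<dots> = tr n (?l (lprod (n+1) (lprod (n+1) ?Y ?Y) ?Y2))"
        by (intro tr_cong mmul_lmat lp)
      finally show ?thesis by (simp add: tr_lmat MID Let_def)
    next
      case AD
      have Y: "ptrace n \<pi> (P A' B') i k = tr n (?l A') * ?l B' i k" for A' B' i k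
        unfolding P_def AD ptrace_rep(2) ..
      have "tr n (mmul n (mmul n (ptrace n \<pi> (P A B)) (ptrace n \<pi> (P A B))) (ptrace n \<pi> (P ?A2 ?B2))) =
          tr n (?l A) * tr n (?l A) * tr n (?l ?A2) * tr n (mmul n (mmul n (?l B) (?l B)) (?l ?B2))"
        by (simp add: mmul_def tr_def[of n "\<lambda>i k. \<Sum>j\<in>_. _ i j k"] tr_def[of n "mmul n _ _"] Y sum_distrib_left sum_distrib_right mult_ac)
      also have "tr n (mmul n (mmul n (?l B) (?l B)) (?l ?B2)) = tr n (mmul n (?l ?B2) (?l ?B2))"
        by (intro tr_cong mmul_cong mmul_lmat B refl)
      also have "\<dots> = tr n (?l (lprod (n+1) ?B2 ?B2))"
        by (intro tr_cong mmul_lmat lp)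
      finally show ?thesis by (simp add: tr_lmat AD Let_def del: ptrace.simps)
    qed (use False in simp)
    finally show ?thesis using False by (simp add: zeval_class_poly del: ptrace.simps class_value.simps)
  qed
  finally show ?thesis unfolding P_def .
qed



section \<open>Detecting the exceptional automorphism\<close>

text \<open>Together with \<open>cid\<close> and \<open>lone\<close>, the counterpart of
  \<open>lin\<close>, \<open>idm\<close> and the identity matrix on lists with type-class
  operations, suited to evaluation.\<close>

definition clin :: "nat \<Rightarrow> ('a::comm_ring_1 \<times> nat \<times> nat) list \<Rightarrow> 'a list list" where
  "clin m xs =
    map (\<lambda>i. map (\<lambda>j. foldr (\<lambda>(a, k, l) s. if k = i \<and> l = j then a + s else s) xs 0) [1..<m+1]) [1..<m+1]"

definition cid :: "nat \<Rightarrow> ('a::comm_ring_1 \<times> nat \<times> nat) list" where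
  "cid m = cf 1 (map (\<lambda>i. (i, i)) [1..<Suc m])"

definition lone :: "nat \<Rightarrow> 'a::comm_ring_1 list list" where
  "lone m = map (\<lambda>i. map (\<lambda>j. if i = j then 1 else 0) [0..<m]) [0..<m]"

lemma lin_class: "lin class_ring m xs = lmat m (clin m xs)"
  unfolding lin_lmat llin_def clin_def class_ring_simps ..

lemma is_lmat_clin: "is_lmat class_ring m (clin m xs)"
  by (auto simp: is_lmat_def clin_def simp del: upt_Suc)

lemma mat_map_lin:
  assumes "cring R" "cring S" "h \<in> Ring.ring_hom R S" "\<And>a k l. (a, k, l) \<in> set xs \<Longrightarrow> a \<in> carrier R"
  shows "mat_map {1..m} h (lin R m xs) = lin S m (map (\<lambda>(a, k, l). (h a, k, l)) xs)"
proof -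
  interpret R: cring R by fact
  interpret S: cring S by fact
  interpret h: ring_hom_cring R S h by unfold_locales (fact assms(3))
  have "h (foldr (\<lambda>(a, k, l) s. if k = i \<and> l = j then a \<oplus>\<^bsub>R\<^esub> s else s) xs \<zero>\<^bsub>R\<^esub>) =
      foldr (\<lambda>(a, k, l) s. if k = i \<and> l = j then a \<oplus>\<^bsub>S\<^esub> s else s) (map (\<lambda>(a, k, l). (h a, k, l)) xs) \<zero>\<^bsub>S\<^esub> \<and>
      foldr (\<lambda>(a, k, l) s. if k = i \<and> l = j then a \<oplus>\<^bsub>R\<^esub> s else s) xs \<zero>\<^bsub>R\<^esub> \<in> carrier R" for i j
    using assms(4)
  proof (induction xs)
    case (Cons x xs)
    obtain a k l where x: "x = (a, k, l)" by (cases x)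
    have "a \<in> carrier R" using Cons.prems[of a k l] x by simp
    moreover have "h (foldr (\<lambda>(a, k, l) s. if k = i \<and> l = j then a \<oplus>\<^bsub>R\<^esub> s else s) xs \<zero>\<^bsub>R\<^esub>) =
      foldr (\<lambda>(a, k, l) s. if k = i \<and> l = j then a \<oplus>\<^bsub>S\<^esub> s else s) (map (\<lambda>(a, k, l). (h a, k, l)) xs) \<zero>\<^bsub>S\<^esub> \<and>
      foldr (\<lambda>(a, k, l) s. if k = i \<and> l = j then a \<oplus>\<^bsub>R\<^esub> s else s) xs \<zero>\<^bsub>R\<^esub> \<in> carrier R"
      by (rule Cons.IH) (use Cons.prems in auto)
    ultimately show ?case using x by simp
  qed simp
  then show ?thesis by (auto simp: mat_map_def lin_def fun_eq_iff)
qed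

lemma (in cring) eq_zero_of_int_multiples:
  assumes \<delta>: "\<delta> \<in> carrier R" "int_embed R 3 \<otimes> \<delta> = \<zero>" "int_embed R c \<otimes> \<delta> = \<zero>" and c: "\<not> 3 dvd c"
  shows "\<delta> = \<zero>"
proof -
  have "coprime c 3" using c prime_imp_coprime[of 3 c] by (simp add: coprime_commute)
  then obtain x y where xy: "x * c + y * 3 = 1"
    using bezout_int[of c 3] by auto
  have "\<delta> = int_embed R (x * c + y * 3) \<otimes> \<delta>"
    using \<delta>(1) by (simp add: xy int_embed_simps)
  also have "\<dots> = int_embed R x \<otimes> (int_embed R c \<otimes> \<delta>) \<oplus> int_embed R y \<otimes> (int_embed R 3 \<otimes> \<delta>)"
    using \<delta>(1) by (simp add: int_embed_simps(3,4) l_distr m_assoc)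
  also have "\<dots> = \<zero>" by (simp add: \<delta>)
  finally show ?thesis .
qed

locale exceptional_witness = elementary_group R \<theta> n for R :: "'a ring" (structure) and \<theta> n +
  fixes \<delta> :: 'a and \<Phi> :: "(nat \<Rightarrow> nat \<Rightarrow> 'a) \<Rightarrow> nat \<Rightarrow> nat \<Rightarrow> 'a"
  assumes \<delta>: "\<delta> \<in> carrier R" and \<delta>_square: "\<delta> \<otimes> \<delta> = \<zero>" and \<delta>_3: "int_embed R 3 \<otimes> \<delta> = \<zero>"
    and \<theta>: "\<theta> \<in> Ring.ring_hom R R" and two: "two R \<in> Units R"
    and \<Phi>: "\<Phi> \<in> auto (E_sc R \<theta> n)"
begin

abbreviation "\<psi> \<equiv> dual_embed R \<delta>"

lemma \<psi>_hom: "\<psi> \<in> Ring.ring_hom class_ring R"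
  by (rule dual_embed_hom[OF \<delta> \<delta>_square])

lemma \<psi>_closed [simp]: "\<psi> x \<in> carrier R"
  by (rule ring_hom_closed[OF \<psi>_hom]) simp

lemma \<psi>_simps: "\<psi> (a + b) = \<psi> a \<oplus> \<psi> b" "\<psi> (a * b) = \<psi> a \<otimes> \<psi> b" "\<psi> (- a) = \<ominus> \<psi> a" "\<psi> 1 = \<one>"
  "\<psi> (Dual 0 1) = \<delta>"
proof -
  interpret h: ring_hom_cring class_ring R \<psi>
    by unfold_locales (fact \<psi>_hom)
  show "\<psi> (a + b) = \<psi> a \<oplus> \<psi> b" "\<psi> (a * b) = \<psi> a \<otimes> \<psi> b" "\<psi> (- a) = \<ominus> \<psi> a" "\<psi> 1 = \<one>"
    using h.hom_add[of a b] h.hom_mult[of a b] h.hom_a_inv[of a] h.hom_one by simp_all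
  show "\<psi> (Dual 0 1) = \<delta>" using \<delta> by (simp add: dual_embed_def int_embed_simps)
qed

lemma \<psi>_int: "\<psi> (Dual k 0) = int_embed R k"
  using \<delta> by (simp add: dual_embed_def int_embed_simps)

lemma \<theta>_\<psi>_int: "\<theta> (\<psi> (Dual k 0)) = \<psi> (Dual k 0)"
  unfolding \<psi>_int by (rule hom_int_embed[OF is_cring is_cring \<theta>])

text \<open>Integers are fixed by \<theta>, so they equal their own symmetric part. Thus the
  prescribed images of root elements with integer parameters have entries in the image of the dual
  numbers.\<close>

lemma plus_part_\<psi>_int: "plus_part R \<theta> (\<psi> (Dual k 0)) = \<psi> (Dual k 0)"
proof -
  have "\<psi> (Dual k 0) \<oplus> \<psi> (Dual k 0) = two R \<otimes> \<psi> (Dual k 0)"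
    by (simp add: two_def l_distr)
  then show ?thesis
    using two by (simp add: plus_part_def \<theta>_\<psi>_int Units_closed flip: m_assoc)
qed

definition realize :: "dual list list \<Rightarrow> nat \<Rightarrow> nat \<Rightarrow> 'a" where
  "realize L = mat_map {1..n+1} \<psi> (lmat (n+1) L)"

text \<open>\<open>P\<close> represents a group element and \<open>Q\<close> its image under \<Phi>.
  The relation is closed under products, so \<Phi> can be followed along words in root elements by
  list computations.\<close>

definition tracks :: "dual list list \<Rightarrow> dual list list \<Rightarrow> bool" where
  "tracks P Q \<longleftrightarrow> is_lmat class_ring (n+1) P \<and> is_lmat class_ring (n+1) Q \<and>
     realize P \<in> carrier (E_sc R \<theta> n) \<and> \<Phi> (realize P) = realize Q"

lemma realize_mult:
  assumes "is_lmat class_ring (n+1) K" "is_lmat class_ring (n+1) L"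
  shows "realize (lprod (n+1) K L) = realize K \<otimes>\<^bsub>M\<^esub> realize L"
  unfolding realize_def lmul_class[symmetric] class_ring.lmat_mult[OF assms, symmetric]
  by (rule mat_map_mult[OF class_ring.is_cring is_cring \<psi>_hom assms[THEN lmat_carrier]])

lemma realize_lin: "realize (clin (n+1) xs) = lin R (n+1) (map (\<lambda>(a, k, l). (\<psi> a, k, l)) xs)"
  unfolding realize_def lin_class[symmetric]
  by (rule mat_map_lin[OF class_ring.is_cring is_cring \<psi>_hom]) simp

lemma realize_one: "realize (lone (n+1)) = \<one>\<^bsub>M\<^esub>"
  using mat_map_one[OF class_ring.is_cring is_cring \<psi>_hom, of "{1..n+1}"]
  unfolding lmat_one[of class_ring] realize_def lone_def class_ring_simps .

lemma tracks_mult: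
  assumes "tracks P Q" "tracks P' Q'"
  shows "tracks (lprod (n+1) P P') (lprod (n+1) Q Q')"
proof -
  interpret E: group "E_sc R \<theta> n" by (rule group_E_sc)
  have "\<Phi> (x \<otimes>\<^bsub>M\<^esub> y) = \<Phi> x \<otimes>\<^bsub>M\<^esub> \<Phi> y" if "x \<in> carrier (E_sc R \<theta> n)" "y \<in> carrier (E_sc R \<theta> n)" for x y
    using \<Phi> that by (auto simp: auto_def hom_def)
  moreover have "x \<otimes>\<^bsub>M\<^esub> y \<in> carrier (E_sc R \<theta> n)" if "x \<in> carrier (E_sc R \<theta> n)" "y \<in> carrier (E_sc R \<theta> n)" for x y
    using E.m_closed[OF that] by simp
  ultimately show ?thesis
    using assms by (simp add: tracks_def realize_mult is_lmat_lprod)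
qed

text \<open>The list \<open>P'\<close> for the inverse is supplied separately because the entries of
  the adjoint representation involve the inverse matrix.\<close>

lemma class_fun_rep_realize:
  assumes P: "is_lmat class_ring (n+1) P" "is_lmat class_ring (n+1) P'"
    and inv: "inv\<^bsub>M\<^esub> (realize P) = realize P'"
  shows "class_fun R n \<pi> (rep R n \<pi> (realize P)) = \<psi> (class_value (n+1) \<pi> P P')"
proof -
  let ?I = "rep_index n \<pi>" and ?l = "lmat (n+1) :: dual list list \<Rightarrow> _"
  define u where "u = (\<lambda>r\<in>?I. \<lambda>c\<in>?I. rep_entry class_ring \<pi> (?l P) (?l P') r c)"
  have "rep R n \<pi> (realize P) = mat_map ?I \<psi> u"
  proof (rule ext)+
    fix r c
    show "rep R n \<pi> (realize P) r c = mat_map ?I \<psi> u r c"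
      unfolding rep_def inv
      using rep_entry_hom[OF class_ring.is_cring is_cring \<psi>_hom _ _ lmat_carrier[OF P(1)] lmat_carrier[OF P(2)], of r \<pi> c]
      by (auto simp: mat_map_def u_def realize_def restrict_def)
  qed
  moreover have "u \<in> carrier (Mat class_ring ?I)"
    unfolding u_def by (rule Mat_carrierI) simp
  ultimately show ?thesis
    using class_fun_map[OF class_ring.is_cring is_cring \<psi>_hom, of u n \<pi>] class_fun_lmat[OF P, of \<pi>]
    by (simp add: u_def)
qed

text \<open>Reduces detection to four computed lists and their images: the inverse of the commutator
  of \<open>u\<close> and \<open>v\<close> is the commutator of \<open>v\<close> and
  \<open>u\<close>, so both matrices needed for \<open>class_value\<close> are words in the same
  lists.\<close>

lemma commutator_witness:
  assumes t: "tracks u U" "tracks v V" "tracks u' U'" "tracks v' V'"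
    and inv: "lprod (n+1) u u' = lone (n+1)" "lprod (n+1) v v' = lone (n+1)"
    and \<Theta>: "\<And>A. A \<in> carrier (E_sc R \<theta> n) \<Longrightarrow> \<Theta> (rep R n \<pi> A) = rep R n \<pi> (\<Phi> A)"
  defines "comm \<equiv> \<lambda>a b c d. lprod (n+1) (lprod (n+1) (lprod (n+1) a b) c) d"
  shows "\<exists>x\<in>center_kernel (E_grp R \<theta> n \<pi>).
    class_fun R n \<pi> x = \<psi> (class_value (n+1) \<pi> (comm u v u' v') (comm v u v' u')) \<and>
    class_fun R n \<pi> (\<Theta> x) = \<psi> (class_value (n+1) \<pi> (comm U V U' V') (comm V U V' U'))"
proof -
  interpret E: group "E_sc R \<theta> n" by (rule group_E_sc)
  interpret h: group_hom "E_sc R \<theta> n" "E_sc R \<theta> n" \<Phi>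
    by unfold_locales (use \<Phi> in \<open>simp add: auto_def\<close>)
  let ?E = "E_sc R \<theta> n" and ?I = "Mat R (rep_index n \<pi>)"
  define a b a' b' where ab: "a = realize u" "b = realize v" "a' = realize u'" "b' = realize v'"
  have c: "a \<in> carrier ?E" "b \<in> carrier ?E" "a' \<in> carrier ?E" "b' \<in> carrier ?E"
    using t by (auto simp: tracks_def ab)
  have l: "is_lmat class_ring (n+1) u" "is_lmat class_ring (n+1) v" "is_lmat class_ring (n+1) u'" "is_lmat class_ring (n+1) v'"
    using t by (auto simp: tracks_def)
  have i: "a \<otimes>\<^bsub>M\<^esub> a' = \<one>\<^bsub>M\<^esub>" "b \<otimes>\<^bsub>M\<^esub> b' = \<one>\<^bsub>M\<^esub>"
    using l inv by (simp_all add: ab realize_one flip: realize_mult)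
  then have i': "a' = inv\<^bsub>?E\<^esub> a" "b' = inv\<^bsub>?E\<^esub> b"
    using E.inv_equality[of a' a] E.inv_equality[of b' b] E.inv_comm[of a a'] E.inv_comm[of b b'] c by simp_all
  have T: "tracks (comm u v u' v') (comm U V U' V')" "tracks (comm v u v' u') (comm V U V' U')"
    unfolding comm_def by (intro tracks_mult t)+
  have r: "realize (comm u v u' v') = a \<otimes>\<^bsub>M\<^esub> b \<otimes>\<^bsub>M\<^esub> a' \<otimes>\<^bsub>M\<^esub> b'"
    "realize (comm v u v' u') = b \<otimes>\<^bsub>M\<^esub> a \<otimes>\<^bsub>M\<^esub> b' \<otimes>\<^bsub>M\<^esub> a'"
    using l by (simp_all add: comm_def realize_mult is_lmat_lprod ab)
  have cancel: "p' \<otimes>\<^bsub>?E\<^esub> (p \<otimes>\<^bsub>?E\<^esub> z) = z"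
    if "p' \<otimes>\<^bsub>?E\<^esub> p = \<one>\<^bsub>?E\<^esub>" "p \<in> carrier ?E" "p' \<in> carrier ?E" "z \<in> carrier ?E" for p p' z
    using that by (simp only: E.m_assoc[symmetric] E.l_one)
  have "(b \<otimes>\<^bsub>?E\<^esub> a \<otimes>\<^bsub>?E\<^esub> b' \<otimes>\<^bsub>?E\<^esub> a') \<otimes>\<^bsub>?E\<^esub> (a \<otimes>\<^bsub>?E\<^esub> b \<otimes>\<^bsub>?E\<^esub> a' \<otimes>\<^bsub>?E\<^esub> b') =
      b \<otimes>\<^bsub>?E\<^esub> (a \<otimes>\<^bsub>?E\<^esub> (b' \<otimes>\<^bsub>?E\<^esub> (a' \<otimes>\<^bsub>?E\<^esub> (a \<otimes>\<^bsub>?E\<^esub> (b \<otimes>\<^bsub>?E\<^esub> (a' \<otimes>\<^bsub>?E\<^esub> b'))))))"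
    using c by (simp only: E.m_assoc E.m_closed)
  also have "\<dots> = \<one>\<^bsub>?E\<^esub>"
    using c unfolding i' by (simp only: cancel E.l_inv E.r_inv E.m_closed E.inv_closed)
  finally have inv1: "inv\<^bsub>?E\<^esub> (realize (comm u v u' v')) = realize (comm v u v' u')"
    unfolding r mult_E_sc[symmetric] using c by (intro E.inv_equality E.m_closed)
  \<comment> \<open>The inverse on the image side follows from \<Phi> being a homomorphism; the
    lists \<open>U\<close>, \<open>V\<close>, \<open>U'\<close>, \<open>V'\<close> need no inverse
    identities of their own.\<close>
  then have inv2: "inv\<^bsub>?E\<^esub> (realize (comm U V U' V')) = realize (comm V U V' U')"
    using T h.hom_inv[of "realize (comm u v u' v')"] by (simp add: tracks_def)
  define x where "x = rep R n \<pi> (realize (comm u v u' v'))"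
  have "x = rep R n \<pi> a \<otimes>\<^bsub>?I\<^esub> rep R n \<pi> b \<otimes>\<^bsub>?I\<^esub> rep R n \<pi> a' \<otimes>\<^bsub>?I\<^esub> rep R n \<pi> b'"
    unfolding x_def r using c E.m_closed by (simp add: rep_mult_E_sc)
  moreover have "rep R n \<pi> a \<otimes>\<^bsub>?I\<^esub> rep R n \<pi> a' = \<one>\<^bsub>?I\<^esub>" "rep R n \<pi> b \<otimes>\<^bsub>?I\<^esub> rep R n \<pi> b' = \<one>\<^bsub>?I\<^esub>"
    using c i by (simp_all add: rep_mult_E_sc rep_one)
  ultimately have "x \<in> center_kernel (E_grp R \<theta> n \<pi>)"
    using commutator_in_center_kernel[OF group_E_grp, of "rep R n \<pi> a" \<pi> "rep R n \<pi> b" "rep R n \<pi> a'" "rep R n \<pi> b'"] c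
    by (simp add: carrier_E_grp)
  moreover have "class_fun R n \<pi> x = \<psi> (class_value (n+1) \<pi> (comm u v u' v') (comm v u v' u'))"
    unfolding x_def using T inv1 inv_E_sc(1)
    by (intro class_fun_rep_realize) (auto simp: tracks_def)
  moreover have "class_fun R n \<pi> (\<Theta> x) = \<psi> (class_value (n+1) \<pi> (comm U V U' V') (comm V U V' U'))"
  proof -
    have "\<Theta> x = rep R n \<pi> (realize (comm U V U' V'))"
      using T(1) \<Theta> by (simp add: x_def tracks_def)
    moreover have "realize (comm U V U' V') \<in> carrier ?E"
      using T(1) h.hom_closed[of "realize (comm u v u' v')"] by (simp add: tracks_def)
    ultimately show ?thesis
      using T inv2 inv_E_sc(1)[of "realize (comm U V U' V')"]
      by (simp add: class_fun_rep_realize tracks_def)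
  qed
  ultimately show ?thesis by blast
qed

lemma \<delta>_eq_zero:
  assumes "\<mu> \<in> Ring.ring_hom R R" "\<mu> (\<psi> (Dual k 0)) = \<psi> (Dual k c)" "\<not> 3 dvd c"
  shows "\<delta> = \<zero>"
proof -
  have "\<mu> (\<psi> (Dual k 0)) = \<psi> (Dual k 0)"
    unfolding \<psi>_int by (rule hom_int_embed[OF is_cring is_cring assms(1)])
  then have "int_embed R k = int_embed R k \<oplus> int_embed R c \<otimes> \<delta>"
    using assms(2) \<delta> by (simp add: dual_embed_def int_embed_simps)
  then have "int_embed R c \<otimes> \<delta> = \<zero>"
    using \<delta> add.l_cancel_one'[of "int_embed R k" "int_embed R c \<otimes> \<delta>"] by simp
  then show ?thesis using eq_zero_of_int_multiples[OF \<delta> \<delta>_3 _ assms(3)] by simp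
qed

end

section \<open>Root elements with integer parameters and their exceptional images over the dual
  numbers\<close>

definition x1_list :: "nat \<Rightarrow> dual \<Rightarrow> dual list list" where
  "x1_list n t = clin (n+1) (cid (n+1) @ [(t, 1, 2), (t, n, n+1)])"

definition xm1_list :: "nat \<Rightarrow> dual \<Rightarrow> dual list list" where
  "xm1_list n t = clin (n+1) (cid (n+1) @ [(t, 2, 1), (t, n+1, n)])"

definition x2_3_list :: "dual \<Rightarrow> dual list list" where
  "x2_3_list s = clin 4 (cid 4 @ [(s, 2, 3)])"

definition xm2_3_list :: "dual \<Rightarrow> dual list list" where
  "xm2_3_list s = clin 4 (cid 4 @ [(s, 3, 2)])"

definition x2_4_dual :: "dual \<Rightarrow> dual \<Rightarrow> dual list list" where
  "x2_4_dual t u = clin 5 (cid 5 @ [(t, 2, 3), (t, 3, 4), (u, 2, 4)])"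

text \<open>The prescribed image with \<open>Dual 0 1\<close> for \<delta>, and with
  \<open>t\<close> for both \<open>\<theta> t\<close> and \<open>p\<close>, as is correct for
  integer parameters. The other image lists follow the same convention.\<close>

definition x1_3_image :: "dual \<Rightarrow> dual list list" where
  "x1_3_image t = clin 4 (cid 4 @ [(t, 1, 2), (t, 3, 4)] @
     cf (- (t * Dual 0 1)) [(1,3),(2,4),(3,1),(4,2)] @ cf (- (t * t * Dual 0 1)) [(1,4),(3,2)])"

definition x2_3_image :: "dual \<Rightarrow> dual list list" where
  "x2_3_image s = clin 4 (cf (1 + (1 + 1) * (s * Dual 0 1)) [(1,1),(4,4)] @
     cf (1 + s * Dual 0 1) [(2,2),(3,3)] @ [(s + s * s * Dual 0 1, 2, 3)])"

definition xm2_3_image :: "dual \<Rightarrow> dual list list" where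
  "xm2_3_image s = clin 4 (cf (1 + - ((1 + 1) * (s * Dual 0 1))) [(1,1),(4,4)] @
     cf (1 + - (s * Dual 0 1)) [(2,2),(3,3)] @ [(s + - (s * s * Dual 0 1), 3, 2)])"

definition x1_4_image :: "dual \<Rightarrow> dual list list" where
  "x1_4_image t = lprod 5 (clin 5 (cf (1 + t * Dual 0 1) [(1,1),(2,2),(4,4),(5,5)] @ [(1 + - (t * Dual 0 1), 3, 3)]))
     (x1_list 4 t)"

definition xm1_4_image :: "dual \<Rightarrow> dual list list" where
  "xm1_4_image t = lprod 5 (clin 5 (cf (1 + - (t * Dual 0 1)) [(1,1),(2,2),(4,4),(5,5)] @ [(1 + t * Dual 0 1, 3, 3)]))
     (xm1_list 4 t)"

definition x2_4_image :: "dual \<Rightarrow> dual \<Rightarrow> dual list list" where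
  "x2_4_image t u = clin 5 (cid 5 @ [(t, 2, 3), (t, 3, 4), (u, 2, 4)] @
     cf (- (t * Dual 0 1)) [(1,3),(5,3),(3,1),(3,5)] @ cf (t * t * Dual 0 1) [(1,4),(5,4),(2,1),(2,5)])"

context exceptional_witness
begin

abbreviation on_coeffs :: "(dual \<times> nat \<times> nat) list \<Rightarrow> ('a \<times> nat \<times> nat) list" where
  "on_coeffs \<equiv> map (\<lambda>(a, k, l). (\<psi> a, k, l))"

lemma on_coeffs_cf: "on_coeffs (cf a ps) = cf (\<psi> a) ps"
  by (auto simp: cf_def)

lemma on_coeffs_cid: "on_coeffs (cid m) = idm R m"
  unfolding cid_def idm_def on_coeffs_cf \<psi>_simps ..

lemmas on_coeffs_simps = map_append list.map prod.case on_coeffs_cf on_coeffs_cid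

lemma realize_x1: "realize (x1_list n (Dual k 0)) = x1 R \<theta> n (\<psi> (Dual k 0))"
  and realize_xm1: "realize (xm1_list n (Dual k 0)) = xm1 R \<theta> n (\<psi> (Dual k 0))"
  unfolding x1_list_def xm1_list_def realize_lin x1_def xm1_def on_coeffs_simps \<theta>_\<psi>_int by rule+

lemma realize_clin:
  "m = n + 1 \<Longrightarrow> realize (clin m xs) = lin R m (on_coeffs xs)"
  using realize_lin by simp

lemma tracksI:
  assumes "realize P \<in> root_elements R \<theta> n" "\<Phi> (realize P) = realize Q"
    and "is_lmat class_ring (n+1) P" "is_lmat class_ring (n+1) Q"
  shows "tracks P Q"
  using assms by (simp add: tracks_def root_in_E_sc)

lemma x1_root: "t \<in> carrier R \<Longrightarrow> x1 R \<theta> n t \<in> root_elements R \<theta> n"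
  and xm1_root: "t \<in> carrier R \<Longrightarrow> xm1 R \<theta> n t \<in> root_elements R \<theta> n"
  by (auto simp: root_elements_def)

lemma tracks_x1_3:
  assumes "n = 3" "exceptional_on_roots_3 R \<theta> \<delta> \<Phi>"
  shows "tracks (x1_list n (Dual k 0)) (x1_3_image (Dual k 0))"
proof (rule tracksI)
  let ?t = "\<psi> (Dual k 0)"
  have num: "4 = n + 1" and x1_n: "x1 R \<theta> n = x1 R \<theta> 3" using assms(1) by simp_all
  show "realize (x1_list n (Dual k 0)) \<in> root_elements R \<theta> n"
    unfolding realize_x1 by (rule x1_root) simp
  have "\<Phi> (x1 R \<theta> 3 ?t) = lin R 4 (idm R 4 @ [(?t,1,2), (?t,3,4)] @
      cf (\<ominus> (?t \<otimes> \<delta>)) [(1,3),(2,4),(3,1),(4,2)] @ cf (\<ominus> (?t \<otimes> ?t \<otimes> \<delta>)) [(1,4),(3,2)])"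
    using assms(2) by (simp add: exceptional_on_roots_3_def Let_def plus_part_\<psi>_int \<theta>_\<psi>_int)
  also have "\<dots> = realize (x1_3_image (Dual k 0))"
    unfolding x1_3_image_def realize_clin[OF num] on_coeffs_simps \<psi>_simps ..
  finally show "\<Phi> (realize (x1_list n (Dual k 0))) = realize (x1_3_image (Dual k 0))"
    unfolding realize_x1 x1_n .
qed (simp_all add: x1_list_def x1_3_image_def is_lmat_clin assms(1))

lemma tracks_x2_3:
  assumes n: "n = 3" and \<Phi>: "exceptional_on_roots_3 R \<theta> \<delta> \<Phi>"
  shows "tracks (x2_3_list (Dual k 0)) (x2_3_image (Dual k 0))" (is ?plus)
    and "tracks (xm2_3_list (Dual k 0)) (xm2_3_image (Dual k 0))" (is ?minus)
proof -
  let ?s = "\<psi> (Dual k 0)"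
  have num: "4 = n + 1" using n by simp
  have s: "?s \<in> sym_part R \<theta>" by (simp add: sym_part_def \<theta>_\<psi>_int)
  have r: "realize (x2_3_list (Dual k 0)) = x2_3 R ?s" "realize (xm2_3_list (Dual k 0)) = xm2_3 R ?s"
    unfolding x2_3_list_def xm2_3_list_def realize_clin[OF num] on_coeffs_simps x2_3_def xm2_3_def by rule+
  have root: "x2_3 R ?s \<in> root_elements R \<theta> n" "xm2_3 R ?s \<in> root_elements R \<theta> n"
    using s n by (auto simp: root_elements_def)
  show ?plus
  proof (rule tracksI)
    have "\<Phi> (x2_3 R ?s) = lin R 4 (cf (\<one> \<oplus> two R \<otimes> (?s \<otimes> \<delta>)) [(1,1),(4,4)] @
        cf (\<one> \<oplus> ?s \<otimes> \<delta>) [(2,2),(3,3)] @ [(?s \<oplus> ?s \<otimes> ?s \<otimes> \<delta>,2,3)])"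
      using \<Phi> s by (simp add: exceptional_on_roots_3_def Let_def)
    also have "\<dots> = realize (x2_3_image (Dual k 0))"
      unfolding x2_3_image_def realize_clin[OF num] on_coeffs_simps \<psi>_simps two_def ..
    finally show "\<Phi> (realize (x2_3_list (Dual k 0))) = realize (x2_3_image (Dual k 0))"
      unfolding r .
  qed (use root r in \<open>simp_all add: x2_3_list_def x2_3_image_def is_lmat_clin n\<close>)
  show ?minus
  proof (rule tracksI)
    have "\<Phi> (xm2_3 R ?s) = lin R 4 (cf (\<one> \<ominus> two R \<otimes> (?s \<otimes> \<delta>)) [(1,1),(4,4)] @
        cf (\<one> \<ominus> ?s \<otimes> \<delta>) [(2,2),(3,3)] @ [(?s \<ominus> ?s \<otimes> ?s \<otimes> \<delta>,3,2)])"
      using \<Phi> s by (simp add: exceptional_on_roots_3_def Let_def)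
    also have "\<dots> = realize (xm2_3_image (Dual k 0))"
      unfolding xm2_3_image_def realize_clin[OF num] on_coeffs_simps \<psi>_simps two_def a_minus_def ..
    finally show "\<Phi> (realize (xm2_3_list (Dual k 0))) = realize (xm2_3_image (Dual k 0))"
      unfolding r .
  qed (use root r in \<open>simp_all add: xm2_3_list_def xm2_3_image_def is_lmat_clin n\<close>)
qed

lemma tracks_x1_4:
  assumes n: "n = 4" and \<Phi>: "exceptional_on_roots_4 R \<theta> \<delta> \<Phi>"
  shows "tracks (x1_list n (Dual k 0)) (x1_4_image (Dual k 0))" (is ?plus)
    and "tracks (xm1_list n (Dual k 0)) (xm1_4_image (Dual k 0))" (is ?minus)
proof -
  let ?t = "\<psi> (Dual k 0)"
  have num: "5 = n + 1" using n by simp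
  have at_n: "x1_list 4 = x1_list n" "xm1_list 4 = xm1_list n" "x1 R \<theta> 4 = x1 R \<theta> n" "xm1 R \<theta> 4 = xm1 R \<theta> n"
    by (simp_all add: n)
  have l: "is_lmat class_ring (n+1) (x1_list n t)" "is_lmat class_ring (n+1) (xm1_list n t)"
    "is_lmat class_ring (n+1) (clin 5 xs)" for t and xs :: "(dual \<times> nat \<times> nat) list"
    by (simp_all add: x1_list_def xm1_list_def is_lmat_clin num)
  have mult: "realize (lprod 5 (clin 5 xs) L) = lin R 5 (on_coeffs xs) \<otimes>\<^bsub>Mat R {1..5}\<^esub> realize L"
    if "is_lmat class_ring (n+1) L" for xs L
    unfolding num realize_mult[OF l(3)[unfolded num] that] realize_lin ..
  show ?plus
  proof (rule tracksI)
    show "realize (x1_list n (Dual k 0)) \<in> root_elements R \<theta> n"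
      unfolding realize_x1 by (rule x1_root) simp
    have "\<Phi> (x1 R \<theta> 4 ?t) = lin R 5 (cf (\<one> \<oplus> ?t \<otimes> \<delta>) [(1,1),(2,2),(4,4),(5,5)] @ [(\<one> \<ominus> ?t \<otimes> \<delta>,3,3)])
        \<otimes>\<^bsub>Mat R {1..5}\<^esub> x1 R \<theta> 4 ?t"
      using \<Phi> by (simp add: exceptional_on_roots_4_def Let_def plus_part_\<psi>_int)
    also have "\<dots> = realize (x1_4_image (Dual k 0))"
      unfolding x1_4_image_def at_n mult[OF l(1)] realize_x1
        on_coeffs_simps \<psi>_simps a_minus_def ..
    finally show "\<Phi> (realize (x1_list n (Dual k 0))) = realize (x1_4_image (Dual k 0))"
      unfolding realize_x1 at_n .
  qed (use l in \<open>simp_all add: x1_4_image_def is_lmat_lprod n\<close>)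
  show ?minus
  proof (rule tracksI)
    show "realize (xm1_list n (Dual k 0)) \<in> root_elements R \<theta> n"
      unfolding realize_xm1 by (rule xm1_root) simp
    have "\<Phi> (xm1 R \<theta> 4 ?t) = lin R 5 (cf (\<one> \<ominus> ?t \<otimes> \<delta>) [(1,1),(2,2),(4,4),(5,5)] @ [(\<one> \<oplus> ?t \<otimes> \<delta>,3,3)])
        \<otimes>\<^bsub>Mat R {1..5}\<^esub> xm1 R \<theta> 4 ?t"
      using \<Phi> by (simp add: exceptional_on_roots_4_def Let_def plus_part_\<psi>_int)
    also have "\<dots> = realize (xm1_4_image (Dual k 0))"
      unfolding xm1_4_image_def at_n mult[OF l(2)] realize_xm1
        on_coeffs_simps \<psi>_simps a_minus_def ..
    finally show "\<Phi> (realize (xm1_list n (Dual k 0))) = realize (xm1_4_image (Dual k 0))"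
      unfolding realize_xm1 at_n .
  qed (use l in \<open>simp_all add: xm1_4_image_def is_lmat_lprod n\<close>)
qed

text \<open>For integers, membership in \<open>param_A\<close> reads \<open>k * k = l + l\<close>,
  so \<open>k\<close> must be even; the smallest nonzero choices are \<open>k = 2\<close> and
  \<open>k = -2\<close> with \<open>l = 2\<close>.\<close>

lemma tracks_x2_4:
  assumes n: "n = 4" and \<Phi>: "exceptional_on_roots_4 R \<theta> \<delta> \<Phi>" and kl: "k * k = l + l"
  shows "tracks (x2_4_dual (Dual k 0) (Dual l 0)) (x2_4_image (Dual k 0) (Dual l 0))"
proof (rule tracksI)
  let ?t = "\<psi> (Dual k 0)" and ?u = "\<psi> (Dual l 0)"
  have num: "5 = n + 1" using n by simp
  have tu: "(?t, ?u) \<in> param_A R \<theta>"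
  proof -
    have "?t \<otimes> ?t = ?u \<oplus> ?u"
      unfolding \<psi>_int int_embed_simps(3,4)[symmetric] kl ..
    then show ?thesis by (simp add: param_A_def \<theta>_\<psi>_int)
  qed
  have r: "realize (x2_4_dual (Dual k 0) (Dual l 0)) = lin R 5 (x2_4_list R \<theta> ?t ?u)"
    unfolding x2_4_dual_def realize_clin[OF num] on_coeffs_simps x2_4_list_def \<theta>_\<psi>_int ..
  show "realize (x2_4_dual (Dual k 0) (Dual l 0)) \<in> root_elements R \<theta> n"
    unfolding r using tu n by (auto simp: root_elements_def)
  have "\<Phi> (lin R 5 (x2_4_list R \<theta> ?t ?u)) = lin R 5 (x2_4_list R \<theta> ?t ?u @
      cf (\<ominus> (?t \<otimes> \<delta>)) [(1,3),(5,3),(3,1),(3,5)] @ cf (?t \<otimes> ?t \<otimes> \<delta>) [(1,4),(5,4),(2,1),(2,5)])"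
    using \<Phi> tu by (auto simp: exceptional_on_roots_4_def Let_def plus_part_\<psi>_int)
  also have "\<dots> = realize (x2_4_image (Dual k 0) (Dual l 0))"
    unfolding x2_4_image_def realize_clin[OF num] on_coeffs_simps \<psi>_simps x2_4_list_def \<theta>_\<psi>_int append_assoc append.simps ..
  finally show "\<Phi> (realize (x2_4_dual (Dual k 0) (Dual l 0))) = realize (x2_4_image (Dual k 0) (Dual l 0))"
    unfolding r .
qed (simp_all add: x2_4_dual_def x2_4_image_def is_lmat_clin n)

end

definition lcomm :: "nat \<Rightarrow> dual list list \<Rightarrow> dual list list \<Rightarrow> dual list list \<Rightarrow> dual list list \<Rightarrow> dual list list" where
  "lcomm n a b c d = lprod (n+1) (lprod (n+1) (lprod (n+1) a b) c) d"

text \<open>The commutators of \<open>x\<^sub>2(1) x\<^sub>-\<^sub>2(1)\<close> and \<open>x\<^sub>1(-1) x\<^sub>2(1)\<close> for \<open>n = 3\<close>, and of \<open>x\<^sub>1(-1) x\<^sub>-\<^sub>1(-1)\<close> and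
  \<open>x\<^sub>2(-2, 2) x\<^sub>1(-1)\<close> for \<open>n = 4\<close>, were found by a computer search for short words on which the
  class functions change by a multiple of \<open>\<delta>\<close> prime to \<open>3\<close>.\<close>

lemma class_values_3:
  defines "u \<equiv> lprod 4 (x2_3_list (Dual 1 0)) (xm2_3_list (Dual 1 0))"
    and "v \<equiv> lprod 4 (x1_list 3 (Dual (-1) 0)) (x2_3_list (Dual 1 0))"
    and "u' \<equiv> lprod 4 (xm2_3_list (Dual (-1) 0)) (x2_3_list (Dual (-1) 0))"
    and "v' \<equiv> lprod 4 (x2_3_list (Dual (-1) 0)) (x1_list 3 (Dual 1 0))"
    and "U \<equiv> lprod 4 (x2_3_image (Dual 1 0)) (xm2_3_image (Dual 1 0))"
    and "V \<equiv> lprod 4 (x1_3_image (Dual (-1) 0)) (x2_3_image (Dual 1 0))"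
    and "U' \<equiv> lprod 4 (xm2_3_image (Dual (-1) 0)) (x2_3_image (Dual (-1) 0))"
    and "V' \<equiv> lprod 4 (x2_3_image (Dual (-1) 0)) (x1_3_image (Dual 1 0))"
  shows "lprod 4 u u' = lone 4" "lprod 4 v v' = lone 4"
    and "class_value 4 SC (lcomm 3 u v u' v') (lcomm 3 v u v' u') = Dual 5 0"
      "class_value 4 SC (lcomm 3 U V U' V') (lcomm 3 V U V' U') = Dual 5 (-2)"
    and "class_value 4 MID (lcomm 3 u v u' v') (lcomm 3 v u v' u') = Dual 832 0"
      "class_value 4 MID (lcomm 3 U V U' V') (lcomm 3 V U V' U') = Dual 832 (-320)"
    and "class_value 4 AD (lcomm 3 u v u' v') (lcomm 3 v u v' u') = Dual 11025 0"
      "class_value 4 AD (lcomm 3 U V U' V') (lcomm 3 V U V' U') = Dual 11025 47680"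
  unfolding assms by code_simp+

lemma class_values_4:
  defines "u \<equiv> lprod 5 (x1_list 4 (Dual (-1) 0)) (xm1_list 4 (Dual (-1) 0))"
    and "v \<equiv> lprod 5 (x2_4_dual (Dual (-2) 0) (Dual 2 0)) (x1_list 4 (Dual (-1) 0))"
    and "u' \<equiv> lprod 5 (xm1_list 4 (Dual 1 0)) (x1_list 4 (Dual 1 0))"
    and "v' \<equiv> lprod 5 (x1_list 4 (Dual 1 0)) (x2_4_dual (Dual 2 0) (Dual 2 0))"
    and "U \<equiv> lprod 5 (x1_4_image (Dual (-1) 0)) (xm1_4_image (Dual (-1) 0))"
    and "V \<equiv> lprod 5 (x2_4_image (Dual (-2) 0) (Dual 2 0)) (x1_4_image (Dual (-1) 0))"
    and "U' \<equiv> lprod 5 (xm1_4_image (Dual 1 0)) (x1_4_image (Dual 1 0))"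
    and "V' \<equiv> lprod 5 (x1_4_image (Dual 1 0)) (x2_4_image (Dual 2 0) (Dual 2 0))"
  shows "lprod 5 u u' = lone 5" "lprod 5 v v' = lone 5"
    and "class_value 5 SC (lcomm 4 u v u' v') (lcomm 4 v u v' u') = Dual 7 0"
      "class_value 5 SC (lcomm 4 U V U' V') (lcomm 4 V U V' U') = Dual 7 (-64)"
    and "class_value 5 AD (lcomm 4 u v u' v') (lcomm 4 v u v' u') = Dual 69825 0"
      "class_value 5 AD (lcomm 4 U V U' V') (lcomm 4 V U V' U') = Dual 69825 471520"
  unfolding assms by code_simp+

section \<open>The exceptional automorphism with parameter zero fixes the root elements\<close>

context cring
begin

lemma lin_append_zero: "lin R m (xs @ cf \<zero> ps) = lin R m xs"
proof -
  have "foldr (\<lambda>(a, k, l) s. if k = i \<and> l = j then a \<oplus> s else s) (cf \<zero> ps) \<zero> = \<zero>" for i j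
    by (induction ps) (auto simp: cf_def)
  then show ?thesis by (simp add: lin_def)
qed

lemma plus_part_closed:
  assumes "two R \<in> Units R" "\<theta> \<in> Ring.ring_hom R R" "t \<in> carrier R"
  shows "plus_part R \<theta> t \<in> carrier R"
  using assms by (simp add: plus_part_def ring_hom_closed)

lemma exceptional_on_roots_3_zero:
  assumes two: "two R \<in> Units R" and \<theta>: "\<theta> \<in> Ring.ring_hom R R" and \<Phi>: "exceptional_on_roots_3 R \<theta> \<zero> \<Phi>"
  shows "t \<in> carrier R \<Longrightarrow> \<Phi> (x1 R \<theta> 3 t) = x1 R \<theta> 3 t" "t \<in> carrier R \<Longrightarrow> \<Phi> (xm1 R \<theta> 3 t) = xm1 R \<theta> 3 t"
    and "s \<in> sym_part R \<theta> \<Longrightarrow> \<Phi> (x2_3 R s) = x2_3 R s" "s \<in> sym_part R \<theta> \<Longrightarrow> \<Phi> (xm2_3 R s) = xm2_3 R s"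
proof -
  have num: "3 + 1 = (4::nat)" by simp
  show "\<Phi> (x1 R \<theta> 3 t) = x1 R \<theta> 3 t" "\<Phi> (xm1 R \<theta> 3 t) = xm1 R \<theta> 3 t" if "t \<in> carrier R"
    using \<Phi> that plus_part_closed[OF two \<theta> that]
    by (simp_all add: exceptional_on_roots_3_def Let_def lin_append_zero x1_def xm1_def num flip: append.simps append_assoc)
  have upt: "[1..<4 + 1] = [1, 2, 3, 4::nat]" "[1..<Suc 4] = [1, 2, 3, 4::nat]" "[1..<5] = [1, 2, 3, 4::nat]"
    by (simp_all add: upt_rec One_nat_def)
  show "\<Phi> (x2_3 R s) = x2_3 R s" "\<Phi> (xm2_3 R s) = xm2_3 R s" if "s \<in> sym_part R \<theta>"
    using \<Phi> that two
    by (simp_all add: exceptional_on_roots_3_def Let_def sym_part_def x2_3_def xm2_3_def a_minus_def Units_closed)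
       (simp_all add: lin_lmat llin_def idm_def cf_def upt)
qed

lemma exceptional_on_roots_4_zero:
  assumes two: "two R \<in> Units R" and \<theta>: "\<theta> \<in> Ring.ring_hom R R" and \<Phi>: "exceptional_on_roots_4 R \<theta> \<zero> \<Phi>"
  shows "t \<in> carrier R \<Longrightarrow> \<Phi> (x1 R \<theta> 4 t) = x1 R \<theta> 4 t" "t \<in> carrier R \<Longrightarrow> \<Phi> (xm1 R \<theta> 4 t) = xm1 R \<theta> 4 t"
    and "(t, u) \<in> param_A R \<theta> \<Longrightarrow> \<Phi> (lin R 5 (x2_4_list R \<theta> t u)) = lin R 5 (x2_4_list R \<theta> t u)"
      "(t, u) \<in> param_A R \<theta> \<Longrightarrow> \<Phi> (lin R 5 (xm2_4_list R \<theta> t u)) = lin R 5 (xm2_4_list R \<theta> t u)"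
proof -
  interpret M: Group.monoid "Mat R {1..5::nat}" by (rule monoid_Mat) simp
  have upt: "[1..<5 + 1] = [1, 2, 3, 4, 5::nat]" "[1..<Suc 5] = [1, 2, 3, 4, 5::nat]" "[1..<6] = [1, 2, 3, 4, 5::nat]"
    "[0..<5] = [0, 1, 2, 3, 4::nat]"
    by (simp_all add: upt_rec One_nat_def)
  have num: "4 + 1 = (5::nat)" by simp
  have one: "lin R 5 (cf \<one> [(1,1),(2,2),(4,4),(5,5)] @ [(\<one>,3,3)]) = \<one>\<^bsub>Mat R {1..5}\<^esub>"
    by (simp add: lin_lmat llin_def lmat_one cf_def upt)
  have c: "lin R 5 xs \<in> carrier (Mat R {1..5})" if "\<And>a k l. (a, k, l) \<in> set xs \<Longrightarrow> a \<in> carrier R" for xs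
  proof -
    have "foldr (\<lambda>(a, k, l) s. if k = i \<and> l = j then a \<oplus> s else s) xs \<zero> \<in> carrier R" for i j
      using that
    proof (induction xs)
      case (Cons x xs)
      obtain a k l where x: "x = (a, k, l)" by (cases x)
      have "a \<in> carrier R" by (rule Cons.prems[of _ k l]) (simp add: x)
      moreover have "foldr (\<lambda>(a, k, l) s. if k = i \<and> l = j then a \<oplus> s else s) xs \<zero> \<in> carrier R"
        by (rule Cons.IH) (use Cons.prems in \<open>meson list.set_intros(2)\<close>)
      ultimately show ?case by (simp add: x)
    qed simp
    then show ?thesis unfolding lin_def by (rule Mat_carrierI)
  qed
  show "\<Phi> (x1 R \<theta> 4 t) = x1 R \<theta> 4 t" "\<Phi> (xm1 R \<theta> 4 t) = xm1 R \<theta> 4 t" if t: "t \<in> carrier R"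
  proof -
    have "x1 R \<theta> 4 t \<in> carrier (Mat R {1..5})" "xm1 R \<theta> 4 t \<in> carrier (Mat R {1..5})"
      unfolding x1_def xm1_def num
      by (rule c, use t ring_hom_closed[OF \<theta> t] in \<open>auto simp: idm_def cf_def\<close>)+
    then show "\<Phi> (x1 R \<theta> 4 t) = x1 R \<theta> 4 t" "\<Phi> (xm1 R \<theta> 4 t) = xm1 R \<theta> 4 t"
      using \<Phi> t plus_part_closed[OF two \<theta> t]
      by (simp_all add: exceptional_on_roots_4_def Let_def one a_minus_def)
  qed
  show "\<Phi> (lin R 5 (x2_4_list R \<theta> t u)) = lin R 5 (x2_4_list R \<theta> t u)"
    "\<Phi> (lin R 5 (xm2_4_list R \<theta> t u)) = lin R 5 (xm2_4_list R \<theta> t u)" if tu: "(t, u) \<in> param_A R \<theta>"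
  proof -
    have "t \<in> carrier R" using tu by (simp add: param_A_def)
    then show "\<Phi> (lin R 5 (x2_4_list R \<theta> t u)) = lin R 5 (x2_4_list R \<theta> t u)"
      "\<Phi> (lin R 5 (xm2_4_list R \<theta> t u)) = lin R 5 (xm2_4_list R \<theta> t u)"
      using \<Phi> tu plus_part_closed[OF two \<theta>]
      by (auto simp: exceptional_on_roots_4_def Let_def lin_append_zero simp flip: append_assoc)
  qed
qed

end

theorem proposition3p9:
  fixes R :: "'a ring"
    and \<theta> :: "'a \<Rightarrow> 'a"
    and n :: nat
    and \<pi> :: isogeny
    and \<delta> :: 'a
    and \<Theta> :: "(nat list \<Rightarrow> nat list \<Rightarrow> 'a) \<Rightarrow> nat list \<Rightarrow> nat list \<Rightarrow> 'a"
  assumes "local_cring R"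
    and "two R \<in> Units R"
    and "ring_involution R \<theta>"
    and "\<exists>r\<in>carrier R. \<theta> r \<noteq> r"
    and "n = 3 \<or> (n = 4 \<and> \<pi> \<noteq> MID)"
    and "\<delta> \<in> exceptional_params R \<theta>"
    and "is_exceptional_aut R \<theta> n \<pi> \<delta> \<Theta>"
  shows "\<Theta> \<in> standard_auts TYPE('b) R \<theta> n \<pi> \<longleftrightarrow> \<delta> = \<zero>\<^bsub>R\<^esub>"
proof -
  interpret R: cring R using assms(1) by (simp add: local_cring_def)
  interpret E: elementary_group R \<theta> n
    by unfold_locales (rule R.root_elements_Units[OF assms(3)], use assms(5) in auto)
  have \<theta>: "\<theta> \<in> Ring.ring_hom R R" using assms(3) by (simp add: ring_involution_def ring_iso_def)
  interpret \<theta>: ring_hom_cring R R \<theta> by unfold_locales (fact \<theta>)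
  have \<delta>: "\<delta> \<in> carrier R" "\<theta> \<delta> = \<ominus>\<^bsub>R\<^esub> \<delta>"
    and \<delta>_skew: "\<And>r. r \<in> skew_part R \<theta> \<Longrightarrow> \<delta> \<otimes>\<^bsub>R\<^esub> r = \<zero>\<^bsub>R\<^esub>"
    and \<delta>_unit: "\<And>t. t \<in> Units R \<inter> sym_part R \<theta> \<Longrightarrow> \<delta> \<otimes>\<^bsub>R\<^esub> (t \<otimes>\<^bsub>R\<^esub> t \<ominus>\<^bsub>R\<^esub> \<one>\<^bsub>R\<^esub>) = \<zero>\<^bsub>R\<^esub>"
    using assms(6) by (auto simp: exceptional_params_def skew_part_def)
  obtain \<Phi> where \<Phi>: "\<Phi> \<in> auto (E_sc R \<theta> n)"
      "if n = 3 then exceptional_on_roots_3 R \<theta> \<delta> \<Phi> else exceptional_on_roots_4 R \<theta> \<delta> \<Phi>"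
      "\<And>A. A \<in> carrier (E_sc R \<theta> n) \<Longrightarrow> \<Theta> (rep R n \<pi> A) = rep R n \<pi> (\<Phi> A)"
    and \<Theta>: "\<Theta> \<in> auto (E_grp R \<theta> n \<pi>)"
    using assms(7) by (auto simp: is_exceptional_aut_def)
  have \<delta>_square: "\<delta> \<otimes>\<^bsub>R\<^esub> \<delta> = \<zero>\<^bsub>R\<^esub>"
    \<comment> \<open>\<delta> is itself skew, so it is annihilated by its own
      multiplication.\<close>
    by (rule \<delta>_skew) (simp add: skew_part_def \<delta>)
  have \<delta>_3: "int_embed R 3 \<otimes>\<^bsub>R\<^esub> \<delta> = \<zero>\<^bsub>R\<^esub>"
  proof -
    have two: "two R = int_embed R 2"
      using R.int_embed_simps(3)[of 1 1] by (simp add: two_def R.int_embed_simps)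
    have "\<theta> (two R) = two R" by (simp add: two_def)
    then have "\<delta> \<otimes>\<^bsub>R\<^esub> (two R \<otimes>\<^bsub>R\<^esub> two R \<ominus>\<^bsub>R\<^esub> \<one>\<^bsub>R\<^esub>) = \<zero>\<^bsub>R\<^esub>"
      using assms(2) by (intro \<delta>_unit) (auto simp: sym_part_def)
    moreover have "two R \<otimes>\<^bsub>R\<^esub> two R \<ominus>\<^bsub>R\<^esub> \<one>\<^bsub>R\<^esub> = int_embed R (2 * 2 + - 1)"
      unfolding R.int_embed_simps two a_minus_def ..
    ultimately show ?thesis using \<delta>(1) by (simp add: R.m_comm)
  qed
  interpret W: exceptional_witness R \<theta> n \<delta> \<Phi>
    by unfold_locales (fact \<delta> \<delta>_square \<delta>_3 \<theta> assms(2) \<Phi>(1))+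
  show ?thesis
  proof
    assume "\<Theta> \<in> standard_auts TYPE('b) R \<theta> n \<pi>"
    from standard_aut_class_fun[OF R.is_cring assms(5) E.group_E_grp E.E_grp_subset this]
    obtain \<mu> where \<mu>: "\<mu> \<in> Ring.ring_hom R R"
      "\<And>x. x \<in> center_kernel (E_grp R \<theta> n \<pi>) \<Longrightarrow> class_fun R n \<pi> (\<Theta> x) = \<mu> (class_fun R n \<pi> x)"
      by blast
    have zero: "\<delta> = \<zero>\<^bsub>R\<^esub>"
      if "\<exists>x\<in>center_kernel (E_grp R \<theta> n \<pi>). class_fun R n \<pi> x = W.\<psi> (Dual k 0) \<and>
        class_fun R n \<pi> (\<Theta> x) = W.\<psi> (Dual k c)" "\<not> 3 dvd c" for k c
      using that \<mu> by (intro W.\<delta>_eq_zero[of \<mu> k c]) auto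
    from assms(5) show "\<delta> = \<zero>\<^bsub>R\<^esub>"
    proof
      assume n: "n = 3"
      have roots: "exceptional_on_roots_3 R \<theta> \<delta> \<Phi>" using \<Phi>(2) n by simp
      have num: "n + 1 = 4" using n by simp
      note t1 = W.tracks_x1_3[OF n roots] and t2 = W.tracks_x2_3[OF n roots]
      note m = W.tracks_mult[unfolded num]
      have "x1_list n = x1_list 3" using n by simp
      note t1 = t1[unfolded this]
      \<comment> \<open>The products are the words \<open>u\<close>, \<open>v\<close>,
        \<open>u'\<close>, \<open>v'\<close> of \<open>class_values_3\<close>, in this order;
        unification with its inverse identities fixes the integer parameters.\<close>
      note w = W.commutator_witness[unfolded num, OF m[OF t2(1) t2(2)] m[OF t1 t2(1)] m[OF t2(2) t2(1)] m[OF t2(1) t1]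
          class_values_3(1,2) \<Phi>(3)]
      have "3 + 1 = (4 :: nat)" by simp
      note cv = class_values_3(3-8)[unfolded lcomm_def this]
      show ?thesis
      proof (cases \<pi>)
        case SC
        show ?thesis by (rule zero[of 5 "-2"]) (use w in \<open>unfold SC cv\<close>, simp_all)
      next
        case MID
        show ?thesis by (rule zero[of 832 "-320"]) (use w in \<open>unfold MID cv\<close>, simp_all)
      next
        case AD
        show ?thesis by (rule zero[of 11025 47680]) (use w in \<open>unfold AD cv\<close>, simp_all)
      qed
    next
      assume "n = 4 \<and> \<pi> \<noteq> MID"
      then have n: "n = 4" and \<pi>: "\<pi> \<noteq> MID" by auto
      have roots: "exceptional_on_roots_4 R \<theta> \<delta> \<Phi>" using \<Phi>(2) n by simp
      have num: "n + 1 = 5" using n by simp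
      have at_n: "x1_list n = x1_list 4" "xm1_list n = xm1_list 4" using n by simp_all
      note t1 = W.tracks_x1_4[OF n roots, unfolded at_n]
      \<comment> \<open>Both parameter pairs occur because inversion sends \<open>(t, u)\<close> to
        \<open>(- t, \<theta> u)\<close>, here \<open>(-2, 2)\<close> to
        \<open>(2, 2)\<close>.\<close>
      have t2: "W.tracks (x2_4_dual (Dual (-2) 0) (Dual 2 0)) (x2_4_image (Dual (-2) 0) (Dual 2 0))"
        "W.tracks (x2_4_dual (Dual 2 0) (Dual 2 0)) (x2_4_image (Dual 2 0) (Dual 2 0))"
        by (rule W.tracks_x2_4[OF n roots]; simp)+
      note m = W.tracks_mult[unfolded num]
      note w = W.commutator_witness[unfolded num, OF m[OF t1(1) t1(2)] m[OF t2(1) t1(1)] m[OF t1(2) t1(1)] m[OF t1(1) t2(2)]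
          class_values_4(1,2) \<Phi>(3)]
      have "4 + 1 = (5 :: nat)" by simp
      note cv = class_values_4(3-6)[unfolded lcomm_def this]
      show ?thesis
      proof (cases \<pi>)
        case SC
        show ?thesis by (rule zero[of 7 "-64"]) (use w in \<open>unfold SC cv\<close>, simp_all)
      next
        case AD
        show ?thesis by (rule zero[of 69825 471520]) (use w in \<open>unfold AD cv\<close>, simp_all)
      qed (use \<pi> in simp)
    qed
  next
    assume 0: "\<delta> = \<zero>\<^bsub>R\<^esub>"
    have "\<Phi> x = x" if "x \<in> root_elements R \<theta> n" for x
      using assms(5)
    proof
      assume n: "n = 3"
      then have roots: "exceptional_on_roots_3 R \<theta> \<zero>\<^bsub>R\<^esub> \<Phi>" using \<Phi>(2) 0 by simp
      show "\<Phi> x = x"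
        using that n R.exceptional_on_roots_3_zero[OF assms(2) \<theta> roots] by (auto simp: root_elements_def)
    next
      assume "n = 4 \<and> \<pi> \<noteq> MID"
      then have n: "n = 4" and roots: "exceptional_on_roots_4 R \<theta> \<zero>\<^bsub>R\<^esub> \<Phi>" using \<Phi>(2) 0 by auto
      show "\<Phi> x = x"
        using that n R.exceptional_on_roots_4_zero[OF assms(2) \<theta> roots] by (auto simp: root_elements_def)
    qed
    then have "\<Theta> x = x" if "x \<in> carrier (E_grp R \<theta> n \<pi>)" for x
      using that \<Phi>(3) E.auto_fixing_roots[OF \<Phi>(1)] by (auto simp: E.carrier_E_grp)
    moreover have "mat_map (rep_index n \<pi>) (\<lambda>r. r) x = x" if "x \<in> carrier (E_grp R \<theta> n \<pi>)" for x
      using subsetD[OF E.E_grp_subset that] unfolding mat_map_def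
      by (intro Mat_eqI[of _ R "rep_index n \<pi>"] Mat_carrierI) (auto dest: Mat_carrierD simp del: rep_index.simps)
    moreover have "(\<lambda>r. r) \<in> ring_iso R R"
      by (auto simp: ring_iso_def Ring.ring_hom_def bij_betw_def)
    \<comment> \<open>\<Theta> acts as the identity on the group, which is the ring automorphism
      induced by the identity of \<open>R\<close>, and a single factor counts as a
      composition.\<close>
    ultimately have "\<Theta> \<in> ring_auts R \<theta> n \<pi>"
      using \<Theta> by (auto simp: ring_auts_def intro!: bexI[of _ "\<lambda>r. r"])
    then show "\<Theta> \<in> standard_auts TYPE('b) R \<theta> n \<pi>"
      unfolding standard_auts_def by (intro compositions.single) blast
  qed
qed

end
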